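(* (1) The construction $\widehat{\mathrm{TKK}}$ defines a functor from the category of Jordan pairs to the category of $3$-graded Lie algebras and graded homomorphisms which is left adjoint to the forgetful functor $L\mapsto(L_{-1},L_1)$, $\alpha\mapsto(\alpha_{-1},\alpha_1)$, and this functor is full and faithful. (2) The construction $T\mapsto(\widehat{\mathrm{TKK}}((T,T)),\widehat\kappa)$ defines a functor from the category of Jordan triple systems to the category of $3$-graded Lie algebras with fixed anti-graded involution and graded involutary homomorphisms which is left adjoint to the forgetful functor $(L,\varepsilon)\mapsto\mathcal F_{\mathcal T}(L,\varepsilon)$, $\alpha\mapsto\alpha_1$, and this functor is full and faithful. (3) The construction $J\mapsto(\widehat{\mathrm{TKK}}((J,J)),\widehat{\mathfrak s})$ defines a functor from the category of unital Jordan algebras (with unital homomorphisms) to the category of $\mathrm{A}_1$-graded Lie algebras and $\mathrm{A}_1$-graded morphisms which is left adjoint to the forgetful functor $(L,\mathfrak s)\mapsto\mathcal F_{\mathcal{JA}}(L,\mathfrak s)$, $\alpha\mapsto\alpha_1$, and this functor is full and faithful.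
   Context: $k$ is a unital commutative ring with no $2$- or $3$-torsion; all modules, algebras and tensor products are over $k$. A subscript $\sigma$ denotes an element of $\{-,+\}$. Jordan pair: a pair of $k$-modules $P=(P_-,P_+)$ with trilinear maps $\{\,,\,,\,\}_\sigma:P_\sigma\times P_{-\sigma}\times P_\sigma\to P_\sigma$ such that, with $V_{a,b}c=\{a,b,c\}_\sigma$, $\{a,b,c\}=\{c,b,a\}$ and $[V_{a,b},V_{c,d}]=V_{V_{a,b}c,d}-V_{c,V_{b,a}d}$ for $a,c\in P_\sigma$, $b,d\in P_{-\sigma}$. A homomorphism $\gamma:P\to Q$ is a pair of linear maps $\gamma_\sigma:P_\sigma\to Q_\sigma$ with $\gamma_\sigma\{a,b,c\}=\{\gamma_\sigma a,\gamma_{-\sigma}b,\gamma_\sigma c\}$. Jordan triple system: a $k$-module $T$ with a trilinear product satisfying the same two identities for all elements of $T$; homomorphisms preserve the product; its Jordan pair is $(T,T)$ with both products equal to that of $T$. Unital Jordan algebra $J$: bilinear product with $ab=ba$, $(a^2b)a=a^2(ba)$, identity $1$. $J$ is a triple system under $\{a,b,c\}=(ab)c+a(bc)-b(ca)$ and its Jordan pair is $(J,J)$. For $x$ in $T$ or $J$, $x_\pm$ denotes its copy in the $\pm$ component; $2$ means $2\cdot 1\in J$. Construction of $\widehat{\mathrm{TKK}}(P)$. For $a\in P_-$, $b\in P_+$ put $\nu(a,b)=(V_{a,b},-V_{b,a})\in\mathfrak{gl}(P_-)\oplus\mathfrak{gl}(P_+)$. Such operators $X$ act on $P_-\otimes P_+$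 by $X(a\otimes b)=Xa\otimes b+a\otimes Xb$. Let $\lambda(a\otimes b)=\nu(a,b)$ extended linearly, $A(P_-\otimes P_+)=\mathrm{span}\{\lambda(m)m:m\in P_-\otimes P_+\}$, and $\langle P_-,P_+\rangle=(P_-\otimes P_+)/A(P_-\otimes P_+)$ with $\langle a,b\rangle$ the coset of $a\otimes b$. It is a Lie algebra under $[\langle a,b\rangle,\langle c,d\rangle]=\langle\{a,b,c\},d\rangle-\langle c,\{b,a,d\}\rangle$, and acts on $P_\pm$ by $\langle a,b\rangle c=\{a,b,c\}$ ($c\in P_-$), $\langle a,b\rangle d=-\{b,a,d\}$ ($d\in P_+$). $\widehat{\mathrm{TKK}}(P)=P_-\oplus\langle P_-,P_+\rangle\oplus P_+$ (degrees $-1,0,1$) is the $3$-graded Lie algebra with bracket $[a+X+b,c+Y+d]=(Xc-Ya)+([X,Y]+\langle a,d\rangle-\langle c,b\rangle)+(Xd-Yb)$. On a homomorphism $\gamma:P\to Q$ of Jordan pairs, $\widehat{\mathrm{TKK}}(\gamma)$ sends $a+\sum_i\langle c_i,d_i\rangle+b$ to $\gamma_-(a)+\sum_i\langle\gamma_-(c_i),\gamma_+(d_i)\rangle+\gamma_+(b)$; on homomorphisms $\gamma$ of triple systems or unital Jordan algebras one applies this to $(\gamma,\gamma)$. A $3$-graded Lie algebra is $L=L_{-1}\oplus L_0\oplus L_1$ with $[L_i,L_j]\subseteq L_{i+j}$ ($L_i=0$ for $|i|>1$). The pair $(L_{-1},L_1)$ is a Jordan pair with $\{a,b,c\}_\sigma=[[a,b],c]$.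 A graded homomorphism $\alpha:L\to K$ satisfies $\alpha(L_i)\subseteq K_i$, and $\alpha_i=\alpha|_{L_i}$. An anti-graded involution of $L$ is a Lie homomorphism $\varepsilon:L\to L$ with $\varepsilon^2=\mathrm{id}$, $\varepsilon(L_i)\subseteq L_{-i}$; a homomorphism $\alpha:(L,\varepsilon_L)\to(K,\varepsilon_K)$ is involutary if $\alpha\varepsilon_L=\varepsilon_K\alpha$. $\mathcal F_{\mathcal T}(L,\varepsilon)$ is the Jordan triple system $L_1$ with $\{a,b,c\}=[[a,\varepsilon(b)],c]$. The involution $\widehat\kappa$ of $\widehat{\mathrm{TKK}}((T,T))$ is $\widehat\kappa(a_-+\langle c,d\rangle+b_+)=b_--\langle d,c\rangle+a_+$. An $\mathfrak{sl}_2$-triple is an ordered triple $\langle h,e,f\rangle$ with $[e,f]=h$, $[h,e]=2e$, $[h,f]=-2f$. An $\mathrm{A}_1$-graded Lie algebra is a pair $(L,\mathfrak s)$, $\mathfrak s=\langle h,e,f\rangle$ an $\mathfrak{sl}_2$-triple in $L$, with $L=L_{-1}\oplus L_0\oplus L_1$ for $L_i=\{x:[h,x]=2ix\}$ and $L_0=[L_{-1},L_1]$. An $\mathrm{A}_1$-graded morphism is a Lie homomorphism sending $\mathfrak{sl}_2$-triple to $\mathfrak{sl}_2$-triple elementwise. $\mathcal F_{\mathcal{JA}}(L,\mathfrak s)$ is the unital Jordan algebra $L_1$ with product $ab=[[a,f],b]$ and identity $\tfrac12e$. On $\widehat{\mathrm{TKK}}((J,J))$ one takes $\widehat{\mathfrak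 s}=\langle-\langle1,2\rangle,2_+,1_-\rangle$.
   Formalization: In (3), 2 and 3 are assumed invertible in k, not merely non-torsion: otherwise the identity ½e need not exist (sl_2 over Z), and F_JA(L,s) need not be a Jordan algebra (sl_3 over F_3 with its principal sl_2-triple, as an algebra over Z[1/2]). *)

theory Defs
  imports "HOL-Algebra.Algebra"
begin

section \<open>Categories, functors, adjunctions\<close>

text \<open>
  Morphisms are extensional functions (or pairs of such), which do not record their domain;
  \<open>Cmp C A g f\<close> is the composite \<open>g \<circ> f\<close> of a morphism \<open>f\<close> with domain the object \<open>A\<close> and
  a morphism \<open>g\<close>.
\<close>

record ('o, 'm) category =
  Ob :: "'o set"
  Hom :: "'o \<Rightarrow> 'o \<Rightarrow> 'm set"
  Idn :: "'o \<Rightarrow> 'm"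
  Cmp :: "'o \<Rightarrow> 'm \<Rightarrow> 'm \<Rightarrow> 'm"

definition is_category :: "('o, 'm) category \<Rightarrow> bool" where
  "is_category C \<longleftrightarrow>
     (\<forall>A\<in>Ob C. Idn C A \<in> Hom C A A) \<and>
     (\<forall>A\<in>Ob C. \<forall>B\<in>Ob C. \<forall>D\<in>Ob C. \<forall>f\<in>Hom C A B. \<forall>g\<in>Hom C B D. Cmp C A g f \<in> Hom C A D) \<and>
     (\<forall>A\<in>Ob C. \<forall>B\<in>Ob C. \<forall>f\<in>Hom C A B. Cmp C A f (Idn C A) = f \<and> Cmp C A (Idn C B) f = f) \<and>
     (\<forall>A\<in>Ob C. \<forall>B\<in>Ob C. \<forall>D\<in>Ob C. \<forall>E\<in>Ob C.
        \<forall>f\<in>Hom C A B. \<forall>g\<in>Hom C B D. \<forall>h\<in>Hom C D E.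
          Cmp C A h (Cmp C A g f) = Cmp C A (Cmp C B h g) f)"

definition is_functor ::
  "('o, 'm) category \<Rightarrow> ('p, 'n) category \<Rightarrow> ('o \<Rightarrow> 'p) \<Rightarrow> ('o \<Rightarrow> 'o \<Rightarrow> 'm \<Rightarrow> 'n) \<Rightarrow> bool" where
  "is_functor C D F Fm \<longleftrightarrow>
     is_category C \<and> is_category D \<and>
     (\<forall>A\<in>Ob C. F A \<in> Ob D) \<and>
     (\<forall>A\<in>Ob C. \<forall>B\<in>Ob C. \<forall>f\<in>Hom C A B. Fm A B f \<in> Hom D (F A) (F B)) \<and>
     (\<forall>A\<in>Ob C. Fm A A (Idn C A) = Idn D (F A)) \<and>
     (\<forall>A\<in>Ob C. \<forall>B\<in>Ob C. \<forall>E\<in>Ob C. \<forall>f\<in>Hom C A B. \<forall>g\<in>Hom C B E.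
        Fm A E (Cmp C A g f) = Cmp D (F A) (Fm B E g) (Fm A B f))"

definition is_full ::
  "('o, 'm) category \<Rightarrow> ('p, 'n) category \<Rightarrow> ('o \<Rightarrow> 'p) \<Rightarrow> ('o \<Rightarrow> 'o \<Rightarrow> 'm \<Rightarrow> 'n) \<Rightarrow> bool" where
  "is_full C D F Fm \<longleftrightarrow> (\<forall>A\<in>Ob C. \<forall>B\<in>Ob C. Hom D (F A) (F B) \<subseteq> Fm A B ` Hom C A B)"

definition is_faithful ::
  "('o, 'm) category \<Rightarrow> ('o \<Rightarrow> 'o \<Rightarrow> 'm \<Rightarrow> 'n) \<Rightarrow> bool" where
  "is_faithful C Fm \<longleftrightarrow> (\<forall>A\<in>Ob C. \<forall>B\<in>Ob C. inj_on (Fm A B) (Hom C A B))"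

text \<open>
  The objects of a category in HOL have their carriers in fixed types, and the left adjoints below
  change the carrier types. So the hom-set functors \<open>Hom (F -, -)\<close> and \<open>Hom (-, U -)\<close>
  of an adjunction are given explicitly as functors \<open>C\<^sup>o\<^sup>p \<times> D \<rightarrow> Sets\<close>:
  \<open>bi_map H A' A B B' f g\<close>, for \<open>f : A' \<rightarrow> A\<close> and \<open>g : B \<rightarrow> B'\<close>, maps \<open>bi_set H A B\<close> to
  \<open>bi_set H A' B'\<close>.
\<close>

record ('c, 'f, 'd, 'g, 'x) hom_bifunctor =
  bi_set :: "'c \<Rightarrow> 'd \<Rightarrow> 'x set"
  bi_map :: "'c \<Rightarrow> 'c \<Rightarrow> 'd \<Rightarrow> 'd \<Rightarrow> 'f \<Rightarrow> 'g \<Rightarrow> 'x \<Rightarrow> 'x"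

definition naturally_isomorphic ::
  "('c, 'f) category \<Rightarrow> ('d, 'g) category \<Rightarrow>
   ('c, 'f, 'd, 'g, 'x) hom_bifunctor \<Rightarrow> ('c, 'f, 'd, 'g, 'y) hom_bifunctor \<Rightarrow> bool" where
  "naturally_isomorphic C D H K \<longleftrightarrow>
     (\<exists>\<theta>. (\<forall>A\<in>Ob C. \<forall>B\<in>Ob D. bij_betw (\<theta> A B) (bi_set H A B) (bi_set K A B)) \<and>
          (\<forall>A\<in>Ob C. \<forall>A'\<in>Ob C. \<forall>B\<in>Ob D. \<forall>B'\<in>Ob D.
             \<forall>f\<in>Hom C A' A. \<forall>g\<in>Hom D B B'. \<forall>x\<in>bi_set H A B.
               \<theta> A' B' (bi_map H A' A B B' f g x) = bi_map K A' A B B' f g (\<theta> A B x)))"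


section \<open>Modules\<close>

definition no_torsion :: "('k, 'r) ring_scheme \<Rightarrow> nat \<Rightarrow> bool" where
  "no_torsion R n \<longleftrightarrow> (\<forall>x\<in>carrier R. [n] \<cdot>\<^bsub>R\<^esub> x = \<zero>\<^bsub>R\<^esub> \<longrightarrow> x = \<zero>\<^bsub>R\<^esub>)"

definition linear_map ::
  "('k, 'r) ring_scheme \<Rightarrow> ('k, 'a, 'x) module_scheme \<Rightarrow> ('k, 'b, 'y) module_scheme \<Rightarrow>
   ('a \<Rightarrow> 'b) \<Rightarrow> bool" where
  "linear_map R M N f \<longleftrightarrow>
     f \<in> carrier M \<rightarrow> carrier N \<and>
     (\<forall>x\<in>carrier M. \<forall>y\<in>carrier M. f (x \<oplus>\<^bsub>M\<^esub> y) = f x \<oplus>\<^bsub>N\<^esub> f y) \<and>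
     (\<forall>r\<in>carrier R. \<forall>x\<in>carrier M. f (r \<odot>\<^bsub>M\<^esub> x) = r \<odot>\<^bsub>N\<^esub> f x)"

definition bilinear_map ::
  "('k, 'r) ring_scheme \<Rightarrow> ('k, 'a, 'x) module_scheme \<Rightarrow> ('k, 'b, 'y) module_scheme \<Rightarrow>
   ('k, 'c, 'z) module_scheme \<Rightarrow> ('a \<Rightarrow> 'b \<Rightarrow> 'c) \<Rightarrow> bool" where
  "bilinear_map R M N K f \<longleftrightarrow>
     (\<forall>y\<in>carrier N. linear_map R M K (\<lambda>x. f x y)) \<and>
     (\<forall>x\<in>carrier M. linear_map R N K (\<lambda>y. f x y))"

definition trilinear_map ::
  "('k, 'r) ring_scheme \<Rightarrow> ('k, 'a, 'x) module_scheme \<Rightarrow> ('k, 'b, 'y) module_scheme \<Rightarrow>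
   ('k, 'c, 'z) module_scheme \<Rightarrow> ('k, 'd, 'w) module_scheme \<Rightarrow> ('a \<Rightarrow> 'b \<Rightarrow> 'c \<Rightarrow> 'd) \<Rightarrow> bool" where
  "trilinear_map R M N K W f \<longleftrightarrow>
     (\<forall>y\<in>carrier N. \<forall>z\<in>carrier K. linear_map R M W (\<lambda>x. f x y z)) \<and>
     (\<forall>x\<in>carrier M. \<forall>z\<in>carrier K. linear_map R N W (\<lambda>y. f x y z)) \<and>
     (\<forall>x\<in>carrier M. \<forall>y\<in>carrier N. linear_map R K W (\<lambda>z. f x y z))"

definition module_span ::
  "('k, 'r) ring_scheme \<Rightarrow> ('k, 'a, 'x) module_scheme \<Rightarrow> 'a set \<Rightarrow> 'a set" where
  "module_span R M S = \<Inter> {N. submodule N R M \<and> S \<subseteq> N}"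

definition restrict_module :: "('k, 'a, 'x) module_scheme \<Rightarrow> 'a set \<Rightarrow> ('k, 'a) module" where
  "restrict_module M S = (module.truncate M)\<lparr>carrier := S\<rparr>"

text \<open>The fields \<open>mult\<close> and \<open>one\<close> of a module record play no role for modules.\<close>

definition quotient_module ::
  "('k, 'a, 'x) module_scheme \<Rightarrow> 'a set \<Rightarrow> ('k, 'a set) module" where
  "quotient_module M N =
     \<lparr>carrier = a_rcosets\<^bsub>M\<^esub> N, monoid.mult = undefined, monoid.one = undefined, ring.zero = N,
      ring.add = set_add M, smult = (\<lambda>r Z. \<Union>x\<in>Z. N +>\<^bsub>M\<^esub> (r \<odot>\<^bsub>M\<^esub> x))\<rparr>"

definition free_module :: "('k, 'r) ring_scheme \<Rightarrow> 'i set \<Rightarrow> ('k, 'i \<Rightarrow> 'k) module" where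
  "free_module R I =
     \<lparr>carrier = {f. (\<forall>i\<in>I. f i \<in> carrier R) \<and> (\<forall>i. i \<notin> I \<longrightarrow> f i = \<zero>\<^bsub>R\<^esub>) \<and> finite {i. f i \<noteq> \<zero>\<^bsub>R\<^esub>}},
      monoid.mult = undefined, monoid.one = undefined, ring.zero = (\<lambda>i. \<zero>\<^bsub>R\<^esub>),
      ring.add = (\<lambda>f g i. f i \<oplus>\<^bsub>R\<^esub> g i), smult = (\<lambda>r f i. r \<otimes>\<^bsub>R\<^esub> f i)\<rparr>"

definition free_gen :: "('k, 'r) ring_scheme \<Rightarrow> 'i \<Rightarrow> 'i \<Rightarrow> 'k" where
  "free_gen R j = (\<lambda>i. if i = j then \<one>\<^bsub>R\<^esub> else \<zero>\<^bsub>R\<^esub>)"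


subsection \<open>Tensor products\<close>

definition tensor_relations ::
  "('k, 'r) ring_scheme \<Rightarrow> ('k, 'a, 'x) module_scheme \<Rightarrow> ('k, 'b, 'y) module_scheme \<Rightarrow>
   ('a \<times> 'b \<Rightarrow> 'k) set" where
  "tensor_relations R M N =
     (let F = free_module R (carrier M \<times> carrier N); g = (\<lambda>a b. free_gen R (a, b)) in
      module_span R F
       ({g (a \<oplus>\<^bsub>M\<^esub> a') b \<ominus>\<^bsub>F\<^esub> (g a b \<oplus>\<^bsub>F\<^esub> g a' b) | a a' b.
           a \<in> carrier M \<and> a' \<in> carrier M \<and> b \<in> carrier N} \<union>
        {g a (b \<oplus>\<^bsub>N\<^esub> b') \<ominus>\<^bsub>F\<^esub> (g a b \<oplus>\<^bsub>F\<^esub> g a b') | a b b'.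
           a \<in> carrier M \<and> b \<in> carrier N \<and> b' \<in> carrier N} \<union>
        {g (r \<odot>\<^bsub>M\<^esub> a) b \<ominus>\<^bsub>F\<^esub> r \<odot>\<^bsub>F\<^esub> g a b | r a b.
           r \<in> carrier R \<and> a \<in> carrier M \<and> b \<in> carrier N} \<union>
        {g a (r \<odot>\<^bsub>N\<^esub> b) \<ominus>\<^bsub>F\<^esub> r \<odot>\<^bsub>F\<^esub> g a b | r a b.
           r \<in> carrier R \<and> a \<in> carrier M \<and> b \<in> carrier N}))"

definition tensor_module ::
  "('k, 'r) ring_scheme \<Rightarrow> ('k, 'a, 'x) module_scheme \<Rightarrow> ('k, 'b, 'y) module_scheme \<Rightarrow>
   ('k, ('a \<times> 'b \<Rightarrow> 'k) set) module" where
  "tensor_module R M N =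
     quotient_module (free_module R (carrier M \<times> carrier N)) (tensor_relations R M N)"

definition pure_tensor ::
  "('k, 'r) ring_scheme \<Rightarrow> ('k, 'a, 'x) module_scheme \<Rightarrow> ('k, 'b, 'y) module_scheme \<Rightarrow>
   'a \<Rightarrow> 'b \<Rightarrow> ('a \<times> 'b \<Rightarrow> 'k) set" where
  "pure_tensor R M N a b =
     tensor_relations R M N +>\<^bsub>free_module R (carrier M \<times> carrier N)\<^esub> free_gen R (a, b)"

text \<open>
  The linear map sending \<open>a \<otimes> b\<close> to \<open>\<beta> a b\<close>, for a bilinear map \<open>\<beta>\<close> into \<open>W\<close>: its value on the coset
  \<open>m\<close> is the common value of \<open>\<Sum> f(a,b) \<beta>(a,b)\<close> for the representatives \<open>f\<close> of \<open>m\<close>.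
\<close>

definition tensor_lift ::
  "('k, 'r) ring_scheme \<Rightarrow> ('k, 'w, 'z) module_scheme \<Rightarrow> ('a \<Rightarrow> 'b \<Rightarrow> 'w) \<Rightarrow>
   ('a \<times> 'b \<Rightarrow> 'k) set \<Rightarrow> 'w" where
  "tensor_lift R W \<beta> m =
     the_elem ((\<lambda>f. \<Oplus>\<^bsub>W\<^esub>p\<in>{p. f p \<noteq> \<zero>\<^bsub>R\<^esub>}. f p \<odot>\<^bsub>W\<^esub> \<beta> (fst p) (snd p)) ` m)"


section \<open>Jordan pairs, Jordan triple systems, Jordan algebras\<close>

record ('k, 'a, 'b) jordan_pair =
  jpm :: "('k, 'a) module"
  jpp :: "('k, 'b) module"
  trm :: "'a \<Rightarrow> 'b \<Rightarrow> 'a \<Rightarrow> 'a"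
  trp :: "'b \<Rightarrow> 'a \<Rightarrow> 'b \<Rightarrow> 'b"

text \<open>
  The requirements on the product \<open>t\<close> of the component \<open>M\<close> of a Jordan pair with other component \<open>N\<close>,
  whose product is \<open>s\<close>. The last one is
  \<open>[V\<^bsub>a,b\<^esub>, V\<^bsub>c,d\<^esub>] = V\<^bsub>V\<^bsub>a,b\<^esub>c,d\<^esub> - V\<^bsub>c,V\<^bsub>b,a\<^esub>d\<^esub>\<close> evaluated at \<open>x\<close>.
\<close>

definition jordan_product ::
  "('k, 'r) ring_scheme \<Rightarrow> ('k, 'a, 'x) module_scheme \<Rightarrow> ('k, 'b, 'y) module_scheme \<Rightarrow>
   ('a \<Rightarrow> 'b \<Rightarrow> 'a \<Rightarrow> 'a) \<Rightarrow> ('b \<Rightarrow> 'a \<Rightarrow> 'b \<Rightarrow> 'b) \<Rightarrow> bool" where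
  "jordan_product R M N t s \<longleftrightarrow>
     trilinear_map R M N M M t \<and>
     (\<forall>a\<in>carrier M. \<forall>b\<in>carrier N. \<forall>c\<in>carrier M. t a b c = t c b a) \<and>
     (\<forall>a\<in>carrier M. \<forall>b\<in>carrier N. \<forall>c\<in>carrier M. \<forall>d\<in>carrier N. \<forall>x\<in>carrier M.
        t a b (t c d x) \<ominus>\<^bsub>M\<^esub> t c d (t a b x) = t (t a b c) d x \<ominus>\<^bsub>M\<^esub> t c (s b a d) x)"

definition is_jordan_pair :: "('k, 'r) ring_scheme \<Rightarrow> ('k, 'a, 'b) jordan_pair \<Rightarrow> bool" where
  "is_jordan_pair R P \<longleftrightarrow>
     module R (jpm P) \<and> module R (jpp P) \<and>
     jordan_product R (jpm P) (jpp P) (trm P) (trp P) \<and>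
     jordan_product R (jpp P) (jpm P) (trp P) (trm P)"

definition jp_hom ::
  "('k, 'r) ring_scheme \<Rightarrow> ('k, 'a, 'b) jordan_pair \<Rightarrow> ('k, 'c, 'd) jordan_pair \<Rightarrow>
   (('a \<Rightarrow> 'c) \<times> ('b \<Rightarrow> 'd)) set" where
  "jp_hom R P Q =
     {(\<gamma>m, \<gamma>p).
        \<gamma>m \<in> extensional (carrier (jpm P)) \<and> linear_map R (jpm P) (jpm Q) \<gamma>m \<and>
        \<gamma>p \<in> extensional (carrier (jpp P)) \<and> linear_map R (jpp P) (jpp Q) \<gamma>p \<and>
        (\<forall>a\<in>carrier (jpm P). \<forall>b\<in>carrier (jpp P). \<forall>c\<in>carrier (jpm P).
           \<gamma>m (trm P a b c) = trm Q (\<gamma>m a) (\<gamma>p b) (\<gamma>m c)) \<and>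
        (\<forall>a\<in>carrier (jpp P). \<forall>b\<in>carrier (jpm P). \<forall>c\<in>carrier (jpp P).
           \<gamma>p (trp P a b c) = trp Q (\<gamma>p a) (\<gamma>m b) (\<gamma>p c))}"

definition jp_comp ::
  "('k, 'a, 'b) jordan_pair \<Rightarrow> ('c \<Rightarrow> 'e) \<times> ('d \<Rightarrow> 'f) \<Rightarrow> ('a \<Rightarrow> 'c) \<times> ('b \<Rightarrow> 'd) \<Rightarrow>
   ('a \<Rightarrow> 'e) \<times> ('b \<Rightarrow> 'f)" where
  "jp_comp P \<delta> \<gamma> =
     (compose (carrier (jpm P)) (fst \<delta>) (fst \<gamma>), compose (carrier (jpp P)) (snd \<delta>) (snd \<gamma>))"

type_synonym ('k, 'a, 'b) jp_category =
  "(('k, 'a, 'b) jordan_pair, ('a \<Rightarrow> 'a) \<times> ('b \<Rightarrow> 'b)) category"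

definition jp_cat ::
  "('k, 'r) ring_scheme \<Rightarrow> ('k, 'a, 'b) jp_category" where
  "jp_cat R =
     \<lparr>Ob = {P. is_jordan_pair R P}, Hom = jp_hom R,
      Idn = (\<lambda>P. (\<lambda>x\<in>carrier (jpm P). x, \<lambda>x\<in>carrier (jpp P). x)), Cmp = jp_comp\<rparr>"

record ('k, 'a) triple_system = "('k, 'a) module" +
  trip :: "'a \<Rightarrow> 'a \<Rightarrow> 'a \<Rightarrow> 'a"

definition is_jordan_triple_system :: "('k, 'r) ring_scheme \<Rightarrow> ('k, 'a) triple_system \<Rightarrow> bool" where
  "is_jordan_triple_system R T \<longleftrightarrow> module R T \<and> jordan_product R T T (trip T) (trip T)"

definition jts_hom ::
  "('k, 'r) ring_scheme \<Rightarrow> ('k, 'a) triple_system \<Rightarrow> ('k, 'b) triple_system \<Rightarrow> ('a \<Rightarrow> 'b) set" where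
  "jts_hom R T U =
     {\<gamma> \<in> extensional (carrier T). linear_map R T U \<gamma> \<and>
        (\<forall>a\<in>carrier T. \<forall>b\<in>carrier T. \<forall>c\<in>carrier T.
           \<gamma> (trip T a b c) = trip U (\<gamma> a) (\<gamma> b) (\<gamma> c))}"

type_synonym ('k, 'a) jts_category =
  "(('k, 'a) triple_system, 'a \<Rightarrow> 'a) category"

definition jts_cat :: "('k, 'r) ring_scheme \<Rightarrow> ('k, 'a) jts_category" where
  "jts_cat R =
     \<lparr>Ob = {T. is_jordan_triple_system R T}, Hom = jts_hom R,
      Idn = (\<lambda>T. \<lambda>x\<in>carrier T. x), Cmp = (\<lambda>T. compose (carrier T))\<rparr>"

definition jp_of_jts :: "('k, 'a) triple_system \<Rightarrow> ('k, 'a, 'a) jordan_pair" where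
  "jp_of_jts T = \<lparr>jpm = module.truncate T, jpp = module.truncate T, trm = trip T, trp = trip T\<rparr>"

text \<open>For Jordan algebras \<open>mult\<close> and \<open>one\<close> are the product and the identity.\<close>

definition is_unital_jordan_algebra :: "('k, 'r) ring_scheme \<Rightarrow> ('k, 'a) module \<Rightarrow> bool" where
  "is_unital_jordan_algebra R J \<longleftrightarrow>
     module R J \<and> bilinear_map R J J J (monoid.mult J) \<and>
     (\<forall>a\<in>carrier J. \<forall>b\<in>carrier J. a \<otimes>\<^bsub>J\<^esub> b = b \<otimes>\<^bsub>J\<^esub> a) \<and>
     (\<forall>a\<in>carrier J. \<forall>b\<in>carrier J.
        ((a \<otimes>\<^bsub>J\<^esub> a) \<otimes>\<^bsub>J\<^esub> b) \<otimes>\<^bsub>J\<^esub> a = (a \<otimes>\<^bsub>J\<^esub> a) \<otimes>\<^bsub>J\<^esub> (b \<otimes>\<^bsub>J\<^esub> a)) \<and>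
     \<one>\<^bsub>J\<^esub> \<in> carrier J \<and> (\<forall>a\<in>carrier J. \<one>\<^bsub>J\<^esub> \<otimes>\<^bsub>J\<^esub> a = a)"

definition ja_hom ::
  "('k, 'r) ring_scheme \<Rightarrow> ('k, 'a) module \<Rightarrow> ('k, 'b) module \<Rightarrow> ('a \<Rightarrow> 'b) set" where
  "ja_hom R J K =
     {\<gamma> \<in> extensional (carrier J). linear_map R J K \<gamma> \<and>
        (\<forall>a\<in>carrier J. \<forall>b\<in>carrier J. \<gamma> (a \<otimes>\<^bsub>J\<^esub> b) = \<gamma> a \<otimes>\<^bsub>K\<^esub> \<gamma> b) \<and> \<gamma> \<one>\<^bsub>J\<^esub> = \<one>\<^bsub>K\<^esub>}"

type_synonym ('k, 'a) ja_category =
  "(('k, 'a) module, 'a \<Rightarrow> 'a) category"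

definition ja_cat :: "('k, 'r) ring_scheme \<Rightarrow> ('k, 'a) ja_category" where
  "ja_cat R =
     \<lparr>Ob = {J. is_unital_jordan_algebra R J}, Hom = ja_hom R,
      Idn = (\<lambda>J. \<lambda>x\<in>carrier J. x), Cmp = (\<lambda>J. compose (carrier J))\<rparr>"

definition jts_of_ja :: "('k, 'a) module \<Rightarrow> ('k, 'a) triple_system" where
  "jts_of_ja J =
     module.extend J (triple_system.fields
       (\<lambda>a b c. ((a \<otimes>\<^bsub>J\<^esub> b) \<otimes>\<^bsub>J\<^esub> c \<oplus>\<^bsub>J\<^esub> a \<otimes>\<^bsub>J\<^esub> (b \<otimes>\<^bsub>J\<^esub> c)) \<ominus>\<^bsub>J\<^esub> b \<otimes>\<^bsub>J\<^esub> (c \<otimes>\<^bsub>J\<^esub> a)))"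

definition jp_of_ja :: "('k, 'a) module \<Rightarrow> ('k, 'a, 'a) jordan_pair" where
  "jp_of_ja J = jp_of_jts (jts_of_ja J)"


section \<open>Lie algebras\<close>

record ('k, 'a) lie_algebra = "('k, 'a) module" +
  bracket :: "'a \<Rightarrow> 'a \<Rightarrow> 'a"

record ('k, 'a) graded_lie_algebra = "('k, 'a) lie_algebra" +
  grade :: "int \<Rightarrow> 'a set"

definition is_lie_algebra :: "('k, 'r) ring_scheme \<Rightarrow> ('k, 'a, 'x) lie_algebra_scheme \<Rightarrow> bool" where
  "is_lie_algebra R L \<longleftrightarrow>
     module R L \<and> bilinear_map R L L L (bracket L) \<and>
     (\<forall>x\<in>carrier L. bracket L x x = \<zero>\<^bsub>L\<^esub>) \<and>
     (\<forall>x\<in>carrier L. \<forall>y\<in>carrier L. \<forall>z\<in>carrier L.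
        (bracket L x (bracket L y z) \<oplus>\<^bsub>L\<^esub> bracket L y (bracket L z x))
          \<oplus>\<^bsub>L\<^esub> bracket L z (bracket L x y) = \<zero>\<^bsub>L\<^esub>)"

definition lie_hom ::
  "('k, 'r) ring_scheme \<Rightarrow> ('k, 'a, 'x) lie_algebra_scheme \<Rightarrow> ('k, 'b, 'y) lie_algebra_scheme \<Rightarrow>
   ('a \<Rightarrow> 'b) set" where
  "lie_hom R L K =
     {\<alpha> \<in> extensional (carrier L). linear_map R L K \<alpha> \<and>
        (\<forall>x\<in>carrier L. \<forall>y\<in>carrier L. \<alpha> (bracket L x y) = bracket K (\<alpha> x) (\<alpha> y))}"

text \<open>\<open>L = A \<oplus> B \<oplus> C\<close> as a module\<close>

definition is_direct_sum3 ::
  "('k, 'r) ring_scheme \<Rightarrow> ('k, 'a, 'x) module_scheme \<Rightarrow> 'a set \<Rightarrow> 'a set \<Rightarrow> 'a set \<Rightarrow> bool" where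
  "is_direct_sum3 R L A B C \<longleftrightarrow>
     submodule A R L \<and> submodule B R L \<and> submodule C R L \<and>
     (\<forall>x\<in>carrier L. \<exists>!p. p \<in> A \<times> B \<times> C \<and>
        x = (fst p \<oplus>\<^bsub>L\<^esub> fst (snd p)) \<oplus>\<^bsub>L\<^esub> snd (snd p))"


subsection \<open>3-graded Lie algebras\<close>

definition is_3graded ::
  "('k, 'r) ring_scheme \<Rightarrow> ('k, 'a) graded_lie_algebra \<Rightarrow> bool" where
  "is_3graded R L \<longleftrightarrow>
     is_lie_algebra R L \<and>
     is_direct_sum3 R L (grade L (- 1)) (grade L 0) (grade L 1) \<and>
     (\<forall>i. \<bar>i\<bar> > 1 \<longrightarrow> grade L i = {\<zero>\<^bsub>L\<^esub>}) \<and>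
     (\<forall>i j. \<forall>x\<in>grade L i. \<forall>y\<in>grade L j. bracket L x y \<in> grade L (i + j))"

definition graded_hom ::
  "('k, 'r) ring_scheme \<Rightarrow> ('k, 'a) graded_lie_algebra \<Rightarrow> ('k, 'b) graded_lie_algebra \<Rightarrow>
   ('a \<Rightarrow> 'b) set" where
  "graded_hom R L K = {\<alpha> \<in> lie_hom R L K. \<forall>i. \<alpha> ` grade L i \<subseteq> grade K i}"

type_synonym ('k, 'a) gla_category =
  "(('k, 'a) graded_lie_algebra, 'a \<Rightarrow> 'a) category"

definition gla_cat :: "('k, 'r) ring_scheme \<Rightarrow> ('k, 'a) gla_category" where
  "gla_cat R =
     \<lparr>Ob = {L. is_3graded R L}, Hom = graded_hom R,
      Idn = (\<lambda>L. \<lambda>x\<in>carrier L. x), Cmp = (\<lambda>L. compose (carrier L))\<rparr>"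

definition jp_of_gla :: "('k, 'a) graded_lie_algebra \<Rightarrow> ('k, 'a, 'a) jordan_pair" where
  "jp_of_gla L =
     \<lparr>jpm = restrict_module L (grade L (- 1)), jpp = restrict_module L (grade L 1),
      trm = (\<lambda>a b c. bracket L (bracket L a b) c),
      trp = (\<lambda>a b c. bracket L (bracket L a b) c)\<rparr>"

definition jp_of_gla_map ::
  "('k, 'a) graded_lie_algebra \<Rightarrow> ('k, 'b) graded_lie_algebra \<Rightarrow> ('a \<Rightarrow> 'b) \<Rightarrow>
   ('a \<Rightarrow> 'b) \<times> ('a \<Rightarrow> 'b)" where
  "jp_of_gla_map L K \<alpha> = (restrict \<alpha> (grade L (- 1)), restrict \<alpha> (grade L 1))"


subsection \<open>3-graded Lie algebras with anti-graded involution\<close>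

definition is_antigraded_involution ::
  "('k, 'r) ring_scheme \<Rightarrow> ('k, 'a) graded_lie_algebra \<Rightarrow> ('a \<Rightarrow> 'a) \<Rightarrow> bool" where
  "is_antigraded_involution R L \<epsilon> \<longleftrightarrow>
     \<epsilon> \<in> lie_hom R L L \<and> (\<forall>x\<in>carrier L. \<epsilon> (\<epsilon> x) = x) \<and> (\<forall>i. \<epsilon> ` grade L i \<subseteq> grade L (- i))"

definition involutary_hom ::
  "('k, 'r) ring_scheme \<Rightarrow> ('k, 'a) graded_lie_algebra \<times> ('a \<Rightarrow> 'a) \<Rightarrow>
   ('k, 'b) graded_lie_algebra \<times> ('b \<Rightarrow> 'b) \<Rightarrow> ('a \<Rightarrow> 'b) set" where
  "involutary_hom R LE KE =
     {\<alpha> \<in> graded_hom R (fst LE) (fst KE). \<forall>x\<in>carrier (fst LE). \<alpha> (snd LE x) = snd KE (\<alpha> x)}"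

type_synonym ('k, 'a) igla_category =
  "(('k, 'a) graded_lie_algebra \<times> ('a \<Rightarrow> 'a), 'a \<Rightarrow> 'a) category"

definition igla_cat ::
  "('k, 'r) ring_scheme \<Rightarrow> ('k, 'a) igla_category" where
  "igla_cat R =
     \<lparr>Ob = {(L, \<epsilon>). is_3graded R L \<and> is_antigraded_involution R L \<epsilon>}, Hom = involutary_hom R,
      Idn = (\<lambda>LE. \<lambda>x\<in>carrier (fst LE). x), Cmp = (\<lambda>LE. compose (carrier (fst LE)))\<rparr>"

definition jts_of_igla ::
  "('k, 'a) graded_lie_algebra \<times> ('a \<Rightarrow> 'a) \<Rightarrow> ('k, 'a) triple_system" where
  "jts_of_igla LE =
     (case LE of (L, \<epsilon>) \<Rightarrow>
       module.extend (restrict_module L (grade L 1))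
         (triple_system.fields (\<lambda>a b c. bracket L (bracket L a (\<epsilon> b)) c)))"

definition jts_of_igla_map ::
  "('k, 'a) graded_lie_algebra \<times> ('a \<Rightarrow> 'a) \<Rightarrow> ('k, 'b) graded_lie_algebra \<times> ('b \<Rightarrow> 'b) \<Rightarrow>
   ('a \<Rightarrow> 'b) \<Rightarrow> 'a \<Rightarrow> 'b" where
  "jts_of_igla_map LE KE \<alpha> = restrict \<alpha> (grade (fst LE) 1)"


subsection \<open>\<open>A\<^sub>1\<close>-graded Lie algebras\<close>

definition is_sl2_triple :: "('k, 'a, 'x) lie_algebra_scheme \<Rightarrow> 'a \<Rightarrow> 'a \<Rightarrow> 'a \<Rightarrow> bool" where
  "is_sl2_triple L h e f \<longleftrightarrow>
     h \<in> carrier L \<and> e \<in> carrier L \<and> f \<in> carrier L \<and>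
     bracket L e f = h \<and> bracket L h e = [(2::int)] \<cdot>\<^bsub>L\<^esub> e \<and> bracket L h f = [(- 2::int)] \<cdot>\<^bsub>L\<^esub> f"

definition h_grade :: "('k, 'a, 'x) lie_algebra_scheme \<Rightarrow> 'a \<Rightarrow> int \<Rightarrow> 'a set" where
  "h_grade L h i = {x \<in> carrier L. bracket L h x = [(2 * i)] \<cdot>\<^bsub>L\<^esub> x}"

definition is_A1_graded ::
  "('k, 'r) ring_scheme \<Rightarrow> ('k, 'a) lie_algebra \<Rightarrow> 'a \<Rightarrow> 'a \<Rightarrow> 'a \<Rightarrow> bool" where
  "is_A1_graded R L h e f \<longleftrightarrow>
     is_lie_algebra R L \<and> is_sl2_triple L h e f \<and>
     is_direct_sum3 R L (h_grade L h (- 1)) (h_grade L h 0) (h_grade L h 1) \<and>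
     h_grade L h 0 =
       module_span R L {bracket L x y | x y. x \<in> h_grade L h (- 1) \<and> y \<in> h_grade L h 1}"

text \<open>Objects are pairs \<open>(L, (h, e, f))\<close>.\<close>

definition A1_hom ::
  "('k, 'r) ring_scheme \<Rightarrow> ('k, 'a) lie_algebra \<times> 'a \<times> 'a \<times> 'a \<Rightarrow>
   ('k, 'b) lie_algebra \<times> 'b \<times> 'b \<times> 'b \<Rightarrow> ('a \<Rightarrow> 'b) set" where
  "A1_hom R LS KS =
     (case LS of (L, h, e, f) \<Rightarrow> case KS of (K, h', e', f') \<Rightarrow>
       {\<alpha> \<in> lie_hom R L K. \<alpha> h = h' \<and> \<alpha> e = e' \<and> \<alpha> f = f'})"

type_synonym ('k, 'a) A1_category =
  "(('k, 'a) lie_algebra \<times> 'a \<times> 'a \<times> 'a, 'a \<Rightarrow> 'a) category"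

definition A1_cat ::
  "('k, 'r) ring_scheme \<Rightarrow> ('k, 'a) A1_category" where
  "A1_cat R =
     \<lparr>Ob = {(L, h, e, f). is_A1_graded R L h e f}, Hom = A1_hom R,
      Idn = (\<lambda>LS. \<lambda>x\<in>carrier (fst LS). x), Cmp = (\<lambda>LS. compose (carrier (fst LS)))\<rparr>"

text \<open>The identity is \<open>\<onehalf>e\<close>; this needs \<open>2\<close> to be invertible in \<open>R\<close>.\<close>

definition ja_of_A1 ::
  "('k, 'r) ring_scheme \<Rightarrow> ('k, 'a) lie_algebra \<times> 'a \<times> 'a \<times> 'a \<Rightarrow> ('k, 'a) module" where
  "ja_of_A1 R LS =
     (case LS of (L, h, e, f) \<Rightarrow>
       (restrict_module L (h_grade L h 1))
         \<lparr>monoid.mult := (\<lambda>a b. bracket L (bracket L a f) b),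
          monoid.one := (inv\<^bsub>R\<^esub> ([(2::nat)] \<cdot>\<^bsub>R\<^esub> \<one>\<^bsub>R\<^esub>)) \<odot>\<^bsub>L\<^esub> e\<rparr>)"

definition ja_of_A1_map ::
  "('k, 'a) lie_algebra \<times> 'a \<times> 'a \<times> 'a \<Rightarrow> ('k, 'b) lie_algebra \<times> 'b \<times> 'b \<times> 'b \<Rightarrow>
   ('a \<Rightarrow> 'b) \<Rightarrow> 'a \<Rightarrow> 'b" where
  "ja_of_A1_map LS KS \<alpha> = (case LS of (L, h, e, f) \<Rightarrow> restrict \<alpha> (h_grade L h 1))"


section \<open>The functor \<open>TKK\<close>\<close>

type_synonym ('k, 'a, 'b) inner = "('a \<times> 'b \<Rightarrow> 'k) set set"
type_synonym ('k, 'a, 'b) tkk = "'a \<times> ('k, 'a, 'b) inner \<times> 'b"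

abbreviation jp_tensor ::
  "('k, 'r) ring_scheme \<Rightarrow> ('k, 'a, 'b) jordan_pair \<Rightarrow> ('k, ('a \<times> 'b \<Rightarrow> 'k) set) module" where
  "jp_tensor R P \<equiv> tensor_module R (jpm P) (jpp P)"

definition jp_lambda ::
  "('k, 'r) ring_scheme \<Rightarrow> ('k, 'a, 'b) jordan_pair \<Rightarrow> ('a \<times> 'b \<Rightarrow> 'k) set \<Rightarrow>
   ('a \<Rightarrow> 'a) \<times> ('b \<Rightarrow> 'b)" where
  "jp_lambda R P m =
     (\<lambda>c. tensor_lift R (jpm P) (\<lambda>a b. trm P a b c) m,
      \<lambda>d. tensor_lift R (jpp P) (\<lambda>a b. \<ominus>\<^bsub>jpp P\<^esub> trp P b a d) m)"

definition tensor_action ::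
  "('k, 'r) ring_scheme \<Rightarrow> ('k, 'a, 'b) jordan_pair \<Rightarrow> ('a \<Rightarrow> 'a) \<times> ('b \<Rightarrow> 'b) \<Rightarrow>
   ('a \<times> 'b \<Rightarrow> 'k) set \<Rightarrow> ('a \<times> 'b \<Rightarrow> 'k) set" where
  "tensor_action R P Z =
     tensor_lift R (jp_tensor R P)
       (\<lambda>a b. pure_tensor R (jpm P) (jpp P) (fst Z a) b
          \<oplus>\<^bsub>jp_tensor R P\<^esub> pure_tensor R (jpm P) (jpp P) a (snd Z b))"

definition inner_relations ::
  "('k, 'r) ring_scheme \<Rightarrow> ('k, 'a, 'b) jordan_pair \<Rightarrow> ('a \<times> 'b \<Rightarrow> 'k) set set" where
  "inner_relations R P =
     module_span R (jp_tensor R P)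
       {tensor_action R P (jp_lambda R P m) m | m. m \<in> carrier (jp_tensor R P)}"

definition inner_module ::
  "('k, 'r) ring_scheme \<Rightarrow> ('k, 'a, 'b) jordan_pair \<Rightarrow> ('k, ('k, 'a, 'b) inner) module" where
  "inner_module R P = quotient_module (jp_tensor R P) (inner_relations R P)"

text \<open>The element \<open>\<langle>a, b\<rangle>\<close>\<close>

definition inner_elem ::
  "('k, 'r) ring_scheme \<Rightarrow> ('k, 'a, 'b) jordan_pair \<Rightarrow> 'a \<Rightarrow> 'b \<Rightarrow> ('k, 'a, 'b) inner" where
  "inner_elem R P a b =
     inner_relations R P +>\<^bsub>jp_tensor R P\<^esub> pure_tensor R (jpm P) (jpp P) a b"

text \<open>The linear map on \<open>\<langle>P\<^sub>-, P\<^sub>+\<rangle>\<close> with \<open>\<langle>a, b\<rangle> \<mapsto> \<beta> a b\<close>, when there is one\<close>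

definition inner_lift ::
  "('k, 'r) ring_scheme \<Rightarrow> ('k, 'w, 'z) module_scheme \<Rightarrow> ('a \<Rightarrow> 'b \<Rightarrow> 'w) \<Rightarrow>
   ('k, 'a, 'b) inner \<Rightarrow> 'w" where
  "inner_lift R W \<beta> x = the_elem (tensor_lift R W \<beta> ` x)"

definition inner_bracket ::
  "('k, 'r) ring_scheme \<Rightarrow> ('k, 'a, 'b) jordan_pair \<Rightarrow>
   ('k, 'a, 'b) inner \<Rightarrow> ('k, 'a, 'b) inner \<Rightarrow> ('k, 'a, 'b) inner" where
  "inner_bracket R P Z Y =
     inner_lift R (inner_module R P)
       (\<lambda>a b. inner_lift R (inner_module R P)
         (\<lambda>c d. inner_elem R P (trm P a b c) d \<ominus>\<^bsub>inner_module R P\<^esub> inner_elem R P c (trp P b a d)) Y) Z"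

definition inner_act_m ::
  "('k, 'r) ring_scheme \<Rightarrow> ('k, 'a, 'b) jordan_pair \<Rightarrow> ('k, 'a, 'b) inner \<Rightarrow> 'a \<Rightarrow> 'a" where
  "inner_act_m R P Z c = inner_lift R (jpm P) (\<lambda>a b. trm P a b c) Z"

definition inner_act_p ::
  "('k, 'r) ring_scheme \<Rightarrow> ('k, 'a, 'b) jordan_pair \<Rightarrow> ('k, 'a, 'b) inner \<Rightarrow> 'b \<Rightarrow> 'b" where
  "inner_act_p R P Z d = inner_lift R (jpp P) (\<lambda>a b. \<ominus>\<^bsub>jpp P\<^esub> trp P b a d) Z"

definition tkk ::
  "('k, 'r) ring_scheme \<Rightarrow> ('k, 'a, 'b) jordan_pair \<Rightarrow>
   ('k, ('k, 'a, 'b) tkk) graded_lie_algebra" where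
  "tkk R P =
     (let M = jpm P; I = inner_module R P; N = jpp P in
      \<lparr>carrier = carrier M \<times> carrier I \<times> carrier N,
       monoid.mult = undefined, monoid.one = undefined,
       ring.zero = (\<zero>\<^bsub>M\<^esub>, \<zero>\<^bsub>I\<^esub>, \<zero>\<^bsub>N\<^esub>),
       ring.add = (\<lambda>(a, Z, b) (c, Y, d). (a \<oplus>\<^bsub>M\<^esub> c, Z \<oplus>\<^bsub>I\<^esub> Y, b \<oplus>\<^bsub>N\<^esub> d)),
       smult = (\<lambda>r (a, Z, b). (r \<odot>\<^bsub>M\<^esub> a, r \<odot>\<^bsub>I\<^esub> Z, r \<odot>\<^bsub>N\<^esub> b)),
       bracket = (\<lambda>(a, Z, b) (c, Y, d).
         (inner_act_m R P Z c \<ominus>\<^bsub>M\<^esub> inner_act_m R P Y a,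
          (inner_bracket R P Z Y \<oplus>\<^bsub>I\<^esub> inner_elem R P a d) \<ominus>\<^bsub>I\<^esub> inner_elem R P c b,
          inner_act_p R P Z d \<ominus>\<^bsub>N\<^esub> inner_act_p R P Y b)),
       grade = (\<lambda>i.
         if i = - 1 then carrier M \<times> {\<zero>\<^bsub>I\<^esub>} \<times> {\<zero>\<^bsub>N\<^esub>}
         else if i = 0 then {\<zero>\<^bsub>M\<^esub>} \<times> carrier I \<times> {\<zero>\<^bsub>N\<^esub>}
         else if i = 1 then {\<zero>\<^bsub>M\<^esub>} \<times> {\<zero>\<^bsub>I\<^esub>} \<times> carrier N
         else {(\<zero>\<^bsub>M\<^esub>, \<zero>\<^bsub>I\<^esub>, \<zero>\<^bsub>N\<^esub>)})\<rparr>)"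

definition tkk_map ::
  "('k, 'r) ring_scheme \<Rightarrow> ('k, 'a, 'b) jordan_pair \<Rightarrow> ('k, 'c, 'd) jordan_pair \<Rightarrow>
   ('a \<Rightarrow> 'c) \<times> ('b \<Rightarrow> 'd) \<Rightarrow> ('k, 'a, 'b) tkk \<Rightarrow> ('k, 'c, 'd) tkk" where
  "tkk_map R P Q \<gamma> =
     restrict (\<lambda>(a, Z, b).
        (fst \<gamma> a,
         inner_lift R (inner_module R Q) (\<lambda>c d. inner_elem R Q (fst \<gamma> c) (snd \<gamma> d)) Z,
         snd \<gamma> b))
       (carrier (tkk R P))"

definition kappa ::
  "('k, 'r) ring_scheme \<Rightarrow> ('k, 'a, 'a) jordan_pair \<Rightarrow> ('k, 'a, 'a) tkk \<Rightarrow> ('k, 'a, 'a) tkk" where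
  "kappa R P =
     restrict (\<lambda>(a, Z, b).
        (b, inner_lift R (inner_module R P) (\<lambda>c d. \<ominus>\<^bsub>inner_module R P\<^esub> inner_elem R P d c) Z, a))
       (carrier (tkk R P))"

definition tkk_jts ::
  "('k, 'r) ring_scheme \<Rightarrow> ('k, 'a) triple_system \<Rightarrow>
   ('k, ('k, 'a, 'a) tkk) graded_lie_algebra \<times> (('k, 'a, 'a) tkk \<Rightarrow> ('k, 'a, 'a) tkk)" where
  "tkk_jts R T = (tkk R (jp_of_jts T), kappa R (jp_of_jts T))"

definition tkk_jts_map ::
  "('k, 'r) ring_scheme \<Rightarrow> ('k, 'a) triple_system \<Rightarrow> ('k, 'b) triple_system \<Rightarrow>
   ('a \<Rightarrow> 'b) \<Rightarrow> ('k, 'a, 'a) tkk \<Rightarrow> ('k, 'b, 'b) tkk" where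
  "tkk_jts_map R T U \<gamma> = tkk_map R (jp_of_jts T) (jp_of_jts U) (\<gamma>, \<gamma>)"

definition tkk_ja ::
  "('k, 'r) ring_scheme \<Rightarrow> ('k, 'a) module \<Rightarrow>
   ('k, ('k, 'a, 'a) tkk) lie_algebra \<times>
     ('k, 'a, 'a) tkk \<times> ('k, 'a, 'a) tkk \<times> ('k, 'a, 'a) tkk" where
  "tkk_ja R J =
     (let P = jp_of_ja J; I = inner_module R P; two = \<one>\<^bsub>J\<^esub> \<oplus>\<^bsub>J\<^esub> \<one>\<^bsub>J\<^esub> in
      (lie_algebra.truncate (tkk R P),
       (\<zero>\<^bsub>J\<^esub>, \<ominus>\<^bsub>I\<^esub> inner_elem R P \<one>\<^bsub>J\<^esub> two, \<zero>\<^bsub>J\<^esub>),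
       (\<zero>\<^bsub>J\<^esub>, \<zero>\<^bsub>I\<^esub>, two),
       (\<one>\<^bsub>J\<^esub>, \<zero>\<^bsub>I\<^esub>, \<zero>\<^bsub>J\<^esub>)))"

definition tkk_ja_map ::
  "('k, 'r) ring_scheme \<Rightarrow> ('k, 'a) module \<Rightarrow> ('k, 'b) module \<Rightarrow>
   ('a \<Rightarrow> 'b) \<Rightarrow> ('k, 'a, 'a) tkk \<Rightarrow> ('k, 'b, 'b) tkk" where
  "tkk_ja_map R J K \<gamma> = tkk_map R (jp_of_ja J) (jp_of_ja K) (\<gamma>, \<gamma>)"


section \<open>The hom-set functors \<open>Hom (TKK -, -)\<close> and \<open>Hom (-, U -)\<close>\<close>

definition hom_from_tkk where
  "hom_from_tkk R =
     \<lparr>bi_set = (\<lambda>P L. graded_hom R (tkk R P) L),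
      bi_map = (\<lambda>P' P L L' \<gamma> \<beta> \<alpha>.
        compose (carrier (tkk R P')) \<beta>
          (compose (carrier (tkk R P')) \<alpha> (tkk_map R P' P \<gamma>)))\<rparr>"

definition hom_to_jp where
  "hom_to_jp R =
     \<lparr>bi_set = (\<lambda>P L. jp_hom R P (jp_of_gla L)),
      bi_map = (\<lambda>P' P L L' \<gamma> \<beta> \<delta>. jp_comp P' (jp_of_gla_map L L' \<beta>) (jp_comp P' \<delta> \<gamma>))\<rparr>"

definition hom_from_tkk_jts where
  "hom_from_tkk_jts R =
     \<lparr>bi_set = (\<lambda>T LE. involutary_hom R (tkk_jts R T) LE),
      bi_map = (\<lambda>T' T LE LE' \<gamma> \<beta> \<alpha>.
        compose (carrier (fst (tkk_jts R T'))) \<beta>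
          (compose (carrier (fst (tkk_jts R T'))) \<alpha> (tkk_jts_map R T' T \<gamma>)))\<rparr>"

definition hom_to_jts where
  "hom_to_jts R =
     \<lparr>bi_set = (\<lambda>T LE. jts_hom R T (jts_of_igla LE)),
      bi_map = (\<lambda>T' T LE LE' \<gamma> \<beta> \<delta>.
        compose (carrier T') (jts_of_igla_map LE LE' \<beta>) (compose (carrier T') \<delta> \<gamma>))\<rparr>"

definition hom_from_tkk_ja where
  "hom_from_tkk_ja R =
     \<lparr>bi_set = (\<lambda>J LS. A1_hom R (tkk_ja R J) LS),
      bi_map = (\<lambda>J' J LS LS' \<gamma> \<beta> \<alpha>.
        compose (carrier (fst (tkk_ja R J'))) \<beta>
          (compose (carrier (fst (tkk_ja R J'))) \<alpha> (tkk_ja_map R J' J \<gamma>)))\<rparr>"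

definition hom_to_ja where
  "hom_to_ja R =
     \<lparr>bi_set = (\<lambda>J LS. ja_hom R J (ja_of_A1 R LS)),
      bi_map = (\<lambda>J' J LS LS' \<gamma> \<beta> \<delta>.
        compose (carrier J') (ja_of_A1_map LS LS' \<beta>) (compose (carrier J') \<delta> \<gamma>))\<rparr>"

end

theory Submission
  imports Defs
begin

text \<open>
  The idea is that \<open>TKK(P)\<close> is the 3-graded Lie algebra freely generated by the Jordan pair \<open>P\<close> in
  degrees \<open>-1\<close> and \<open>1\<close>. In any 3-graded Lie algebra \<open>K\<close> the triple products of \<open>(K\<^sub>-\<^sub>1, K\<^sub>1)\<close> are
  \<open>[[a,b],c]\<close>, so a Jordan pair homomorphism \<open>\<gamma>\<close> from \<open>P\<close> into it can only extend to
  \<open>a + \<langle>c,d\<rangle> + b \<mapsto> \<gamma> a + [\<gamma> c, \<gamma> d] + \<gamma> b\<close>. On \<open>P\<^sub>- \<otimes> P\<^sub>+\<close> the middle term defines a map \<open>lift0\<close> that turns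
  the action \<open>\<lambda>\<close> of the tensor product on itself into the bracket of \<open>K\<close> (\<open>lift0_tact\<close>); hence
  \<open>\<lambda>(m) m\<close> goes to \<open>[x,x] = 0\<close>, and the relations that define \<open>\<langle>P\<^sub>-,P\<^sub>+\<rangle>\<close> are respected. This is the
  bijection of the adjunction (\<open>tkk_restrict_bij\<close>). Since \<open>\<langle>a,b\<rangle> = [a,b]\<close>, a homomorphism on
  \<open>TKK(P)\<close> is determined by its restriction to degrees \<open>-1\<close> and \<open>1\<close>; as the Jordan pair of \<open>TKK(P)\<close> is
  again \<open>P\<close>, the functor is full and faithful.

  That \<open>TKK(P)\<close> is a Lie algebra rests on one fact: the action of \<open>P\<^sub>- \<otimes> P\<^sub>+\<close> on itself and on \<open>P\<close> is
  equivariant, \<open>\<lambda>(\<lambda>(m) u) = [\<lambda>(m), \<lambda>(u)]\<close> (\<open>act_m_tact\<close>, \<open>act_p_tact\<close>, \<open>tact_tact\<close>). It implies that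
  the relations \<open>\<lambda>(m) m\<close> act by zero and span an invariant submodule, so that everything descends to
  the quotient, where the bracket becomes alternating. The Jacobi identity is then a calculation in
  the three components (\<open>tkk_lie\<close>).

  The maps \<open>TKK(\<gamma>)\<close> and \<open>\<kappa>\<close> are themselves such extensions, the latter into \<open>TKK(P)\<close> with reversed
  grading; this gives their multiplicativity without calculation.

  For triple systems a homomorphism \<open>\<gamma>\<close> into \<open>K\<^sub>1\<close> corresponds to the pair \<open>(\<epsilon> \<gamma>, \<gamma>)\<close>.

  For Jordan algebras, \<open>J\<close> is a triple system because \<open>V\<^bsub>a,b\<^esub> = L\<^bsub>ab\<^esub> + [L\<^sub>a, L\<^sub>b]\<close>, where \<open>[L\<^sub>a, L\<^sub>b]\<close> is a
  derivation (\<open>jordan_identity_tr\<close>). Conversely \<open>K\<^sub>1\<close> with \<open>a b = {a, f, b}\<close> is a homotope of the Jordan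
  pair of \<open>K\<close>; it satisfies the Jordan identity because there is no 3-torsion (\<open>homotope_jordan\<close>).
  The component of degree \<open>-1\<close> of the extension of \<open>\<gamma>\<close> is forced to be \<open>x \<mapsto> {f, \<gamma> x, f}\<close>, as
  \<open>x\<^sub>- = {1\<^sub>-, x\<^sub>+, 1\<^sub>-}\<close>; that this is compatible with the triple products (\<open>htr_s\<close>, \<open>htr_t\<close>) uses the
  partner \<open>e\<close> of \<open>f\<close>, with which \<open>{e, {f, x, f}, e} = 4 x\<close>.
\<close>

section \<open>Linear combinations in abelian groups\<close>

text \<open>
  Identities between signed sums are decided by rewriting. The sign is the last argument, so that
  the order used for associative-commutative rewriting compares \<open>x\<close> first: in a sorted sum the
  summands \<open>x\<close> and \<open>-x\<close> are neighbours and cancel.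
\<close>

definition signed :: "('a, 'x) ring_scheme \<Rightarrow> 'a \<Rightarrow> bool \<Rightarrow> 'a" where
  "signed G x s = (if s then \<ominus>\<^bsub>G\<^esub> x else x)"

context abelian_group
begin

lemma eq_if_signed:
  assumes "signed G x False \<oplus> signed G y True = \<zero>" "x \<in> carrier G" "y \<in> carrier G"
  shows "x = y"
  using assms by (metis add.inv_solve_right' l_zero signed_def zero_closed)

lemma signed_closed: "x \<in> carrier G \<Longrightarrow> signed G x s \<in> carrier G"
  by (simp add: signed_def)

lemma signed_push:
  "\<lbrakk>x \<in> carrier G; y \<in> carrier G\<rbrakk> \<Longrightarrow> signed G (x \<oplus> y) s = signed G x s \<oplus> signed G y s"
  "x \<in> carrier G \<Longrightarrow> signed G (\<ominus> x) s = signed G x (\<not> s)"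
  "\<lbrakk>x \<in> carrier G; y \<in> carrier G\<rbrakk> \<Longrightarrow> signed G (x \<ominus> y) s = signed G x s \<oplus> signed G y (\<not> s)"
  "signed G \<zero> s = \<zero>"
  by (auto simp: signed_def minus_eq minus_add)

lemma signed_cancel:
  "x \<in> carrier G \<Longrightarrow> signed G x False \<oplus> signed G x True = \<zero>"
  "x \<in> carrier G \<Longrightarrow> signed G x True \<oplus> signed G x False = \<zero>"
  "\<lbrakk>x \<in> carrier G; y \<in> carrier G\<rbrakk> \<Longrightarrow> signed G x False \<oplus> (signed G x True \<oplus> y) = y"
  "\<lbrakk>x \<in> carrier G; y \<in> carrier G\<rbrakk> \<Longrightarrow> signed G x True \<oplus> (signed G x False \<oplus> y) = y"
  by (auto simp: signed_def r_neg l_neg r_neg1 r_neg2)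

lemmas signed_norm = signed_closed signed_push signed_cancel a_assoc a_comm a_lcomm

end

section \<open>Linear maps, quotients and free modules\<close>

text \<open>
  The modules, triple systems and Lie algebras in play are records of different types that share
  the fields of a module; properties of modules are carried over from one to another by comparing
  these fields.
\<close>

lemma module_cong:
  assumes "module R M" "carrier N = carrier M" "add N = add M" "ring.zero N = ring.zero M" "smult N =
      smult M"
  shows "module R N"
proof -
  interpret M: module R M by fact
  have "abelian_group N"
  proof (rule abelian_groupI)
    fix x assume "x \<in> carrier N"
    then show "\<exists>y\<in>carrier N. y \<oplus>\<^bsub>N\<^esub> x = \<zero>\<^bsub>N\<^esub>"
      using assms by (intro bexI[of _ "\<ominus>\<^bsub>M\<^esub> x"]) (auto simp: M.l_neg)
  qed (use assms in \<open>auto simp: M.a_ac\<close>)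
  then show ?thesis
    using assms M.R.is_cring
      by (intro moduleI) (auto simp: M.smult_l_distr M.smult_r_distr M.smult_assoc1)
qed

lemma a_inv_cong:
  assumes "carrier N = carrier M" "add N = add M" "ring.zero N = ring.zero M"
  shows "a_inv N = a_inv M" "a_minus N = a_minus M"
  using assms by (auto simp: a_inv_def a_minus_def m_inv_def fun_eq_iff)

lemma linear_mapD:
  assumes "linear_map R M N f"
  shows linear_map_closed: "x \<in> carrier M \<Longrightarrow> f x \<in> carrier N"
    and linear_map_add: "\<lbrakk>x \<in> carrier M; y \<in> carrier M\<rbrakk> \<Longrightarrow> f (x \<oplus>\<^bsub>M\<^esub> y) = f x \<oplus>\<^bsub>N\<^esub> f y"
    and linear_map_smult: "\<lbrakk>r \<in> carrier R; x \<in> carrier M\<rbrakk> \<Longrightarrow> f (r \<odot>\<^bsub>M\<^esub> x) = r \<odot>\<^bsub>N\<^esub> f x"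
  using assms by (auto simp: linear_map_def)

lemma linear_mapI:
  assumes "\<And>x. x \<in> carrier M \<Longrightarrow> f x \<in> carrier N"
    and "\<And>x y. \<lbrakk>x \<in> carrier M; y \<in> carrier M\<rbrakk> \<Longrightarrow> f (x \<oplus>\<^bsub>M\<^esub> y) = f x \<oplus>\<^bsub>N\<^esub> f y"
    and "\<And>r x. \<lbrakk>r \<in> carrier R; x \<in> carrier M\<rbrakk> \<Longrightarrow> f (r \<odot>\<^bsub>M\<^esub> x) = r \<odot>\<^bsub>N\<^esub> f x"
  shows "linear_map R M N f"
  using assms by (auto simp: linear_map_def)

lemma linear_map_zero:
  assumes "module R M" "module R N" "linear_map R M N f"
  shows "f \<zero>\<^bsub>M\<^esub> = \<zero>\<^bsub>N\<^esub>"
proof -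
  interpret M: module R M by fact
  interpret N: module R N by fact
  have "f (\<zero>\<^bsub>R\<^esub> \<odot>\<^bsub>M\<^esub> \<zero>\<^bsub>M\<^esub>) = \<zero>\<^bsub>R\<^esub> \<odot>\<^bsub>N\<^esub> f \<zero>\<^bsub>M\<^esub>"
    using assms(3) by (rule linear_map_smult) auto
  then show ?thesis
    using assms(3) by (simp add: linear_map_closed)
qed

lemma linear_map_neg:
  assumes "module R M" "module R N" "linear_map R M N f" "x \<in> carrier M"
  shows "f (\<ominus>\<^bsub>M\<^esub> x) = \<ominus>\<^bsub>N\<^esub> f x"
proof -
  interpret M: module R M by fact
  interpret N: module R N by fact
  have "f ((\<ominus>\<^bsub>R\<^esub> \<one>\<^bsub>R\<^esub>) \<odot>\<^bsub>M\<^esub> x) = (\<ominus>\<^bsub>R\<^esub> \<one>\<^bsub>R\<^esub>) \<odot>\<^bsub>N\<^esub> f x"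
    using assms(3,4) by (simp add: linear_map_smult)
  then show ?thesis
    using assms(3,4) by (simp add: M.smult_l_minus N.smult_l_minus linear_map_closed)
qed

lemma linear_map_minus:
  assumes "module R M" "module R N" "linear_map R M N f" "x \<in> carrier M" "y \<in> carrier M"
  shows "f (x \<ominus>\<^bsub>M\<^esub> y) = f x \<ominus>\<^bsub>N\<^esub> f y"
proof -
  interpret M: module R M by fact
  show ?thesis
    using assms by (simp add: a_minus_def linear_map_neg linear_map_add)
qed

lemma linear_map_comp:
  assumes "linear_map R M N f" "linear_map R N K g"
  shows "linear_map R M K (\<lambda>x. g (f x))"
  using assms by (auto simp: linear_map_def Pi_iff)

lemma linear_map_cong:
  assumes "module R M" "linear_map R M N f" "\<And>x. x \<in> carrier M \<Longrightarrow> g x = f x"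
  shows "linear_map R M N g"
proof -
  interpret M: module R M by fact
  show ?thesis
    using assms(2,3) by (auto simp: linear_map_def Pi_iff)
qed

lemma linear_map_plus:
  assumes "module R N" "linear_map R M N f" "linear_map R M N g"
  shows "linear_map R M N (\<lambda>x. f x \<oplus>\<^bsub>N\<^esub> g x)"
proof -
  interpret N: module R N by fact
  show ?thesis
    using assms(2,3) by (auto simp: linear_map_def Pi_iff N.smult_r_distr N.a_ac)
qed

lemma linear_map_uminus:
  assumes "module R N" "linear_map R M N f"
  shows "linear_map R M N (\<lambda>x. \<ominus>\<^bsub>N\<^esub> f x)"
proof -
  interpret N: module R N by fact
  show ?thesis
    using assms(2) by (auto simp: linear_map_def Pi_iff N.smult_r_minus N.minus_add)
qed

lemma linear_map_diff:
  assumes "module R N" "linear_map R M N f" "linear_map R M N g"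
  shows "linear_map R M N (\<lambda>x. f x \<ominus>\<^bsub>N\<^esub> g x)"
  using assms by (simp add: a_minus_def linear_map_plus linear_map_uminus)

lemma linear_map_kernel:
  assumes "module R M" "module R N" "linear_map R M N f"
  shows "submodule {x \<in> carrier M. f x = \<zero>\<^bsub>N\<^esub>} R M"
proof -
  interpret M: module R M by fact
  interpret N: module R N by fact
  show ?thesis
    using assms by (intro M.submoduleI)
      (auto simp: linear_map_zero linear_map_neg linear_map_add linear_map_smult)
qed

lemma bilinear_mapD:
  assumes "bilinear_map R M N K f"
  shows bilinear_map_left: "y \<in> carrier N \<Longrightarrow> linear_map R M K (\<lambda>x. f x y)"
    and bilinear_map_right: "x \<in> carrier M \<Longrightarrow> linear_map R N K (\<lambda>y. f x y)"
  using assms by (auto simp: bilinear_map_def)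

lemma bilinear_map_comp:
  assumes "bilinear_map R M N K f" "linear_map R K W g"
  shows "bilinear_map R M N W (\<lambda>x y. g (f x y))"
  unfolding bilinear_map_def
  using linear_map_comp[OF bilinear_map_left[OF assms(1)] assms(2)]
    linear_map_comp[OF bilinear_map_right[OF assms(1)] assms(2)] by blast

lemma bilinear_map_precomp:
  assumes "bilinear_map R M N K f" "linear_map R M' M g" "linear_map R N' N h"
  shows "bilinear_map R M' N' K (\<lambda>x y. f (g x) (h y))"
  unfolding bilinear_map_def
  using linear_map_comp[OF assms(2) bilinear_map_left[OF assms(1) linear_map_closed[OF assms(3)]]]
    linear_map_comp[OF assms(3) bilinear_map_right[OF assms(1) linear_map_closed[OF assms(2)]]] by blast

lemma module_span_submodule:
  assumes "module R M" "S \<subseteq> carrier M"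
  shows "submodule (module_span R M S) R M"
proof -
  interpret M: module R M by fact
  have car: "submodule (carrier M) R M \<and> S \<subseteq> carrier M"
    using assms(2) M.carrier_is_submodule by simp
  have zero: "\<zero>\<^bsub>M\<^esub> \<in> N" if "submodule N R M" for N
    using subgroup.one_closed[OF submodule.axioms(1)[OF that]] by simp
  show ?thesis
  proof (rule M.submoduleI)
    show "module_span R M S \<subseteq> carrier M"
      using car by (auto simp: module_span_def)
  qed (simp_all add: module_span_def zero M.submoduleE(3,4,5))
qed

lemma module_span_incl: "S \<subseteq> module_span R M S"
  by (auto simp: module_span_def)

lemma module_span_minimal: "submodule N R M \<Longrightarrow> S \<subseteq> N \<Longrightarrow> module_span R M S \<subseteq> N"
  by (auto simp: module_span_def)

lemma linear_map_zero_on_span: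
  assumes "module R M" "module R N" "linear_map R M N f" "S \<subseteq> carrier M"
    and "\<And>x. x \<in> S \<Longrightarrow> f x = \<zero>\<^bsub>N\<^esub>" and "x \<in> module_span R M S"
  shows "f x = \<zero>\<^bsub>N\<^esub>"
  using module_span_minimal[OF linear_map_kernel[OF assms(1-3)], of S] assms(4-6) by auto

lemma submodule_abelian_subgroup:
  assumes "module R M" "submodule N R M"
  shows "abelian_subgroup N M"
proof -
  interpret M: module R M by fact
  show ?thesis
    using assms(2) submodule.axioms(1)
    by (intro abelian_subgroupI3) (auto intro: additive_subgroup.intro M.abelian_group_axioms)
qed

subsection \<open>Quotient modules\<close>

locale quotient =
  fixes R :: "('k, 'r) ring_scheme" and M :: "('k, 'a, 'x) module_scheme" and N
  assumes module_M: "module R M" and sub: "submodule N R M"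
begin

abbreviation Q where "Q \<equiv> quotient_module M N"

sublocale M: module R M by (fact module_M)
sublocale N: abelian_subgroup N M by (rule submodule_abelian_subgroup[OF module_M sub])

lemma coset_eq_iff:
  "\<lbrakk>x \<in> carrier M; y \<in> carrier M\<rbrakk> \<Longrightarrow> N +>\<^bsub>M\<^esub> x = N +>\<^bsub>M\<^esub> y \<longleftrightarrow> x \<ominus>\<^bsub>M\<^esub> y \<in> N"
  by (metis N.a_rcos_module N.a_rcos_self N.a_repr_independence' M.minus_eq N.a_repr_independenceD)

lemma carrier_Q: "carrier Q = (\<lambda>x. N +>\<^bsub>M\<^esub> x) ` carrier M"
  by (auto simp: quotient_module_def A_RCOSETS_def')

lemma zero_Q: "\<zero>\<^bsub>Q\<^esub> = N +>\<^bsub>M\<^esub> \<zero>\<^bsub>M\<^esub>"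
  using N.a_subset by (simp add: quotient_module_def)

lemma coset_add:
  "\<lbrakk>x \<in> carrier M; y \<in> carrier M\<rbrakk> \<Longrightarrow> (N +>\<^bsub>M\<^esub> x) \<oplus>\<^bsub>Q\<^esub> (N +>\<^bsub>M\<^esub> y) = N +>\<^bsub>M\<^esub> (x \<oplus>\<^bsub>M\<^esub> y)"
  by (simp add: quotient_module_def N.a_rcos_sum)

lemma coset_smult:
  assumes r: "r \<in> carrier R" and x: "x \<in> carrier M"
  shows "r \<odot>\<^bsub>Q\<^esub> (N +>\<^bsub>M\<^esub> x) = N +>\<^bsub>M\<^esub> (r \<odot>\<^bsub>M\<^esub> x)"
proof -
  have "N +>\<^bsub>M\<^esub> (r \<odot>\<^bsub>M\<^esub> y) = N +>\<^bsub>M\<^esub> (r \<odot>\<^bsub>M\<^esub> x)" if y: "y \<in> N +>\<^bsub>M\<^esub> x" for y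
  proof -
    have yM: "y \<in> carrier M"
      using y x by (meson M.a_r_coset_subset_G N.a_subset subsetD)
    have "y \<ominus>\<^bsub>M\<^esub> x \<in> N"
      using y x yM by (simp add: M.minus_eq N.a_rcos_module)
    then have "r \<odot>\<^bsub>M\<^esub> (y \<ominus>\<^bsub>M\<^esub> x) \<in> N"
      using sub r by (simp add: submodule.smult_closed)
    then show ?thesis
      using r x yM by (simp add: coset_eq_iff M.minus_eq M.smult_r_distr M.smult_r_minus)
  qed
  moreover have "N +>\<^bsub>M\<^esub> x \<noteq> {}" using N.a_rcos_self[OF x] by blast
  ultimately have "(\<Union>y\<in>N +>\<^bsub>M\<^esub> x. N +>\<^bsub>M\<^esub> (r \<odot>\<^bsub>M\<^esub> y)) = N +>\<^bsub>M\<^esub> (r \<odot>\<^bsub>M\<^esub> x)"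
    by (intro SUP_eq_const) auto
  then show ?thesis
    by (simp add: quotient_module_def)
qed

lemma module_Q: "module R Q"
proof (rule moduleI)
  show "cring R" by (rule M.R.is_cring)
  show "abelian_group Q"
  proof (rule abelian_groupI)
    fix Z assume "Z \<in> carrier Q"
    then obtain x where "x \<in> carrier M" "Z = N +>\<^bsub>M\<^esub> x" by (auto simp: carrier_Q)
    then show "\<exists>Y\<in>carrier Q. Y \<oplus>\<^bsub>Q\<^esub> Z = \<zero>\<^bsub>Q\<^esub>"
      by (intro bexI[of _ "N +>\<^bsub>M\<^esub> (\<ominus>\<^bsub>M\<^esub> x)"]) (auto simp: carrier_Q coset_add zero_Q M.l_neg)
  qed (auto simp: carrier_Q coset_add zero_Q M.a_ac)
qed (auto simp: carrier_Q coset_add coset_smult M.smult_l_distr M.smult_r_distr M.smult_assoc1)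

lemma coset_linear: "linear_map R M Q (\<lambda>x. N +>\<^bsub>M\<^esub> x)"
  by (rule linear_mapI) (auto simp: carrier_Q coset_add coset_smult)

lemma coset_zero_iff: "x \<in> carrier M \<Longrightarrow> N +>\<^bsub>M\<^esub> x = \<zero>\<^bsub>Q\<^esub> \<longleftrightarrow> x \<in> N"
  using M.add.inv_one by (simp add: zero_Q coset_eq_iff M.minus_eq a_inv_def del: M.a_coset_add_zero)

lemma the_elem_coset:
  assumes W: "module R W" and f: "linear_map R M W f" and zero: "\<And>n. n \<in> N \<Longrightarrow> f n = \<zero>\<^bsub>W\<^esub>"
    and x: "x \<in> carrier M"
  shows "the_elem (f ` (N +>\<^bsub>M\<^esub> x)) = f x"
proof -
  interpret W: module R W by fact
  have "f y = f x" if "y \<in> N +>\<^bsub>M\<^esub> x" for y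
  proof -
    from that obtain n where "n \<in> N" "y = n \<oplus>\<^bsub>M\<^esub> x" by (auto simp: a_r_coset_def')
    then show ?thesis
      using x f zero N.a_subset by (auto simp: linear_map_add linear_map_closed subset_iff)
  qed
  then have "f ` (N +>\<^bsub>M\<^esub> x) = {f x}"
    using N.a_rcos_self[OF x] by blast
  then show ?thesis by simp
qed

lemma linear_the_elem:
  assumes "module R W" and "linear_map R M W f" and "\<And>n. n \<in> N \<Longrightarrow> f n = \<zero>\<^bsub>W\<^esub>"
  shows "linear_map R Q W (\<lambda>Z. the_elem (f ` Z))"
  by (rule linear_mapI)
    (auto simp: carrier_Q coset_add coset_smult the_elem_coset[OF assms] linear_mapD[OF assms(2)])

end

subsection \<open>Free modules\<close>

context
  fixes R :: "('k, 'r) ring_scheme" (structure)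
  assumes R: "cring R"
begin

interpretation cring R by (rule R)

lemma free_module_simps:
  "\<zero>\<^bsub>free_module R I\<^esub> = (\<lambda>i. \<zero>)"
  "f \<oplus>\<^bsub>free_module R I\<^esub> g = (\<lambda>i. f i \<oplus> g i)"
  "r \<odot>\<^bsub>free_module R I\<^esub> f = (\<lambda>i. r \<otimes> f i)"
  by (simp_all add: free_module_def)

lemma free_module_coeff: "f \<in> carrier (free_module R I) \<Longrightarrow> f i \<in> carrier R"
  by (cases "i \<in> I") (auto simp: free_module_def)

lemma free_module_finite: "f \<in> carrier (free_module R I) \<Longrightarrow> finite {i. f i \<noteq> \<zero>}"
  by (auto simp: free_module_def)

lemma free_module_add_closed:
  assumes "f \<in> carrier (free_module R I)" "g \<in> carrier (free_module R I)"
  shows "(\<lambda>i. f i \<oplus> g i) \<in> carrier (free_module R I)"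
proof -
  have "finite {i. f i \<oplus> g i \<noteq> \<zero>}"
    by (rule finite_subset[OF _ finite_UnI[OF assms[THEN free_module_finite]]]) auto
  then show ?thesis
    using assms by (auto simp: free_module_def)
qed

lemma free_module_smult_closed:
  assumes "f \<in> carrier (free_module R I)" "r \<in> carrier R"
  shows "(\<lambda>i. r \<otimes> f i) \<in> carrier (free_module R I)"
proof -
  have "finite {i. r \<otimes> f i \<noteq> \<zero>}"
    by (rule finite_subset[OF _ free_module_finite[OF assms(1)]]) (use assms(2) in auto)
  then show ?thesis
    using assms by (auto simp: free_module_def)
qed

lemma module_free_module: "module R (free_module R I)" (is "module R ?F")
proof (rule moduleI)
  note simps = free_module_simps free_module_coeff[of _ I] fun_eq_iff
  show "cring R" by (rule R)
  show "abelian_group ?F"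
  proof (rule abelian_groupI)
    show "\<zero>\<^bsub>?F\<^esub> \<in> carrier ?F"
      by (simp add: free_module_def)
    fix f assume f: "f \<in> carrier ?F"
    show "\<exists>g\<in>carrier ?F. g \<oplus>\<^bsub>?F\<^esub> f = \<zero>\<^bsub>?F\<^esub>"
    proof
      show "(\<lambda>i. (\<ominus> \<one>) \<otimes> f i) \<in> carrier ?F"
        using f by (rule free_module_smult_closed) simp
      show "(\<lambda>i. (\<ominus> \<one>) \<otimes> f i) \<oplus>\<^bsub>?F\<^esub> f = \<zero>\<^bsub>?F\<^esub>"
        using f by (simp add: simps l_minus l_neg)
    qed
    show "\<zero>\<^bsub>?F\<^esub> \<oplus>\<^bsub>?F\<^esub> f = f"
      using f by (simp add: simps)
    fix g assume g: "g \<in> carrier ?F"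
    show "f \<oplus>\<^bsub>?F\<^esub> g = g \<oplus>\<^bsub>?F\<^esub> f"
      using f g by (simp add: simps a_comm)
    show "f \<oplus>\<^bsub>?F\<^esub> g \<in> carrier ?F"
      using f g by (simp add: free_module_simps free_module_add_closed)
    fix h assume h: "h \<in> carrier ?F"
    show "f \<oplus>\<^bsub>?F\<^esub> g \<oplus>\<^bsub>?F\<^esub> h = f \<oplus>\<^bsub>?F\<^esub> (g \<oplus>\<^bsub>?F\<^esub> h)"
      using f g h by (simp add: simps a_assoc)
  qed
  fix f assume f: "f \<in> carrier ?F"
  show "\<one> \<odot>\<^bsub>?F\<^esub> f = f"
    using f by (simp add: simps)
  fix r assume r: "r \<in> carrier R"
  show "r \<odot>\<^bsub>?F\<^esub> f \<in> carrier ?F"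
    using f r by (simp add: free_module_simps free_module_smult_closed)
  show "r \<odot>\<^bsub>?F\<^esub> (f \<oplus>\<^bsub>?F\<^esub> g) = r \<odot>\<^bsub>?F\<^esub> f \<oplus>\<^bsub>?F\<^esub> r \<odot>\<^bsub>?F\<^esub> g" if "g \<in> carrier ?F" for g
    using f r that by (simp add: simps r_distr)
  fix s assume s: "s \<in> carrier R"
  show "(r \<oplus> s) \<odot>\<^bsub>?F\<^esub> f = r \<odot>\<^bsub>?F\<^esub> f \<oplus>\<^bsub>?F\<^esub> s \<odot>\<^bsub>?F\<^esub> f"
    using f r s by (simp add: simps l_distr)
  show "(r \<otimes> s) \<odot>\<^bsub>?F\<^esub> f = r \<odot>\<^bsub>?F\<^esub> (s \<odot>\<^bsub>?F\<^esub> f)"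
    using f r s by (simp add: simps m_assoc)
qed

lemma free_gen_closed: "j \<in> I \<Longrightarrow> free_gen R j \<in> carrier (free_module R I)"
  by (simp add: free_gen_def free_module_def)

text \<open>
  The coefficient functions have finite support, so they are reached from zero by adding one term
  at a time.
\<close>

lemma free_module_induct [consumes 1, case_names zero add]:
  assumes "f \<in> carrier (free_module R I)"
    and "P (\<lambda>i. \<zero>)"
    and "\<And>r j g. \<lbrakk>r \<in> carrier R; j \<in> I; g \<in> carrier (free_module R I); P g\<rbrakk> \<Longrightarrow>
      P ((r \<odot>\<^bsub>free_module R I\<^esub> free_gen R j) \<oplus>\<^bsub>free_module R I\<^esub> g)"
  shows "P f"
  using free_module_finite[OF assms(1)] assms(1)
proof (induction "{i. f i \<noteq> \<zero>}" arbitrary: f rule: finite_induct)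
  case empty
  then have "f = (\<lambda>i. \<zero>)" by auto
  then show ?case using assms(2) by simp
next
  case (insert j A)
  then have j: "j \<in> I" "f j \<in> carrier R" by (auto simp: free_module_def)
  let ?g = "f(j := \<zero>)"
  have A: "A = {i. ?g i \<noteq> \<zero>}" using insert by auto
  have g: "?g \<in> carrier (free_module R I)"
    using insert.prems j insert.hyps(1) A by (auto simp: free_module_def)
  have "f = (f j \<odot>\<^bsub>free_module R I\<^esub> free_gen R j) \<oplus>\<^bsub>free_module R I\<^esub> ?g"
    using free_module_coeff[OF insert.prems] by (auto simp: free_module_simps free_gen_def fun_eq_iff)
  with assms(3)[OF j(2,1) g insert.hyps(3)[OF A g]] show ?case by simp
qed

context
  fixes W :: "('k, 'w, 'x) module_scheme" and \<beta> :: "'i \<Rightarrow> 'w" and I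
  assumes W: "module R W" and \<beta>: "\<And>i. i \<in> I \<Longrightarrow> \<beta> i \<in> carrier W"
begin

interpretation W: module R W by (rule W)

text \<open>
  The supports of two functions and of their sum can so be replaced by a common finite index set.
\<close>

lemma free_lift_superset:
  assumes f: "f \<in> carrier (free_module R I)" and A: "finite A" "{p. f p \<noteq> \<zero>} \<subseteq> A" "A \<subseteq> I"
  shows "(\<Oplus>\<^bsub>W\<^esub>p\<in>{p. f p \<noteq> \<zero>}. f p \<odot>\<^bsub>W\<^esub> \<beta> p) = (\<Oplus>\<^bsub>W\<^esub>p\<in>A. f p \<odot>\<^bsub>W\<^esub> \<beta> p)"
  using A \<beta> free_module_coeff[OF f]
  by (intro W.add.finprod_mono_neutral_cong_left) (auto simp: Pi_iff subset_iff)

lemma free_lift_linear: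
  "linear_map R (free_module R I) W (\<lambda>f. \<Oplus>\<^bsub>W\<^esub>p\<in>{p. f p \<noteq> \<zero>}. f p \<odot>\<^bsub>W\<^esub> \<beta> p)"
proof (rule linear_mapI)
  have supp: "{p. f p \<noteq> \<zero>} \<subseteq> I" if "f \<in> carrier (free_module R I)" for f
    using that by (auto simp: free_module_def)
  fix f assume f: "f \<in> carrier (free_module R I)"
  note c [simp] = free_module_coeff[OF f]
  show "(\<Oplus>\<^bsub>W\<^esub>p\<in>{p. f p \<noteq> \<zero>}. f p \<odot>\<^bsub>W\<^esub> \<beta> p) \<in> carrier W"
    using supp[OF f] \<beta> by (intro W.finsum_closed) (auto simp: Pi_iff)
  fix r assume r: "r \<in> carrier R"
  have rf: "(\<lambda>i. r \<otimes> f i) \<in> carrier (free_module R I)"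
    using f r by (rule free_module_smult_closed)
  let ?A = "{p. f p \<noteq> \<zero>}"
  have "(\<Oplus>\<^bsub>W\<^esub>p\<in>{p. r \<otimes> f p \<noteq> \<zero>}. (r \<otimes> f p) \<odot>\<^bsub>W\<^esub> \<beta> p) = (\<Oplus>\<^bsub>W\<^esub>p\<in>?A. (r \<otimes> f p) \<odot>\<^bsub>W\<^esub> \<beta> p)"
    by (rule free_lift_superset[OF rf free_module_finite[OF f] _ supp[OF f]]) (use r in force)
  also have "\<dots> = (\<Oplus>\<^bsub>W\<^esub>p\<in>?A. r \<odot>\<^bsub>W\<^esub> (f p \<odot>\<^bsub>W\<^esub> \<beta> p))"
    by (rule W.finsum_cong') (use r supp[OF f] \<beta> in \<open>auto simp: W.smult_assoc1 subset_iff\<close>)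
  also have "\<dots> = r \<odot>\<^bsub>W\<^esub> (\<Oplus>\<^bsub>W\<^esub>p\<in>?A. f p \<odot>\<^bsub>W\<^esub> \<beta> p)"
    by (rule W.finsum_smult_ldistr[symmetric, OF free_module_finite[OF f] r])
      (use supp[OF f] \<beta> in \<open>auto simp: subset_iff\<close>)
  finally show "(\<Oplus>\<^bsub>W\<^esub>p\<in>{p. (r \<odot>\<^bsub>free_module R I\<^esub> f) p \<noteq> \<zero>}. (r \<odot>\<^bsub>free_module R I\<^esub> f) p \<odot>\<^bsub>W\<^esub> \<beta> p)
    = r \<odot>\<^bsub>W\<^esub> (\<Oplus>\<^bsub>W\<^esub>p\<in>{p. f p \<noteq> \<zero>}. f p \<odot>\<^bsub>W\<^esub> \<beta> p)"
    by (simp add: free_module_simps)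
next
  fix f g assume f: "f \<in> carrier (free_module R I)" and g: "g \<in> carrier (free_module R I)"
  note c [simp] = free_module_coeff[OF f] free_module_coeff[OF g]
  have fg: "(\<lambda>i. f i \<oplus> g i) \<in> carrier (free_module R I)"
    using f g by (rule free_module_add_closed)
  let ?A = "{p. f p \<noteq> \<zero>} \<union> {p. g p \<noteq> \<zero>}"
  have A: "finite ?A" "?A \<subseteq> I"
    using free_module_finite[OF f] free_module_finite[OF g] f g by (auto simp: free_module_def)
  have "(\<Oplus>\<^bsub>W\<^esub>p\<in>{p. f p \<oplus> g p \<noteq> \<zero>}. (f p \<oplus> g p) \<odot>\<^bsub>W\<^esub> \<beta> p) = (\<Oplus>\<^bsub>W\<^esub>p\<in>?A. (f p \<oplus> g p) \<odot>\<^bsub>W\<^esub> \<beta> p)"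
    by (rule free_lift_superset[OF fg A(1) _ A(2)]) force
  also have "\<dots> = (\<Oplus>\<^bsub>W\<^esub>p\<in>?A. f p \<odot>\<^bsub>W\<^esub> \<beta> p \<oplus>\<^bsub>W\<^esub> g p \<odot>\<^bsub>W\<^esub> \<beta> p)"
    by (rule W.finsum_cong') (use A(2) \<beta> in \<open>auto simp: W.smult_l_distr subset_iff\<close>)
  also have "\<dots> = (\<Oplus>\<^bsub>W\<^esub>p\<in>?A. f p \<odot>\<^bsub>W\<^esub> \<beta> p) \<oplus>\<^bsub>W\<^esub> (\<Oplus>\<^bsub>W\<^esub>p\<in>?A. g p \<odot>\<^bsub>W\<^esub> \<beta> p)"
    by (rule W.finsum_addf) (use A(2) \<beta> in \<open>auto simp: subset_iff\<close>)
  finally show "(\<Oplus>\<^bsub>W\<^esub>p\<in>{p. (f \<oplus>\<^bsub>free_module R I\<^esub> g) p \<noteq> \<zero>}. (f \<oplus>\<^bsub>free_module R I\<^esub> g) p \<odot>\<^bsub>W\<^esub> \<beta> p)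
    = (\<Oplus>\<^bsub>W\<^esub>p\<in>{p. f p \<noteq> \<zero>}. f p \<odot>\<^bsub>W\<^esub> \<beta> p) \<oplus>\<^bsub>W\<^esub> (\<Oplus>\<^bsub>W\<^esub>p\<in>{p. g p \<noteq> \<zero>}. g p \<odot>\<^bsub>W\<^esub> \<beta> p)"
    unfolding free_module_simps
      free_lift_superset[OF f A(1) Un_upper1 A(2)] free_lift_superset[OF g A(1) Un_upper2 A(2)] .
qed

lemma free_lift_gen:
  assumes "j \<in> I"
  shows "(\<Oplus>\<^bsub>W\<^esub>p\<in>{p. free_gen R j p \<noteq> \<zero>}. free_gen R j p \<odot>\<^bsub>W\<^esub> \<beta> p) = \<beta> j"
proof -
  have "(\<Oplus>\<^bsub>W\<^esub>p\<in>{p. free_gen R j p \<noteq> \<zero>}. free_gen R j p \<odot>\<^bsub>W\<^esub> \<beta> p) = (\<Oplus>\<^bsub>W\<^esub>p\<in>{j}. free_gen R j p \<odot>\<^bsub>W\<^esub> \<beta> p)"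
    using assms by (intro free_lift_superset free_gen_closed) (auto simp: free_gen_def)
  then show ?thesis
    using \<beta>[OF assms] by (simp add: free_gen_def)
qed

end

end

subsection \<open>Tensor products\<close>

locale tensor =
  fixes R :: "('k, 'r) ring_scheme" and M :: "('k, 'a, 'x) module_scheme"
    and N :: "('k, 'b, 'y) module_scheme"
  assumes module_M: "module R M" and module_N: "module R N"
begin

abbreviation F where "F \<equiv> free_module R (carrier M \<times> carrier N)"
abbreviation T where "T \<equiv> tensor_module R M N"
abbreviation rel where "rel \<equiv> tensor_relations R M N"
abbreviation gen where "gen a b \<equiv> free_gen R (a, b)"
abbreviation pure where "pure a b \<equiv> pure_tensor R M N a b"

sublocale M: module R M by (fact module_M)
sublocale N: module R N by (fact module_N)
sublocale F: module R F by (rule module_free_module[OF M.R.is_cring])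

definition relators where
  "relators =
    {gen (a \<oplus>\<^bsub>M\<^esub> a') b \<ominus>\<^bsub>F\<^esub> (gen a b \<oplus>\<^bsub>F\<^esub> gen a' b) | a a' b.
       a \<in> carrier M \<and> a' \<in> carrier M \<and> b \<in> carrier N} \<union>
    {gen a (b \<oplus>\<^bsub>N\<^esub> b') \<ominus>\<^bsub>F\<^esub> (gen a b \<oplus>\<^bsub>F\<^esub> gen a b') | a b b'.
       a \<in> carrier M \<and> b \<in> carrier N \<and> b' \<in> carrier N} \<union>
    {gen (r \<odot>\<^bsub>M\<^esub> a) b \<ominus>\<^bsub>F\<^esub> r \<odot>\<^bsub>F\<^esub> gen a b | r a b.
       r \<in> carrier R \<and> a \<in> carrier M \<and> b \<in> carrier N} \<union>
    {gen a (r \<odot>\<^bsub>N\<^esub> b) \<ominus>\<^bsub>F\<^esub> r \<odot>\<^bsub>F\<^esub> gen a b | r a b.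
       r \<in> carrier R \<and> a \<in> carrier M \<and> b \<in> carrier N}"

lemma rel_span: "rel = module_span R F relators"
  by (simp add: tensor_relations_def relators_def Let_def)

lemma gen_closed: "a \<in> carrier M \<Longrightarrow> b \<in> carrier N \<Longrightarrow> gen a b \<in> carrier F"
  by (rule free_gen_closed[OF M.R.is_cring]) simp

lemma relators_closed: "relators \<subseteq> carrier F"
  unfolding relators_def by (auto intro!: F.minus_closed gen_closed)

sublocale Q: quotient R F rel
  using module_span_submodule[OF F.module_axioms relators_closed]
  by (intro quotient.intro F.module_axioms) (simp add: rel_span)

lemma T_eq: "T = quotient_module F rel" by (simp add: tensor_module_def)

lemma module_T: "module R T" using Q.module_Q by (simp add: T_eq)

sublocale T: module R T by (rule module_T)

lemma pure_bilinear: "bilinear_map R M N T (pure_tensor R M N)"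
proof -
  have pure_eqI: "rel +>\<^bsub>F\<^esub> x = rel +>\<^bsub>F\<^esub> y" if "x \<ominus>\<^bsub>F\<^esub> y \<in> relators" "x \<in> carrier F" "y \<in> carrier F" for x y
    using that module_span_incl[of relators R F] Q.coset_eq_iff[of x y]
      by (simp add: rel_span subset_iff)
  have cl: "pure a b \<in> carrier T" if "a \<in> carrier M" "b \<in> carrier N" for a b
    using that by (simp add: pure_tensor_def T_eq Q.carrier_Q gen_closed)
  have "pure (a \<oplus>\<^bsub>M\<^esub> a') b = pure a b \<oplus>\<^bsub>T\<^esub> pure a' b"
    if "a \<in> carrier M" "a' \<in> carrier M" "b \<in> carrier N" for a a' b
    unfolding pure_tensor_def T_eq Q.coset_add[OF gen_closed[OF that(1,3)] gen_closed[OF that(2,3)]]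
    by (rule pure_eqI) (use that in \<open>simp_all add: gen_closed, auto simp: relators_def\<close>)
  moreover have "pure a (b \<oplus>\<^bsub>N\<^esub> b') = pure a b \<oplus>\<^bsub>T\<^esub> pure a b'"
    if "a \<in> carrier M" "b \<in> carrier N" "b' \<in> carrier N" for a b b'
    unfolding pure_tensor_def T_eq Q.coset_add[OF gen_closed[OF that(1,2)] gen_closed[OF that(1,3)]]
    by (rule pure_eqI) (use that in \<open>simp_all add: gen_closed, auto simp: relators_def\<close>)
  moreover have "pure (r \<odot>\<^bsub>M\<^esub> a) b = r \<odot>\<^bsub>T\<^esub> pure a b"
    if "r \<in> carrier R" "a \<in> carrier M" "b \<in> carrier N" for r a b
    unfolding pure_tensor_def T_eq Q.coset_smult[OF that(1) gen_closed[OF that(2,3)]]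
    by (rule pure_eqI) (use that in \<open>simp_all add: gen_closed, auto simp: relators_def\<close>)
  moreover have "pure a (r \<odot>\<^bsub>N\<^esub> b) = r \<odot>\<^bsub>T\<^esub> pure a b"
    if "r \<in> carrier R" "a \<in> carrier M" "b \<in> carrier N" for r a b
    unfolding pure_tensor_def T_eq Q.coset_smult[OF that(1) gen_closed[OF that(2,3)]]
    by (rule pure_eqI) (use that in \<open>simp_all add: gen_closed, auto simp: relators_def\<close>)
  ultimately show ?thesis
    using cl by (auto simp: bilinear_map_def linear_map_def)
qed

lemma pure_closed: "a \<in> carrier M \<Longrightarrow> b \<in> carrier N \<Longrightarrow> pure a b \<in> carrier T"
  by (rule linear_map_closed[OF bilinear_map_right[OF pure_bilinear]])

text \<open>
  Scalars can be absorbed in the first factor of a pure tensor, so sums of pure tensors exhaust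
  the tensor product and no case for scalar multiples is needed.
\<close>

lemma tensor_induct [consumes 1, case_names pure add]:
  assumes "m \<in> carrier T"
    and pure: "\<And>a b. \<lbrakk>a \<in> carrier M; b \<in> carrier N\<rbrakk> \<Longrightarrow> P (pure a b)"
    and plus: "\<And>x y. \<lbrakk>x \<in> carrier T; y \<in> carrier T; P x; P y\<rbrakk> \<Longrightarrow> P (x \<oplus>\<^bsub>T\<^esub> y)"
  shows "P m"
proof -
  from assms(1) obtain f where f: "f \<in> carrier F" and m: "m = rel +>\<^bsub>F\<^esub> f"
    by (auto simp: T_eq Q.carrier_Q)
  have "P (rel +>\<^bsub>F\<^esub> f)"
  proof (rule free_module_induct[OF M.R.is_cring f, where P = "\<lambda>f. P (rel +>\<^bsub>F\<^esub> f)"])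
    have zero_F: "(\<lambda>i. \<zero>\<^bsub>R\<^esub>) = \<zero>\<^bsub>F\<^esub>" by (simp add: free_module_def)
    have "pure \<zero>\<^bsub>M\<^esub> \<zero>\<^bsub>N\<^esub> = \<zero>\<^bsub>T\<^esub>"
      using linear_map_zero[OF module_M module_T bilinear_map_left[OF pure_bilinear]] by simp
    then show "P (rel +>\<^bsub>F\<^esub> (\<lambda>i. \<zero>\<^bsub>R\<^esub>))"
      using pure[of "\<zero>\<^bsub>M\<^esub>" "\<zero>\<^bsub>N\<^esub>"] zero_F by (simp add: Q.zero_Q T_eq)
  next
    fix r j g assume add: "r \<in> carrier R" "j \<in> carrier M \<times> carrier N" "g \<in> carrier F" "P (rel +>\<^bsub>F\<^esub> g)"
    then obtain a b where ab: "j = (a, b)" "a \<in> carrier M" "b \<in> carrier N" by auto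
    have "rel +>\<^bsub>F\<^esub> ((r \<odot>\<^bsub>F\<^esub> free_gen R j) \<oplus>\<^bsub>F\<^esub> g) = pure (r \<odot>\<^bsub>M\<^esub> a) b \<oplus>\<^bsub>T\<^esub> (rel +>\<^bsub>F\<^esub> g)"
      using linear_map_smult[OF bilinear_map_left[OF pure_bilinear ab(3)] add(1) ab(2)] add ab
      by (simp add: T_eq Q.coset_add Q.coset_smult gen_closed pure_tensor_def)
    moreover have "rel +>\<^bsub>F\<^esub> g \<in> carrier T" using add by (auto simp: T_eq Q.carrier_Q)
    ultimately show "P (rel +>\<^bsub>F\<^esub> ((r \<odot>\<^bsub>F\<^esub> free_gen R j) \<oplus>\<^bsub>F\<^esub> g))"
      using add ab by (simp add: plus pure pure_closed)
  qed
  then show ?thesis using m by simp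
qed

lemma tensor_lift:
  assumes W: "module R W" and \<beta>: "bilinear_map R M N W \<beta>"
  shows tensor_lift_linear: "linear_map R T W (tensor_lift R W \<beta>)"
    and tensor_lift_pure: "\<lbrakk>a \<in> carrier M; b \<in> carrier N\<rbrakk> \<Longrightarrow> tensor_lift R W \<beta> (pure a b) = \<beta> a b"
proof -
  interpret W: module R W by fact
  define f where "f = (\<lambda>f. \<Oplus>\<^bsub>W\<^esub>p\<in>{p. f p \<noteq> \<zero>\<^bsub>R\<^esub>}. f p \<odot>\<^bsub>W\<^esub> \<beta> (fst p) (snd p))"
  have cl: "\<beta> a b \<in> carrier W" if "a \<in> carrier M" "b \<in> carrier N" for a b
    using that by (rule linear_map_closed[OF bilinear_map_right[OF \<beta>]])
  have f: "linear_map R F W f"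
    unfolding f_def by (rule free_lift_linear[OF M.R.is_cring W]) (auto simp: cl)
  have g: "f (gen a b) = \<beta> a b" if "a \<in> carrier M" "b \<in> carrier N" for a b
    using free_lift_gen[OF M.R.is_cring W, of "carrier M \<times> carrier N" "\<lambda>p. \<beta> (fst p) (snd p)" "(a, b)"]
        cl that
    by (auto simp: f_def)
  note f_simps = linear_map_minus[OF F.module_axioms W f] linear_map_add[OF f] linear_map_smult[OF f]
  note \<beta>_simps = linear_mapD[OF bilinear_map_left[OF \<beta>]] linear_mapD[OF bilinear_map_right[OF \<beta>]]
  have "f x = \<zero>\<^bsub>W\<^esub>" if "x \<in> relators" for x
    using that unfolding relators_def
    by (elim UnE CollectE exE conjE) (simp_all add: f_simps gen_closed g \<beta>_simps cl W.r_neg W.minus_eq)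
  then have zero: "f x = \<zero>\<^bsub>W\<^esub>" if "x \<in> rel" for x
    using linear_map_zero_on_span[OF F.module_axioms W f relators_closed] that by (simp add: rel_span)
  have tl: "tensor_lift R W \<beta> = (\<lambda>m. the_elem (f ` m))"
    by (simp add: tensor_lift_def f_def fun_eq_iff)
  show "linear_map R T W (tensor_lift R W \<beta>)"
    unfolding tl T_eq by (rule Q.linear_the_elem[OF W f zero])
  show "tensor_lift R W \<beta> (pure a b) = \<beta> a b" if "a \<in> carrier M" "b \<in> carrier N"
    using that by (simp add: tl pure_tensor_def Q.the_elem_coset[OF W f zero] gen_closed g)
qed

text \<open>
  The values of \<open>\<beta>\<close> outside the carriers are arbitrary, which is why \<open>\<beta>\<close> is only assumed to agree
  with a given linear map on the carriers.
\<close>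

lemma tensor_lift_eq:
  assumes W: "module R W" and g: "linear_map R T W g"
    and \<beta>: "\<And>a b. \<lbrakk>a \<in> carrier M; b \<in> carrier N\<rbrakk> \<Longrightarrow> \<beta> a b = g (pure a b)"
    and m: "m \<in> carrier T"
  shows "tensor_lift R W \<beta> m = g m"
proof -
  have bil: "bilinear_map R M N W (\<lambda>a b. g (pure a b))"
    by (rule bilinear_map_comp[OF pure_bilinear g])
  have "bilinear_map R M N W \<beta>"
    unfolding bilinear_map_def
    by (intro conjI ballI linear_map_cong[OF module_M bilinear_map_left[OF bil] \<beta>]
      linear_map_cong[OF module_N bilinear_map_right[OF bil] \<beta>])
  note tl = tensor_lift[OF W this]
  from m show ?thesis
    by (induction rule: tensor_induct) (simp_all add: tl(2) \<beta> linear_map_add[OF tl(1)] linear_map_add[OF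
        g])
qed

lemma tensor_lift_param:
  assumes W: "module R W" and C: "module R C"
    and \<beta>: "\<And>c. c \<in> carrier C \<Longrightarrow> bilinear_map R M N W (\<lambda>a b. \<beta> a b c)"
    and lin: "\<And>a b. \<lbrakk>a \<in> carrier M; b \<in> carrier N\<rbrakk> \<Longrightarrow> linear_map R C W (\<beta> a b)"
    and m: "m \<in> carrier T"
  shows "linear_map R C W (\<lambda>c. tensor_lift R W (\<lambda>a b. \<beta> a b c) m)"
  using m
proof (induction rule: tensor_induct)
  case (pure a b)
  show ?case
    using lin[OF pure] by (rule linear_map_cong[OF C]) (simp add: tensor_lift_pure[OF W \<beta>] pure)
next
  case (add x y)
  show ?case
    using linear_map_plus[OF W add(3,4)] 
    by (rule linear_map_cong[OF C]) (simp add: linear_map_add[OF tensor_lift_linear[OF W \<beta>]] add)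
qed

end

section \<open>The inner part of the Tits-Kantor-Koecher algebra\<close>

locale jpair =
  fixes R :: "('k, 'r) ring_scheme" and P :: "('k, 'a, 'b) jordan_pair"
  assumes jordan_pair: "is_jordan_pair R P"
begin

abbreviation M where "M \<equiv> jpm P"
abbreviation N where "N \<equiv> jpp P"
abbreviation t where "t \<equiv> trm P"
abbreviation s where "s \<equiv> trp P"
abbreviation I where "I \<equiv> inner_module R P"

sublocale tensor R M N
  using jordan_pair by (simp add: is_jordan_pair_def tensor_def)

lemma t_linear:
  "\<lbrakk>b \<in> carrier N; c \<in> carrier M\<rbrakk> \<Longrightarrow> linear_map R M M (\<lambda>a. t a b c)"
  "\<lbrakk>a \<in> carrier M; c \<in> carrier M\<rbrakk> \<Longrightarrow> linear_map R N M (\<lambda>b. t a b c)"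
  "\<lbrakk>a \<in> carrier M; b \<in> carrier N\<rbrakk> \<Longrightarrow> linear_map R M M (t a b)"
  using jordan_pair by (auto simp: is_jordan_pair_def jordan_product_def trilinear_map_def)

lemma s_linear:
  "\<lbrakk>b \<in> carrier M; c \<in> carrier N\<rbrakk> \<Longrightarrow> linear_map R N N (\<lambda>a. s a b c)"
  "\<lbrakk>a \<in> carrier N; c \<in> carrier N\<rbrakk> \<Longrightarrow> linear_map R M N (\<lambda>b. s a b c)"
  "\<lbrakk>a \<in> carrier N; b \<in> carrier M\<rbrakk> \<Longrightarrow> linear_map R N N (s a b)"
  using jordan_pair by (auto simp: is_jordan_pair_def jordan_product_def trilinear_map_def)

lemma t_closed [simp]: "\<lbrakk>a \<in> carrier M; b \<in> carrier N; c \<in> carrier M\<rbrakk> \<Longrightarrow> t a b c \<in> carrier M"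
  using t_linear(3) by (rule linear_map_closed)

lemma s_closed [simp]: "\<lbrakk>a \<in> carrier N; b \<in> carrier M; c \<in> carrier N\<rbrakk> \<Longrightarrow> s a b c \<in> carrier N"
  using s_linear(3) by (rule linear_map_closed)

lemmas t_simps =
  t_linear(1)[THEN linear_map_add] t_linear(2)[THEN linear_map_add] t_linear(3)[THEN linear_map_add]
  t_linear(1)[THEN linear_map_neg[OF module_M module_M]]
  t_linear(2)[THEN linear_map_neg[OF module_N module_M]]
  t_linear(3)[THEN linear_map_neg[OF module_M module_M]]

lemmas s_simps =
  s_linear(1)[THEN linear_map_add] s_linear(2)[THEN linear_map_add] s_linear(3)[THEN linear_map_add]
  s_linear(1)[THEN linear_map_neg[OF module_N module_N]]
  s_linear(2)[THEN linear_map_neg[OF module_M module_N]]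
  s_linear(3)[THEN linear_map_neg[OF module_N module_N]]

lemma t_commute: "\<lbrakk>a \<in> carrier M; b \<in> carrier N; c \<in> carrier M\<rbrakk> \<Longrightarrow> t a b c = t c b a"
  using jordan_pair unfolding is_jordan_pair_def jordan_product_def by blast

lemma s_commute: "\<lbrakk>a \<in> carrier N; b \<in> carrier M; c \<in> carrier N\<rbrakk> \<Longrightarrow> s a b c = s c b a"
  using jordan_pair unfolding is_jordan_pair_def jordan_product_def by blast

text \<open>
  The Jordan pair identity, solved for the leftmost term so that it can be used as a rewrite
  rule: it says that \<open>V\<^bsub>a,b\<^esub>\<close> is a derivation of the triple product, where it acts on the other
  component as \<open>-V\<^bsub>b,a\<^esub>\<close>.
\<close>

lemma jordan_t:
  assumes "a \<in> carrier M" "b \<in> carrier N" "c \<in> carrier M" "d \<in> carrier N" "x \<in> carrier M"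
  shows "t a b (t c d x) = (t (t a b c) d x \<ominus>\<^bsub>M\<^esub> t c (s b a d) x) \<oplus>\<^bsub>M\<^esub> t c d (t a b x)"
proof -
  have "t a b (t c d x) \<ominus>\<^bsub>M\<^esub> t c d (t a b x) = t (t a b c) d x \<ominus>\<^bsub>M\<^esub> t c (s b a d) x"
    using jordan_pair assms unfolding is_jordan_pair_def jordan_product_def by blast
  then show ?thesis
    using assms by (metis M.add.inv_closed M.add.m_assoc M.l_neg M.minus_closed M.minus_eq M.r_zero
        s_closed t_closed)
qed

lemma jordan_s:
  assumes "a \<in> carrier N" "b \<in> carrier M" "c \<in> carrier N" "d \<in> carrier M" "x \<in> carrier N"
  shows "s a b (s c d x) = (s (s a b c) d x \<ominus>\<^bsub>N\<^esub> s c (t b a d) x) \<oplus>\<^bsub>N\<^esub> s c d (s a b x)"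
proof -
  have "s a b (s c d x) \<ominus>\<^bsub>N\<^esub> s c d (s a b x) = s (s a b c) d x \<ominus>\<^bsub>N\<^esub> s c (t b a d) x"
    using jordan_pair assms unfolding is_jordan_pair_def jordan_product_def by blast
  then show ?thesis
    using assms by (metis N.add.inv_closed N.add.m_assoc N.l_neg N.minus_closed N.minus_eq N.r_zero
        s_closed t_closed)
qed

subsection \<open>The action of the tensor product\<close>

text \<open>
  The tensor \<open>m\<close> acts by \<open>\<lambda>(m)\<close> on the two components of \<open>P\<close> and, as a derivation, on the tensor
  product.
\<close>

definition act_m where "act_m m c = tensor_lift R M (\<lambda>a b. t a b c) m"
definition act_p where "act_p m d = tensor_lift R N (\<lambda>a b. \<ominus>\<^bsub>N\<^esub> s b a d) m"
definition tact where "tact m = tensor_action R P (jp_lambda R P m)"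

lemma t_bilinear: "c \<in> carrier M \<Longrightarrow> bilinear_map R M N M (\<lambda>a b. t a b c)"
  by (simp add: bilinear_map_def t_linear)

lemma s_bilinear: "d \<in> carrier N \<Longrightarrow> bilinear_map R M N N (\<lambda>a b. \<ominus>\<^bsub>N\<^esub> s b a d)"
  by (simp add: bilinear_map_def s_linear linear_map_uminus[OF module_N])

lemma act_m_linear1: "c \<in> carrier M \<Longrightarrow> linear_map R T M (\<lambda>m. act_m m c)"
  unfolding act_m_def by (rule tensor_lift_linear[OF module_M t_bilinear])

lemma act_p_linear1: "d \<in> carrier N \<Longrightarrow> linear_map R T N (\<lambda>m. act_p m d)"
  unfolding act_p_def by (rule tensor_lift_linear[OF module_N s_bilinear])

lemma act_m_linear2: "m \<in> carrier T \<Longrightarrow> linear_map R M M (act_m m)"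
  unfolding act_m_def
  by (rule tensor_lift_param[OF module_M module_M t_bilinear t_linear(3)])

lemma act_p_linear2: "m \<in> carrier T \<Longrightarrow> linear_map R N N (act_p m)"
  unfolding act_p_def
  by (rule tensor_lift_param[OF module_N module_N s_bilinear linear_map_uminus[OF module_N s_linear(3)]])

lemma act_pure:
  assumes "a \<in> carrier M" "b \<in> carrier N"
  shows "c \<in> carrier M \<Longrightarrow> act_m (pure a b) c = t a b c"
    and "d \<in> carrier N \<Longrightarrow> act_p (pure a b) d = \<ominus>\<^bsub>N\<^esub> s b a d"
  using assms by (simp_all add: act_m_def act_p_def tensor_lift_pure[OF module_M t_bilinear]
    tensor_lift_pure[OF module_N s_bilinear])

lemma act_closed [simp]:
  "\<lbrakk>m \<in> carrier T; c \<in> carrier M\<rbrakk> \<Longrightarrow> act_m m c \<in> carrier M"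
  "\<lbrakk>m \<in> carrier T; d \<in> carrier N\<rbrakk> \<Longrightarrow> act_p m d \<in> carrier N"
  by (rule linear_map_closed[OF act_m_linear2] linear_map_closed[OF act_p_linear2]; assumption)+

lemmas act_simps =
  act_m_linear1[THEN linear_map_add] act_p_linear1[THEN linear_map_add]
  act_m_linear2[THEN linear_map_add] act_p_linear2[THEN linear_map_add]
  act_m_linear2[THEN linear_map_neg[OF module_M module_M]]
  act_p_linear2[THEN linear_map_neg[OF module_N module_N]]

lemmas pure_left = bilinear_map_left[OF pure_bilinear]
lemmas pure_right = bilinear_map_right[OF pure_bilinear]

lemmas pure_simps =
  pure_left[THEN linear_map_add] pure_right[THEN linear_map_add]
  pure_left[THEN linear_map_neg[OF module_M module_T]]
  pure_right[THEN linear_map_neg[OF module_N module_T]]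

declare pure_closed [simp]

lemma tact_bilinear:
  assumes m: "m \<in> carrier T"
  shows "bilinear_map R M N T (\<lambda>a b. pure (act_m m a) b \<oplus>\<^bsub>T\<^esub> pure a (act_p m b))"
  unfolding bilinear_map_def
  using m act_m_linear2[OF m] act_p_linear2[OF m]
  by (intro ballI conjI linear_map_plus module_T pure_left pure_right act_closed
    linear_map_comp[OF act_m_linear2[OF m] pure_left] linear_map_comp[OF act_p_linear2[OF m] pure_right])

lemma tact_def':
  "tact m = tensor_lift R T (\<lambda>a b. pure (act_m m a) b \<oplus>\<^bsub>T\<^esub> pure a (act_p m b))"
  by (simp add: tact_def tensor_action_def jp_lambda_def act_m_def act_p_def)

lemma tact_linear2: "m \<in> carrier T \<Longrightarrow> linear_map R T T (tact m)"
  unfolding tact_def' by (rule tensor_lift_linear[OF module_T tact_bilinear])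

lemma tact_pure:
  "\<lbrakk>m \<in> carrier T; a \<in> carrier M; b \<in> carrier N\<rbrakk> \<Longrightarrow>
    tact m (pure a b) = pure (act_m m a) b \<oplus>\<^bsub>T\<^esub> pure a (act_p m b)"
  unfolding tact_def' by (rule tensor_lift_pure[OF module_T tact_bilinear])

lemma tact_linear1: 
  assumes "u \<in> carrier T"
  shows "linear_map R T T (\<lambda>m. tact m u)"
  unfolding tact_def'
  by (rule tensor_lift_param[OF module_T module_T tact_bilinear _ assms])
    (auto intro!: linear_map_plus[OF module_T] linear_map_comp[OF act_m_linear1 pure_left]
      linear_map_comp[OF act_p_linear1 pure_right])

lemma tact_closed [simp]: "\<lbrakk>m \<in> carrier T; u \<in> carrier T\<rbrakk> \<Longrightarrow> tact m u \<in> carrier T"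
  by (rule linear_map_closed[OF tact_linear2])

lemmas tact_simps = tact_linear1[THEN linear_map_add] tact_linear2[THEN linear_map_add]

lemmas M_norm = M.signed_norm t_simps
lemmas N_norm = N.signed_norm s_simps

text \<open>
  For a pure tensor this is the Jordan pair identity; both sides are additive in \<open>m\<close>.
\<close>

lemma act_m_derivation:
  assumes "m \<in> carrier T" and abc: "a \<in> carrier M" "b \<in> carrier N" "c \<in> carrier M"
  shows "act_m m (t a b c) = (t (act_m m a) b c \<oplus>\<^bsub>M\<^esub> t a (act_p m b) c) \<oplus>\<^bsub>M\<^esub> t a b (act_m m c)"
  using assms(1)
proof (induction rule: tensor_induct)
  case (pure x y)
  with abc show ?case
    by (simp add: act_pure jordan_t[of x y a b c] M.minus_eq t_simps)
next
  case (add x y)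
  show ?case
    by (rule M.eq_if_signed) (use abc add in \<open>simp_all add: act_simps M_norm\<close>)
qed

lemma act_p_derivation:
  assumes "m \<in> carrier T" and abc: "a \<in> carrier N" "b \<in> carrier M" "c \<in> carrier N"
  shows "act_p m (s a b c) = (s (act_p m a) b c \<oplus>\<^bsub>N\<^esub> s a (act_m m b) c) \<oplus>\<^bsub>N\<^esub> s a b (act_p m c)"
  using assms(1)
proof (induction rule: tensor_induct)
  case (pure x y)
  show ?case
    by (rule N.eq_if_signed) (use abc pure in \<open>simp_all add: act_pure jordan_s[of y x a b c] N_norm\<close>)
next
  case (add x y)
  show ?case
    by (rule N.eq_if_signed) (use abc add in \<open>simp_all add: act_simps N_norm\<close>)
qed

text \<open>
  As \<open>\<lambda>(u)\<close> is built from the triple products, of which \<open>\<lambda>(m)\<close> is a derivation, applying \<open>m\<close> to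
  \<open>u\<close> amounts to a commutator of operators.
\<close>

lemma act_m_tact:
  assumes "m \<in> carrier T" "u \<in> carrier T" "c \<in> carrier M"
  shows "act_m (tact m u) c = act_m m (act_m u c) \<ominus>\<^bsub>M\<^esub> act_m u (act_m m c)"
  using assms(2)
proof (induction rule: tensor_induct)
  case (pure x y)
  show ?case
    by (rule M.eq_if_signed)
      (use assms(1,3) pure in \<open>simp_all add: tact_pure act_simps act_pure act_m_derivation M_norm\<close>)
next
  case (add x y)
  show ?case
    by (rule M.eq_if_signed) (use assms(1,3) add in \<open>simp_all add: act_simps tact_simps M_norm\<close>)
qed

lemma act_p_tact:
  assumes "m \<in> carrier T" "u \<in> carrier T" "c \<in> carrier N"
  shows "act_p (tact m u) c = act_p m (act_p u c) \<ominus>\<^bsub>N\<^esub> act_p u (act_p m c)"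
  using assms(2)
proof (induction rule: tensor_induct)
  case (pure x y)
  show ?case
    by (rule N.eq_if_signed)
      (use assms(1,3) pure in \<open>simp_all add: tact_pure act_simps act_pure act_p_derivation N_norm\<close>)
next
  case (add x y)
  show ?case
    by (rule N.eq_if_signed) (use assms(1,3) add in \<open>simp_all add: act_simps tact_simps N_norm\<close>)
qed

text \<open>
  On a pure tensor the commutator acts on each factor, so this follows from the same identity on
  the two components.
\<close>

lemma tact_tact:
  assumes "m \<in> carrier T" "u \<in> carrier T" "w \<in> carrier T"
  shows "tact (tact m u) w = tact m (tact u w) \<ominus>\<^bsub>T\<^esub> tact u (tact m w)"
  using assms(3)
proof (induction rule: tensor_induct)
  case (pure x y)
  show ?case
    by (rule T.eq_if_signed)
      (use assms(1,2) pure in \<open>simp_all add: tact_pure tact_simps act_m_tact act_p_tact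
        M.minus_eq N.minus_eq pure_simps T.signed_norm\<close>)
next
  case (add x y)
  show ?case
    by (rule T.eq_if_signed) (use assms(1,2) add in \<open>simp_all add: tact_simps T.signed_norm\<close>)
qed

subsection \<open>The relations of the inner part\<close>

abbreviation irel where "irel \<equiv> inner_relations R P"

lemma irel_span: "irel = module_span R T {tact m m | m. m \<in> carrier T}"
  by (simp add: inner_relations_def tact_def)

lemma squares_closed: "{tact m m | m. m \<in> carrier T} \<subseteq> carrier T"
  by auto

sublocale I: quotient R T irel
  using module_span_submodule[OF module_T squares_closed]
  by (intro quotient.intro module_T) (simp add: irel_span)

lemma I_eq: "I = quotient_module T irel" by (simp add: inner_module_def)

lemma module_I: "module R I" using I.module_Q by (simp add: I_eq)

end

context jpair
begin

sublocale Im: module R I by (rule module_I)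

abbreviation cos where "cos u \<equiv> irel +>\<^bsub>T\<^esub> u"
abbreviation ang where "ang a b \<equiv> inner_elem R P a b"

lemma ang_eq: "ang a b = cos (pure a b)" by (simp add: inner_elem_def)

lemma cos_linear: "linear_map R T I (\<lambda>u. cos u)"
  using I.coset_linear by (simp add: I_eq)

lemma cos_closed [simp]: "u \<in> carrier T \<Longrightarrow> cos u \<in> carrier I"
  by (rule linear_map_closed[OF cos_linear])

lemma carrier_I: "Z \<in> carrier I \<Longrightarrow> \<exists>u\<in>carrier T. Z = cos u"
  by (auto simp: I_eq I.carrier_Q)

lemma cos_zero_iff: "u \<in> carrier T \<Longrightarrow> cos u = \<zero>\<^bsub>I\<^esub> \<longleftrightarrow> u \<in> irel"
  by (simp add: I_eq I.coset_zero_iff)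

lemmas cos_add = linear_map_add[OF cos_linear]

lemma tact_self: "u \<in> carrier T \<Longrightarrow> tact u u \<in> irel"
  unfolding irel_span using module_span_incl[of "{tact m m | m. m \<in> carrier T}" R T] by blast

text \<open>
  By equivariance \<open>\<lambda>(m) m\<close> acts as the commutator of \<open>\<lambda>(m)\<close> with itself.
\<close>

lemma irel_act_m: "\<lbrakk>n \<in> irel; c \<in> carrier M\<rbrakk> \<Longrightarrow> act_m n c = \<zero>\<^bsub>M\<^esub>"
  by (rule linear_map_zero_on_span[OF module_T module_M act_m_linear1 squares_closed])
    (auto simp: irel_span act_m_tact M.minus_eq M.r_neg)

lemma irel_act_p: "\<lbrakk>n \<in> irel; d \<in> carrier N\<rbrakk> \<Longrightarrow> act_p n d = \<zero>\<^bsub>N\<^esub>"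
  by (rule linear_map_zero_on_span[OF module_T module_N act_p_linear1 squares_closed])
    (auto simp: irel_span act_p_tact N.minus_eq N.r_neg)

lemma irel_tact_left: "\<lbrakk>n \<in> irel; u \<in> carrier T\<rbrakk> \<Longrightarrow> tact n u = \<zero>\<^bsub>T\<^esub>"
  by (rule linear_map_zero_on_span[OF module_T module_T tact_linear1 squares_closed])
    (auto simp: irel_span tact_tact T.minus_eq T.r_neg)

text \<open>
  The relations are the values of a quadratic map; its polar form is a relation, too.
\<close>

lemma tact_polar:
  assumes "u \<in> carrier T" "w \<in> carrier T"
  shows "cos (tact u w \<oplus>\<^bsub>T\<^esub> tact w u) = \<zero>\<^bsub>I\<^esub>"
proof -
  have sq: "cos (tact x x) = \<zero>\<^bsub>I\<^esub>" if "x \<in> carrier T" for x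
    using that by (simp add: cos_zero_iff tact_self)
  have "cos (tact (u \<oplus>\<^bsub>T\<^esub> w) (u \<oplus>\<^bsub>T\<^esub> w)) = \<zero>\<^bsub>I\<^esub>"
    using assms by (intro sq) simp
  then show ?thesis
    using assms by (simp add: tact_simps cos_add sq Im.a_comm)
qed

text \<open>
  Applying \<open>u\<close> to \<open>\<lambda>(m) m\<close> gives the polar form of the quadratic map \<open>m \<mapsto> \<lambda>(m) m\<close> at \<open>m\<close> and
  \<open>\<lambda>(u) m\<close>, so the span of the relations is invariant.
\<close>

lemma irel_tact_right:
  assumes "u \<in> carrier T" "n \<in> irel"
  shows "cos (tact u n) = \<zero>\<^bsub>I\<^esub>"
proof (rule linear_map_zero_on_span[OF module_T module_I linear_map_comp[OF tact_linear2 cos_linear]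
    squares_closed])
  show "n \<in> module_span R T {tact m m |m. m \<in> carrier T}"
    using assms(2) by (simp add: irel_span)
  fix x assume "x \<in> {tact m m |m. m \<in> carrier T}"
  then obtain m where m: "m \<in> carrier T" "x = tact m m" by blast
  have "tact u (tact m m) = tact (tact u m) m \<oplus>\<^bsub>T\<^esub> tact m (tact u m)"
    by (rule T.eq_if_signed) (use assms(1) m in \<open>simp_all add: tact_tact T.signed_norm\<close>)
  then show "cos (tact u x) = \<zero>\<^bsub>I\<^esub>"
    using tact_polar[of "tact u m" m] m assms(1) by simp
qed (fact assms(1))

lemma ang_bilinear: "bilinear_map R M N I (inner_elem R P)"
  using bilinear_map_comp[OF pure_bilinear cos_linear] by (simp add: inner_elem_def[abs_def])

lemma ang_closed [simp]: "\<lbrakk>a \<in> carrier M; b \<in> carrier N\<rbrakk> \<Longrightarrow> ang a b \<in> carrier I"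
  by (simp add: ang_eq)

lemma inner_induct [consumes 1, case_names ang add]:
  assumes "Z \<in> carrier I"
    and ang: "\<And>a b. \<lbrakk>a \<in> carrier M; b \<in> carrier N\<rbrakk> \<Longrightarrow> Q (ang a b)"
    and plus: "\<And>Z Y. \<lbrakk>Z \<in> carrier I; Y \<in> carrier I; Q Z; Q Y\<rbrakk> \<Longrightarrow> Q (Z \<oplus>\<^bsub>I\<^esub> Y)"
  shows "Q Z"
proof -
  have "Q (cos u)" if "u \<in> carrier T" for u
    using that
  proof (induction rule: tensor_induct)
    case (pure a b)
    then show ?case using ang by (simp add: ang_eq)
  next
    case (add x y)
    then show ?case using plus[of "cos x" "cos y"] by (simp add: cos_add)
  qed
  then show ?thesis using carrier_I[OF assms(1)] by blast
qed

text \<open>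
  It suffices to check a bilinear map on the generators \<open>\<lambda>(m) m\<close> of the relations.
\<close>

lemma inner_lift:
  assumes W: "module R W" and \<beta>: "bilinear_map R M N W \<beta>"
    and sq: "\<And>m. m \<in> carrier T \<Longrightarrow> tensor_lift R W \<beta> (tact m m) = \<zero>\<^bsub>W\<^esub>"
  shows inner_lift_linear: "linear_map R I W (inner_lift R W \<beta>)"
    and inner_lift_cos: "u \<in> carrier T \<Longrightarrow> inner_lift R W \<beta> (cos u) = tensor_lift R W \<beta> u"
    and inner_lift_ang: "\<lbrakk>a \<in> carrier M; b \<in> carrier N\<rbrakk> \<Longrightarrow> inner_lift R W \<beta> (ang a b) = \<beta> a b"
proof -
  note lin = tensor_lift_linear[OF W \<beta>]
  have zero: "tensor_lift R W \<beta> n = \<zero>\<^bsub>W\<^esub>" if "n \<in> irel" for n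
    using linear_map_zero_on_span[OF module_T W lin squares_closed] sq that
    by (auto simp: irel_span)
  show "linear_map R I W (inner_lift R W \<beta>)"
    using I.linear_the_elem[OF W lin zero] by (simp add: I_eq inner_lift_def[abs_def])
  show cos: "inner_lift R W \<beta> (cos u) = tensor_lift R W \<beta> u" if "u \<in> carrier T" for u
    using I.the_elem_coset[OF W lin zero that] by (simp add: inner_lift_def)
  show "inner_lift R W \<beta> (ang a b) = \<beta> a b" if "a \<in> carrier M" "b \<in> carrier N"
    using that by (simp add: ang_eq cos tensor_lift_pure[OF W \<beta>])
qed

lemma linear_map_inner_eqI:
  assumes f: "linear_map R I W f" and g: "linear_map R I W g"
    and "\<And>a b. \<lbrakk>a \<in> carrier M; b \<in> carrier N\<rbrakk> \<Longrightarrow> f (ang a b) = g (ang a b)" and "Z \<in> carrier I"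
  shows "f Z = g Z"
  using assms(4)
  by (induction rule: inner_induct) (simp_all add: assms(3) linear_map_add[OF f] linear_map_add[OF g])

text \<open>
  Once a linear map with the right values on the elements \<open>\<langle>a,b\<rangle>\<close> is known, the map defined
  through representatives is that map; the relations need not be checked again.
\<close>

lemma inner_lift_eq:
  assumes W: "module R W" and g: "linear_map R I W g"
    and \<beta>: "\<And>a b. \<lbrakk>a \<in> carrier M; b \<in> carrier N\<rbrakk> \<Longrightarrow> \<beta> a b = g (ang a b)"
    and Z: "Z \<in> carrier I"
  shows "inner_lift R W \<beta> Z = g Z"
proof -
  have bil': "bilinear_map R M N W (\<lambda>a b. g (ang a b))"
    by (rule bilinear_map_comp[OF ang_bilinear g])
  have bil: "bilinear_map R M N W \<beta>"
    unfolding bilinear_map_def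
    by (intro conjI ballI linear_map_cong[OF module_M bilinear_map_left[OF bil'] \<beta>]
      linear_map_cong[OF module_N bilinear_map_right[OF bil'] \<beta>])
  have tl: "tensor_lift R W \<beta> u = g (cos u)" if "u \<in> carrier T" for u
    using linear_map_comp[OF cos_linear g] \<beta> that by (intro tensor_lift_eq[OF W]) (simp_all add: ang_eq)
  obtain u where u: "u \<in> carrier T" "Z = cos u"
    using carrier_I[OF Z] by blast
  have "tensor_lift R W \<beta> (tact m m) = \<zero>\<^bsub>W\<^esub>" if "m \<in> carrier T" for m
    using that linear_map_zero[OF module_I W g]
      by (simp add: tl cos_zero_iff[THEN iffD2, OF _ tact_self])
  from inner_lift_cos[OF W bil this] show ?thesis
    using u by (simp add: tl)
qed

subsection \<open>The Lie algebra structure of the inner part and its action\<close>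

abbreviation am where "am \<equiv> inner_act_m R P"
abbreviation ap where "ap \<equiv> inner_act_p R P"
abbreviation br where "br \<equiv> inner_bracket R P"

lemma act_m_square: "\<lbrakk>m \<in> carrier T; c \<in> carrier M\<rbrakk> \<Longrightarrow> tensor_lift R M (\<lambda>a b. t a b c) (tact m m) = \<zero>\<^bsub>M\<^esub>"
  using irel_act_m[OF tact_self] by (simp add: act_m_def)

lemma act_p_square:
  "\<lbrakk>m \<in> carrier T; d \<in> carrier N\<rbrakk> \<Longrightarrow> tensor_lift R N (\<lambda>a b. \<ominus>\<^bsub>N\<^esub> s b a d) (tact m m) = \<zero>\<^bsub>N\<^esub>"
  using irel_act_p[OF tact_self] by (simp add: act_p_def)

lemma am_cos: "\<lbrakk>u \<in> carrier T; c \<in> carrier M\<rbrakk> \<Longrightarrow> am (cos u) c = act_m u c"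
  by (simp add: inner_act_m_def act_m_def inner_lift_cos[OF module_M t_bilinear act_m_square])

lemma ap_cos: "\<lbrakk>u \<in> carrier T; d \<in> carrier N\<rbrakk> \<Longrightarrow> ap (cos u) d = act_p u d"
  by (simp add: inner_act_p_def act_p_def inner_lift_cos[OF module_N s_bilinear act_p_square])

lemma am_linear1: "c \<in> carrier M \<Longrightarrow> linear_map R I M (\<lambda>Z. am Z c)"
  unfolding inner_act_m_def by (rule inner_lift_linear[OF module_M t_bilinear act_m_square])

lemma ap_linear1: "d \<in> carrier N \<Longrightarrow> linear_map R I N (\<lambda>Z. ap Z d)"
  unfolding inner_act_p_def by (rule inner_lift_linear[OF module_N s_bilinear act_p_square])

lemma am_linear2:
  assumes "Z \<in> carrier I" shows "linear_map R M M (am Z)"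
proof -
  obtain u where u: "u \<in> carrier T" "Z = cos u" using carrier_I[OF assms] by blast
  show ?thesis
    using act_m_linear2[OF u(1)] by (rule linear_map_cong[OF module_M]) (simp add: u am_cos)
qed

lemma ap_linear2:
  assumes "Z \<in> carrier I" shows "linear_map R N N (ap Z)"
proof -
  obtain u where u: "u \<in> carrier T" "Z = cos u" using carrier_I[OF assms] by blast
  show ?thesis
    using act_p_linear2[OF u(1)] by (rule linear_map_cong[OF module_N]) (simp add: u ap_cos)
qed

lemma ang_act:
  assumes "a \<in> carrier M" "b \<in> carrier N"
  shows "c \<in> carrier M \<Longrightarrow> am (ang a b) c = t a b c"
    and "d \<in> carrier N \<Longrightarrow> ap (ang a b) d = \<ominus>\<^bsub>N\<^esub> s b a d"
  using assms by (simp_all add: ang_eq am_cos ap_cos act_pure)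

text \<open>
  The bracket is defined by lifting twice. Both lifts exist because of the invariance of the
  relations: the inner one by \<open>irel_tact_right\<close>, the outer one by \<open>irel_tact_left\<close>.
\<close>

lemma br_cos:
  assumes u: "u \<in> carrier T" and w: "w \<in> carrier T"
  shows "br (cos u) (cos w) = cos (tact u w)"
proof -
  have tw: "linear_map R T I (\<lambda>w. cos (tact x w))" if "x \<in> carrier T" for x
    using linear_map_comp[OF tact_linear2[OF that] cos_linear] .
  have uw: "linear_map R T I (\<lambda>u. cos (tact u w))"
    using linear_map_comp[OF tact_linear1[OF w] cos_linear] .
  have 1: "inner_lift R I (\<lambda>c d. ang (t a b c) d \<ominus>\<^bsub>I\<^esub> ang c (s b a d)) (cos w) = cos (tact (pure a b) w)"
    if ab: "a \<in> carrier M" "b \<in> carrier N" for a b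
  proof -
    obtain g where g: "linear_map R I I g" "\<And>w. w \<in> carrier T \<Longrightarrow> g (cos w) = cos (tact (pure a b) w)"
    proof
      have p: "pure a b \<in> carrier T" using ab by simp
      show "linear_map R I I (\<lambda>Z. the_elem ((\<lambda>w. cos (tact (pure a b) w)) ` Z))"
        using I.linear_the_elem[OF module_I tw[OF p] irel_tact_right[OF p]] by (simp add: I_eq)
      show "the_elem ((\<lambda>w. cos (tact (pure a b) w)) ` cos w) = cos (tact (pure a b) w)"
        if "w \<in> carrier T" for w
        using I.the_elem_coset[OF module_I tw[OF p] irel_tact_right[OF p] that] .
    qed
    show ?thesis
      by (subst inner_lift_eq[OF module_I g(1)])
        (use ab w in \<open>simp_all add: g ang_eq tact_pure act_pure cos_add Im.minus_eq pure_simps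
          linear_map_neg[OF module_T module_I cos_linear]\<close>)
  qed
  obtain g where g: "linear_map R I I g" "\<And>u. u \<in> carrier T \<Longrightarrow> g (cos u) = cos (tact u w)"
  proof -
    have z: "cos (tact n w) = \<zero>\<^bsub>I\<^esub>" if "n \<in> irel" for n
      using that w linear_map_zero[OF module_T module_I cos_linear] by (simp add: irel_tact_left)
    show thesis
      using that[of "\<lambda>Z. the_elem ((\<lambda>u. cos (tact u w)) ` Z)"]
        I.linear_the_elem[OF module_I uw z] I.the_elem_coset[OF module_I uw z]
      by (simp add: I_eq)
  qed
  have "br (cos u) (cos w) = g (cos u)"
    unfolding inner_bracket_def
    by (rule inner_lift_eq[OF module_I g(1)]) (use u w g(2)[OF pure_closed] in \<open>simp_all add: 1 flip:
        ang_eq\<close>)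
  then show ?thesis using u by (simp add: g)
qed

lemma br_linear2:
  assumes "Z \<in> carrier I" shows "linear_map R I I (br Z)"
proof -
  obtain u where u: "u \<in> carrier T" "Z = cos u" using carrier_I[OF assms] by blast
  show ?thesis
  proof (rule linear_mapI)
    fix W assume "W \<in> carrier I"
    then obtain w where w: "w \<in> carrier T" "W = cos w" using carrier_I by blast
    show "br Z W \<in> carrier I" using u w by (simp add: br_cos)
    show "br Z (r \<odot>\<^bsub>I\<^esub> W) = r \<odot>\<^bsub>I\<^esub> br Z W" if "r \<in> carrier R" for r
      using u w that linear_map_smult[OF cos_linear, symmetric] linear_map_smult[OF tact_linear2, of u r
          w]
      by (simp add: br_cos)
    fix Y assume "Y \<in> carrier I"
    then obtain y where y: "y \<in> carrier T" "Y = cos y" using carrier_I by blast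
    show "br Z (W \<oplus>\<^bsub>I\<^esub> Y) = br Z W \<oplus>\<^bsub>I\<^esub> br Z Y"
      using u w y by (simp add: br_cos tact_simps flip: cos_add)
  qed
qed

lemma br_closed [simp]: "\<lbrakk>Z \<in> carrier I; Y \<in> carrier I\<rbrakk> \<Longrightarrow> br Z Y \<in> carrier I"
  by (rule linear_map_closed[OF br_linear2])

lemma br_self: "Z \<in> carrier I \<Longrightarrow> br Z Z = \<zero>\<^bsub>I\<^esub>"
  using carrier_I[of Z] by (auto simp: br_cos cos_zero_iff[THEN iffD2, OF _ tact_self])

lemma br_antisym:
  assumes "Z \<in> carrier I" "Y \<in> carrier I" shows "br Z Y = \<ominus>\<^bsub>I\<^esub> br Y Z"
proof -
  obtain u where "u \<in> carrier T" "Z = cos u"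
    using carrier_I[OF assms(1)] by blast
  moreover obtain w where "w \<in> carrier T" "Y = cos w"
    using carrier_I[OF assms(2)] by blast
  ultimately show ?thesis
    using tact_polar[of u w] by (simp add: br_cos cos_add Im.add.inv_equality Im.minus_equality)
qed

lemma br_linear1:
  assumes "Y \<in> carrier I" shows "linear_map R I I (\<lambda>Z. br Z Y)"
  using linear_map_uminus[OF module_I br_linear2[OF assms]]
  by (rule linear_map_cong[OF module_I]) (rule br_antisym[OF _ assms])

lemma am_closed [simp]: "\<lbrakk>Z \<in> carrier I; c \<in> carrier M\<rbrakk> \<Longrightarrow> am Z c \<in> carrier M"
  by (rule linear_map_closed[OF am_linear2])

lemma ap_closed [simp]: "\<lbrakk>Z \<in> carrier I; c \<in> carrier N\<rbrakk> \<Longrightarrow> ap Z c \<in> carrier N"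
  by (rule linear_map_closed[OF ap_linear2])

lemma am_br:
  assumes "Z \<in> carrier I" "Y \<in> carrier I" "c \<in> carrier M"
  shows "am (br Z Y) c = am Z (am Y c) \<ominus>\<^bsub>M\<^esub> am Y (am Z c)"
proof -
  obtain u where "u \<in> carrier T" "Z = cos u"
    using carrier_I[OF assms(1)] by blast
  moreover obtain w where "w \<in> carrier T" "Y = cos w"
    using carrier_I[OF assms(2)] by blast
  ultimately show ?thesis
    using assms(3) by (simp add: br_cos am_cos act_m_tact)
qed

lemma ap_br:
  assumes "Z \<in> carrier I" "Y \<in> carrier I" "c \<in> carrier N"
  shows "ap (br Z Y) c = ap Z (ap Y c) \<ominus>\<^bsub>N\<^esub> ap Y (ap Z c)"
proof -
  obtain u where "u \<in> carrier T" "Z = cos u"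
    using carrier_I[OF assms(1)] by blast
  moreover obtain w where "w \<in> carrier T" "Y = cos w"
    using carrier_I[OF assms(2)] by blast
  ultimately show ?thesis
    using assms(3) by (simp add: br_cos ap_cos act_p_tact)
qed

text \<open>
  The equivariance of the action on the tensor product becomes the Jacobi identity.
\<close>

lemma br_br:
  assumes "Z \<in> carrier I" "Y \<in> carrier I" "W \<in> carrier I"
  shows "br (br Z Y) W = br Z (br Y W) \<ominus>\<^bsub>I\<^esub> br Y (br Z W)"
proof -
  obtain u where "u \<in> carrier T" "Z = cos u"
    using carrier_I[OF assms(1)] by blast
  moreover obtain w where "w \<in> carrier T" "Y = cos w"
    using carrier_I[OF assms(2)] by blast
  moreover obtain y where "y \<in> carrier T" "W = cos y"
    using carrier_I[OF assms(3)] by blast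
  ultimately show ?thesis
    by (simp add: br_cos tact_tact linear_map_minus[OF module_T module_I cos_linear])
qed

lemma br_ang:
  assumes "Z \<in> carrier I" "a \<in> carrier M" "b \<in> carrier N"
  shows "br Z (ang a b) = ang (am Z a) b \<oplus>\<^bsub>I\<^esub> ang a (ap Z b)"
proof -
  obtain u where "u \<in> carrier T" "Z = cos u"
    using carrier_I[OF assms(1)] by blast
  then show ?thesis
    using assms(2,3) by (simp add: ang_eq br_cos tact_pure am_cos ap_cos cos_add)
qed

lemma ang_br:
  assumes "Z \<in> carrier I" "a \<in> carrier M" "b \<in> carrier N"
  shows "br (ang a b) Z = \<ominus>\<^bsub>I\<^esub> (ang (am Z a) b \<oplus>\<^bsub>I\<^esub> ang a (ap Z b))"
  using assms by (simp add: br_antisym[of "ang a b" Z] br_ang)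

end

section \<open>The Tits-Kantor-Koecher Lie algebra\<close>

context jpair
begin

abbreviation L where "L \<equiv> tkk R P"

lemma tkk_simps:
  "carrier L = carrier M \<times> carrier I \<times> carrier N"
  "\<zero>\<^bsub>L\<^esub> = (\<zero>\<^bsub>M\<^esub>, \<zero>\<^bsub>I\<^esub>, \<zero>\<^bsub>N\<^esub>)"
  "(a, Z, b) \<oplus>\<^bsub>L\<^esub> (c, Y, d) = (a \<oplus>\<^bsub>M\<^esub> c, Z \<oplus>\<^bsub>I\<^esub> Y, b \<oplus>\<^bsub>N\<^esub> d)"
  "r \<odot>\<^bsub>L\<^esub> (a, Z, b) = (r \<odot>\<^bsub>M\<^esub> a, r \<odot>\<^bsub>I\<^esub> Z, r \<odot>\<^bsub>N\<^esub> b)"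
  by (simp_all add: tkk_def Let_def)

lemma tkk_bracket:
  "bracket L (a, Z, b) (c, Y, d) =
    (am Z c \<ominus>\<^bsub>M\<^esub> am Y a, (br Z Y \<oplus>\<^bsub>I\<^esub> ang a d) \<ominus>\<^bsub>I\<^esub> ang c b, ap Z d \<ominus>\<^bsub>N\<^esub> ap Y b)"
  by (simp add: tkk_def Let_def)

lemma tkk_grade:
  "grade L (- 1) = carrier M \<times> {\<zero>\<^bsub>I\<^esub>} \<times> {\<zero>\<^bsub>N\<^esub>}"
  "grade L 0 = {\<zero>\<^bsub>M\<^esub>} \<times> carrier I \<times> {\<zero>\<^bsub>N\<^esub>}"
  "grade L 1 = {\<zero>\<^bsub>M\<^esub>} \<times> {\<zero>\<^bsub>I\<^esub>} \<times> carrier N"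
  "1 < \<bar>i\<bar> \<Longrightarrow> grade L i = {\<zero>\<^bsub>L\<^esub>}"
  by (auto simp: tkk_def Let_def)

lemma module_L: "module R L"
proof (rule moduleI)
  show "abelian_group L"
  proof (rule abelian_groupI)
    fix x assume "x \<in> carrier L"
    then obtain a Z b where "x = (a, Z, b)" "a \<in> carrier M" "Z \<in> carrier I" "b \<in> carrier N"
      by (auto simp: tkk_simps)
    then show "\<exists>y\<in>carrier L. y \<oplus>\<^bsub>L\<^esub> x = \<zero>\<^bsub>L\<^esub>"
      by (intro bexI[of _ "(\<ominus>\<^bsub>M\<^esub> a, \<ominus>\<^bsub>I\<^esub> Z, \<ominus>\<^bsub>N\<^esub> b)"])
        (simp_all add: tkk_simps M.l_neg N.l_neg Im.l_neg)
  qed (auto simp: tkk_simps M.a_ac N.a_ac Im.a_ac)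
qed (auto simp: tkk_simps M.R.is_cring M.smult_l_distr M.smult_r_distr M.smult_assoc1 N.smult_l_distr
    N.smult_r_distr
  N.smult_assoc1 Im.smult_l_distr Im.smult_r_distr Im.smult_assoc1)

sublocale L: module R L by (rule module_L)

lemma linear_map_tkkI:
  assumes "linear_map R V M f" "linear_map R V I g" "linear_map R V N h"
  shows "linear_map R V L (\<lambda>x. (f x, g x, h x))"
  using assms by (auto simp: linear_map_def tkk_simps Pi_iff)

lemma tkk_proj_linear:
  "linear_map R L M fst" "linear_map R L I (\<lambda>x. fst (snd x))" "linear_map R L N (\<lambda>x. snd (snd x))"
  by (auto simp: linear_map_def tkk_simps)

lemma tkk_inj_linear:
  "linear_map R M L (\<lambda>a. (a, \<zero>\<^bsub>I\<^esub>, \<zero>\<^bsub>N\<^esub>))" "linear_map R I L (\<lambda>Z. (\<zero>\<^bsub>M\<^esub>, Z, \<zero>\<^bsub>N\<^esub>))"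
  "linear_map R N L (\<lambda>b. (\<zero>\<^bsub>M\<^esub>, \<zero>\<^bsub>I\<^esub>, b))"
  by (auto simp: linear_map_def tkk_simps)

lemmas ang_left = bilinear_map_left[OF ang_bilinear]
lemmas ang_right = bilinear_map_right[OF ang_bilinear]

lemma bracket_bilinear: "bilinear_map R L L L (bracket L)"
proof -
  have eq: "bracket L x y =
    (am (fst (snd x)) (fst y) \<ominus>\<^bsub>M\<^esub> am (fst (snd y)) (fst x),
     (br (fst (snd x)) (fst (snd y)) \<oplus>\<^bsub>I\<^esub> ang (fst x) (snd (snd y))) \<ominus>\<^bsub>I\<^esub> ang (fst y) (snd (snd x)),
     ap (fst (snd x)) (snd (snd y)) \<ominus>\<^bsub>N\<^esub> ap (fst (snd y)) (snd (snd x)))" for x y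
    by (cases x; cases y) (simp add: tkk_bracket)
  show ?thesis
    unfolding bilinear_map_def eq
    by (intro conjI ballI linear_map_tkkI linear_map_diff linear_map_plus module_M module_I module_N
      linear_map_comp[OF tkk_proj_linear(1) am_linear2] linear_map_comp[OF tkk_proj_linear(2) am_linear1]
      linear_map_comp[OF tkk_proj_linear(3) ap_linear2] linear_map_comp[OF tkk_proj_linear(2) ap_linear1]
      linear_map_comp[OF tkk_proj_linear(2) br_linear2] linear_map_comp[OF tkk_proj_linear(2) br_linear1]
      linear_map_comp[OF tkk_proj_linear(1) ang_left] linear_map_comp[OF tkk_proj_linear(3) ang_right])
      (auto simp: tkk_simps)
qed

lemmas inner_simps =
  am_linear1[THEN linear_map_add] am_linear2[THEN linear_map_add]
  am_linear1[THEN linear_map_neg[OF module_I module_M]] am_linear2[THEN linear_map_neg[OF module_M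
      module_M]]
  am_linear1[THEN linear_map_zero[OF module_I module_M]] am_linear2[THEN linear_map_zero[OF module_M
      module_M]]
  ap_linear1[THEN linear_map_add] ap_linear2[THEN linear_map_add]
  ap_linear1[THEN linear_map_neg[OF module_I module_N]] ap_linear2[THEN linear_map_neg[OF module_N
      module_N]]
  ap_linear1[THEN linear_map_zero[OF module_I module_N]] ap_linear2[THEN linear_map_zero[OF module_N
      module_N]]
  br_linear1[THEN linear_map_add] br_linear2[THEN linear_map_add]
  br_linear1[THEN linear_map_neg[OF module_I module_I]] br_linear2[THEN linear_map_neg[OF module_I
      module_I]]
  br_linear1[THEN linear_map_zero[OF module_I module_I]] br_linear2[THEN linear_map_zero[OF module_I
      module_I]]
  ang_left[THEN linear_map_add] ang_right[THEN linear_map_add]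
  ang_left[THEN linear_map_neg[OF module_M module_I]] ang_right[THEN linear_map_neg[OF module_N
      module_I]]
  ang_left[THEN linear_map_zero[OF module_M module_I]] ang_right[THEN linear_map_zero[OF module_N
      module_I]]

text \<open>
  Each component of the Jacobi sum cancels after the actions of brackets and of elements \<open>\<langle>a,b\<rangle>\<close>
  have been expanded.
\<close>

lemma tkk_lie: "is_lie_algebra R L"
proof -
  have "bracket L x x = \<zero>\<^bsub>L\<^esub>" if "x \<in> carrier L" for x
    using that by (auto simp: tkk_simps tkk_bracket br_self M.minus_eq M.r_neg N.minus_eq N.r_neg
        Im.minus_eq Im.r_neg)
  moreover have "(bracket L x (bracket L y z) \<oplus>\<^bsub>L\<^esub> bracket L y (bracket L z x))
          \<oplus>\<^bsub>L\<^esub> bracket L z (bracket L x y) = \<zero>\<^bsub>L\<^esub>"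
    if "x \<in> carrier L" "y \<in> carrier L" "z \<in> carrier L" for x y z
  proof -
    obtain a Z b where x: "x = (a, Z, b)" "a \<in> carrier M" "Z \<in> carrier I" "b \<in> carrier N"
      using \<open>x \<in> carrier L\<close> by (auto simp: tkk_simps)
    obtain c Y d where y: "y = (c, Y, d)" "c \<in> carrier M" "Y \<in> carrier I" "d \<in> carrier N"
      using \<open>y \<in> carrier L\<close> by (auto simp: tkk_simps)
    obtain e W f where z: "z = (e, W, f)" "e \<in> carrier M" "W \<in> carrier I" "f \<in> carrier N"
      using \<open>z \<in> carrier L\<close> by (auto simp: tkk_simps)
    note facts = x y z
    note simps = inner_simps ang_act M.minus_eq Im.minus_eq N.minus_eq
    \<comment> \<open>The three cyclic terms in degree 0 are expressed by two of them, which makes them visible to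
        cancellation.\<close>
    have br_cyc: "br W (br Z Y) = br Y (br Z W) \<ominus>\<^bsub>I\<^esub> br Z (br Y W)" "br Y (br W Z) = \<ominus>\<^bsub>I\<^esub> br Y (br Z W)"
      using facts by (simp_all add: br_antisym[of W "br Z Y"] br_antisym[of W Z] br_br inner_simps
        Im.minus_eq Im.minus_add Im.a_comm)
    show ?thesis
      unfolding x y z tkk_bracket tkk_simps prod.inject
      apply (intro conjI)
      subgoal
        by (rule M.eq_if_signed) (use facts in \<open>simp_all add: simps am_br t_commute M.signed_norm\<close>)
      subgoal
        by (rule Im.eq_if_signed) (use facts in \<open>simp_all add: simps br_cyc br_ang ang_br
            Im.signed_norm\<close>)
      subgoal
        by (rule N.eq_if_signed) (use facts in \<open>simp_all add: simps ap_br s_commute N.signed_norm\<close>)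
      done
  qed
  ultimately show ?thesis
    unfolding is_lie_algebra_def using module_L bracket_bilinear by blast
qed


lemma tkk_3graded: "is_3graded R L"
proof -
  have sub: "submodule (f ` carrier V) R L" if "module R V" "linear_map R V L f" for V :: "('k, 'v)
      module" and f
  proof -
    interpret V: module R V by fact
    note f = that(2)
    show ?thesis
    proof (rule L.submoduleI)
      show "\<zero>\<^bsub>L\<^esub> \<in> f ` carrier V"
        using linear_map_zero[OF that(1) module_L f] by (metis V.zero_closed imageI)
    qed (use f in \<open>auto simp: linear_map_closed linear_map_neg[OF that(1) module_L f, symmetric]
      linear_map_add[symmetric] linear_map_smult[symmetric]\<close>)
  qed
  have "is_direct_sum3 R L (grade L (- 1)) (grade L 0) (grade L 1)"
    unfolding is_direct_sum3_def
  proof (intro conjI ballI)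
    have "(\<lambda>a. (a, \<zero>\<^bsub>I\<^esub>, \<zero>\<^bsub>N\<^esub>)) ` carrier M = grade L (- 1)" by (auto simp: tkk_grade)
    then show "submodule (grade L (- 1)) R L"
      using sub[OF module_M tkk_inj_linear(1)] by simp
    have "(\<lambda>a. (\<zero>\<^bsub>M\<^esub>, a, \<zero>\<^bsub>N\<^esub>)) ` carrier I = grade L 0" by (auto simp: tkk_grade)
    then show "submodule (grade L 0) R L"
      using sub[OF module_I tkk_inj_linear(2)] by simp
    have "(\<lambda>a. (\<zero>\<^bsub>M\<^esub>, \<zero>\<^bsub>I\<^esub>, a)) ` carrier N = grade L 1" by (auto simp: tkk_grade)
    then show "submodule (grade L 1) R L"
      using sub[OF module_N tkk_inj_linear(3)] by simp
    fix x assume "x \<in> carrier L"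
    then obtain a Z b where x: "x = (a, Z, b)" "a \<in> carrier M" "Z \<in> carrier I" "b \<in> carrier N"
      by (auto simp: tkk_simps)
    show "\<exists>!p. p \<in> grade L (- 1) \<times> grade L 0 \<times> grade L 1 \<and>
        x = (fst p \<oplus>\<^bsub>L\<^esub> fst (snd p)) \<oplus>\<^bsub>L\<^esub> snd (snd p)"
      by (rule ex1I[of _ "((a, \<zero>\<^bsub>I\<^esub>, \<zero>\<^bsub>N\<^esub>), (\<zero>\<^bsub>M\<^esub>, Z, \<zero>\<^bsub>N\<^esub>), (\<zero>\<^bsub>M\<^esub>, \<zero>\<^bsub>I\<^esub>, b))"])
        (use x in \<open>auto simp: tkk_simps tkk_grade\<close>)
  qed
  moreover have "bracket L x y \<in> grade L (i + j)" if xy: "x \<in> grade L i" "y \<in> grade L j" for i j x y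
  proof -
    have zero: "\<zero>\<^bsub>L\<^esub> \<in> grade L k" for k
      by (auto simp: tkk_def Let_def)
    have grade: "grade L k \<subseteq> carrier L" for k
      by (auto simp: tkk_def Let_def)
    have left: "bracket L \<zero>\<^bsub>L\<^esub> y = \<zero>\<^bsub>L\<^esub>" and right: "bracket L x \<zero>\<^bsub>L\<^esub> = \<zero>\<^bsub>L\<^esub>"
      using linear_map_zero[OF module_L module_L bilinear_map_left[OF bracket_bilinear]]
        linear_map_zero[OF module_L module_L bilinear_map_right[OF bracket_bilinear]] grade xy by blast+
    have *: "k = -1 \<or> k = 0 \<or> k = 1 \<or> 1 < \<bar>k\<bar>" for k :: int by linarith
    show ?thesis
    proof (cases "1 < \<bar>i\<bar> \<or> 1 < \<bar>j\<bar>")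
      case True
      then show ?thesis
        using xy left right zero tkk_grade(4) by (metis singletonD)
    next
      case False
      with *[of i] *[of j] show ?thesis
        using xy by (elim disjE)
          (auto simp: tkk_grade tkk_bracket inner_simps tkk_simps M.minus_eq N.minus_eq Im.minus_eq)
    qed
  qed
  ultimately show ?thesis
    using tkk_lie tkk_grade(4) unfolding is_3graded_def by blast
qed

end

section \<open>Lie algebras and their Jordan pairs\<close>

lemma restrict_module_simps [simp]:
  "carrier (restrict_module M S) = S"
  "\<zero>\<^bsub>restrict_module M S\<^esub> = \<zero>\<^bsub>M\<^esub>"
  "add (restrict_module M S) = add M"
  "smult (restrict_module M S) = smult M"
  by (simp_all add: restrict_module_def module.truncate_def)

lemma module_restrict_module:
  assumes "module R M" "submodule S R M"
  shows "module R (restrict_module M S)"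
  by (rule module_cong[OF submodule.submodule_is_module[OF assms(2,1)]]) simp_all

text \<open>
  Negation in a record is defined by a description over its carrier, so it has to be compared
  explicitly.
\<close>

lemma restrict_module_a_inv:
  assumes "module R M" "submodule S R M" "x \<in> S"
  shows "\<ominus>\<^bsub>restrict_module M S\<^esub> x = \<ominus>\<^bsub>M\<^esub> x"
proof -
  interpret M: module R M by fact
  interpret S: module R "restrict_module M S" by (rule module_restrict_module[OF assms(1,2)])
  show ?thesis
    using M.submoduleE[OF assms(2)] assms(3) by (intro S.minus_equality) (auto simp: M.l_neg)
qed

lemma linear_map_restrict_codom:
  assumes "linear_map R V M f" "\<And>x. x \<in> carrier V \<Longrightarrow> f x \<in> S"
  shows "linear_map R V (restrict_module M S) f"
  using assms by (auto simp: linear_map_def)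

lemma linear_map_restrict_dom:
  assumes "linear_map R M V f" "S \<subseteq> carrier M"
  shows "linear_map R (restrict_module M S) V f"
  using assms by (intro linear_mapI) (simp_all add: linear_mapD subset_iff)

lemma linear_map_into_carrier:
  assumes "linear_map R V (restrict_module M S) f" "S \<subseteq> carrier M"
  shows "linear_map R V M f"
  using linear_mapD[OF assms(1)] assms(2) by (intro linear_mapI) auto

locale lie =
  fixes R :: "('k, 'r) ring_scheme" and L :: "('k, 'l, 'x) lie_algebra_scheme"
  assumes lie_algebra: "is_lie_algebra R L"
begin

abbreviation lb where "lb \<equiv> bracket L"

lemma module_lie: "module R L" using lie_algebra by (simp add: is_lie_algebra_def)

sublocale module R L by (rule module_lie)

lemma lb_bilinear: "bilinear_map R L L L lb" using lie_algebra by (simp add: is_lie_algebra_def)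

lemmas lb_left = bilinear_map_left[OF lb_bilinear]
lemmas lb_right = bilinear_map_right[OF lb_bilinear]

lemma lb_closed [simp]: "\<lbrakk>x \<in> carrier L; y \<in> carrier L\<rbrakk> \<Longrightarrow> lb x y \<in> carrier L"
  by (rule linear_map_closed[OF lb_right])

lemmas lb_simps =
  lb_left[THEN linear_map_add] lb_right[THEN linear_map_add]
  lb_left[THEN linear_map_neg[OF module_lie module_lie]] lb_right[THEN linear_map_neg[OF module_lie
      module_lie]]
  lb_left[THEN linear_map_zero[OF module_lie module_lie]] lb_right[THEN linear_map_zero[OF module_lie
      module_lie]]

lemma lb_self: "x \<in> carrier L \<Longrightarrow> lb x x = \<zero>\<^bsub>L\<^esub>"
  using lie_algebra by (simp add: is_lie_algebra_def)

lemma lb_antisym: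
  assumes "x \<in> carrier L" "y \<in> carrier L"
  shows "lb x y = \<ominus>\<^bsub>L\<^esub> lb y x"
proof -
  have "lb (x \<oplus>\<^bsub>L\<^esub> y) (x \<oplus>\<^bsub>L\<^esub> y) = lb x y \<oplus>\<^bsub>L\<^esub> lb y x"
    using assms lb_self[of x] lb_self[of y] by (simp add: lb_simps M.a_comm)
  then have "lb x y \<oplus>\<^bsub>L\<^esub> lb y x = \<zero>\<^bsub>L\<^esub>"
    using assms lb_self[of "x \<oplus>\<^bsub>L\<^esub> y"] by simp
  from M.minus_equality[OF this] show ?thesis using assms by simp
qed

text \<open>
  The Jacobi identity in the form that moves brackets to the right. Iterated, it rewrites every
  bracket of fixed elements ending in \<open>x\<close> to a combination of right-nested ones, so that
  consequences of the Jacobi identity follow by cancellation.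
\<close>

lemma lb_lb:
  assumes "x \<in> carrier L" "y \<in> carrier L" "z \<in> carrier L"
  shows "lb (lb x y) z = lb x (lb y z) \<ominus>\<^bsub>L\<^esub> lb y (lb x z)"
proof -
  have "(lb x (lb y z) \<oplus>\<^bsub>L\<^esub> lb y (lb z x)) \<oplus>\<^bsub>L\<^esub> lb z (lb x y) = \<zero>\<^bsub>L\<^esub>"
    using lie_algebra assms by (simp add: is_lie_algebra_def)
  moreover have "lb y (lb z x) = \<ominus>\<^bsub>L\<^esub> lb y (lb x z)" "lb z (lb x y) = \<ominus>\<^bsub>L\<^esub> lb (lb x y) z"
    using assms by (simp_all add: lb_antisym[of z x] lb_antisym[of z "lb x y"] lb_simps)
  ultimately have "(lb x (lb y z) \<ominus>\<^bsub>L\<^esub> lb y (lb x z)) \<ominus>\<^bsub>L\<^esub> lb (lb x y) z = \<zero>\<^bsub>L\<^esub>"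
    by (simp add: M.minus_eq)
  note zero = this
  have "lb x (lb y z) \<ominus>\<^bsub>L\<^esub> lb y (lb x z) = lb (lb x y) z"
    by (rule M.eq_if_signed) (use assms zero in \<open>simp_all add: signed_def M.minus_eq\<close>)
  then show ?thesis by simp
qed

lemmas lie_norm = lb_lb lb_simps M.minus_eq M.signed_norm

end

locale gla =
  fixes R :: "('k, 'r) ring_scheme" and L :: "('k, 'l) graded_lie_algebra"
  assumes graded: "is_3graded R L"
begin

sublocale lie R L using graded by unfold_locales (simp add: is_3graded_def)

lemma grade_bracket: "\<lbrakk>x \<in> grade L i; y \<in> grade L j\<rbrakk> \<Longrightarrow> lb x y \<in> grade L (i + j)"
  using graded unfolding is_3graded_def by blast

lemma grade_outside: "1 < \<bar>i\<bar> \<Longrightarrow> grade L i = {\<zero>\<^bsub>L\<^esub>}"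
  using graded unfolding is_3graded_def by blast

lemma submodule_grade: "submodule (grade L i) R L"
proof -
  consider "i = - 1" | "i = 0" | "i = 1" | "1 < \<bar>i\<bar>" by linarith
  then show ?thesis
  proof cases
    case 4
    then show ?thesis by (intro submoduleI) (auto simp: grade_outside)
  qed (use graded in \<open>auto simp: is_3graded_def is_direct_sum3_def\<close>)
qed

lemma grade_subset: "grade L i \<subseteq> carrier L"
  using submoduleE(1)[OF submodule_grade] .

lemma gradeD [dest, simp]: "x \<in> grade L i \<Longrightarrow> x \<in> carrier L"
  using grade_subset by blast

lemma zero_grade [simp]: "\<zero>\<^bsub>L\<^esub> \<in> grade L i"
  using subgroup.one_closed[OF submodule.axioms(1)[OF submodule_grade]] by simp

lemma module_grade: "module R (restrict_module L (grade L i))"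
  by (rule module_restrict_module[OF module_lie submodule_grade])

lemma grade_commute: "\<lbrakk>x \<in> grade L i; y \<in> grade L i; \<bar>i\<bar> = 1\<rbrakk> \<Longrightarrow> lb x y = \<zero>\<^bsub>L\<^esub>"
  using grade_bracket[of x i y i] grade_outside[of "i + i"] by auto

lemma grade_triple: "\<lbrakk>a \<in> grade L i; b \<in> grade L (- i); c \<in> grade L i\<rbrakk> \<Longrightarrow> lb (lb a b) c \<in> grade L i"
  using grade_bracket[OF grade_bracket, of a i b "- i" c i] by simp

text \<open>
  The two sides differ by \<open>[b, [a,c]]\<close>, and \<open>[a,c]\<close> has degree \<open>\<plusminus>2\<close>.
\<close>

lemma grade_triple_commute:
  assumes "a \<in> grade L i" "b \<in> grade L (- i)" "c \<in> grade L i" "\<bar>i\<bar> = 1"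
  shows "lb (lb a b) c = lb (lb c b) a"
proof -
  have [simp]: "lb a c = \<zero>\<^bsub>L\<^esub>" "lb c a = \<zero>\<^bsub>L\<^esub>"
    using assms by (auto intro: grade_commute)
  have "lb c (lb b a) = lb (lb a b) c"
    using assms lb_antisym[of c "lb b a"] lb_antisym[of b a] by (simp add: lb_simps)
  moreover have "lb (lb c b) a = lb c (lb b a)"
    using assms by (simp add: lb_lb lb_simps M.minus_eq)
  ultimately show ?thesis by simp
qed

text \<open>
  The Jordan pair identity holds in every Lie algebra for \<open>{a,b,c} = [[a,b],c]\<close>; only the
  symmetry of the triple product needs the grading. Both signs are treated at once.
\<close>

lemma jordan_product_grade:
  assumes i: "\<bar>i\<bar> = 1"
  shows "jordan_product R (restrict_module L (grade L i)) (restrict_module L (grade L (- i)))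
    (\<lambda>a b c. lb (lb a b) c) (\<lambda>a b c. lb (lb a b) c)"
  unfolding jordan_product_def
proof (intro conjI ballI)
  show "trilinear_map R (restrict_module L (grade L i)) (restrict_module L (grade L (- i)))
    (restrict_module L (grade L i)) (restrict_module L (grade L i)) (\<lambda>a b c. lb (lb a b) c)"
    unfolding trilinear_map_def
    by (intro conjI ballI linear_map_restrict_codom linear_map_restrict_dom grade_subset
      linear_map_comp[OF lb_left lb_left] linear_map_comp[OF lb_right lb_left] lb_right)
      (auto intro: grade_triple)
  show "lb (lb a b) c = lb (lb c b) a"
    if "a \<in> carrier (restrict_module L (grade L i))" "b \<in> carrier (restrict_module L (grade L (- i)))"
      "c \<in> carrier (restrict_module L (grade L i))" for a b c
    using that i by (auto intro: grade_triple_commute)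
  fix a b c d x
  assume asm: "a \<in> carrier (restrict_module L (grade L i))" "b \<in> carrier (restrict_module L (grade L (-
      i)))"
      "c \<in> carrier (restrict_module L (grade L i))" "d \<in> carrier (restrict_module L (grade L (- i)))"
      "x \<in> carrier (restrict_module L (grade L i))"
  note [simp] = gradeD[OF asm(1)[simplified]] gradeD[OF asm(2)[simplified]] gradeD[OF asm(3)[simplified]]
    gradeD[OF asm(4)[simplified]] gradeD[OF asm(5)[simplified]]
  have minus: "\<ominus>\<^bsub>restrict_module L (grade L i)\<^esub> y = \<ominus>\<^bsub>L\<^esub> y" if "y \<in> grade L i" for y
    by (rule restrict_module_a_inv[OF module_lie submodule_grade that])
  have "lb (lb a b) (lb (lb c d) x) \<ominus>\<^bsub>L\<^esub> lb (lb c d) (lb (lb a b) x)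
    = lb (lb (lb (lb a b) c) d) x \<ominus>\<^bsub>L\<^esub> lb (lb c (lb (lb b a) d)) x"
    by (rule M.eq_if_signed) (simp_all add: lie_norm)
  moreover have "lb (lb c d) (lb (lb a b) x) \<in> grade L i" "lb (lb c (lb (lb b a) d)) x \<in> grade L i"
    using asm grade_triple[of b "- i" a d] by (auto intro!: grade_triple)
  ultimately show "lb (lb a b) (lb (lb c d) x) \<ominus>\<^bsub>restrict_module L (grade L i)\<^esub> lb (lb c d) (lb (lb a b) x)
    = lb (lb (lb (lb a b) c) d) x \<ominus>\<^bsub>restrict_module L (grade L i)\<^esub> lb (lb c (lb (lb b a) d)) x"
    by (simp add: a_minus_def minus)
qed

lemma jordan_pair_gla: "is_jordan_pair R (jp_of_gla L)"
  using module_grade jordan_product_grade[of 1] jordan_product_grade[of "- 1"]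
  by (simp add: is_jordan_pair_def jp_of_gla_def)

end

lemma jp_of_gla_simps [simp]:
  "jpm (jp_of_gla L) = restrict_module L (grade L (- 1))"
  "jpp (jp_of_gla L) = restrict_module L (grade L 1)"
  "trm (jp_of_gla L) a b c = bracket L (bracket L a b) c"
  "trp (jp_of_gla L) a b c = bracket L (bracket L a b) c"
  by (simp_all add: jp_of_gla_def)

section \<open>The universal property\<close>

lemma lie_homD:
  assumes "\<alpha> \<in> lie_hom R L K"
  shows lie_hom_extensional: "\<alpha> \<in> extensional (carrier L)"
    and lie_hom_linear: "linear_map R L K \<alpha>"
    and lie_hom_bracket: "\<lbrakk>x \<in> carrier L; y \<in> carrier L\<rbrakk> \<Longrightarrow> \<alpha> (bracket L x y) = bracket K (\<alpha> x) (\<alpha> y)"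
  using assms by (auto simp: lie_hom_def)

context jpair
begin

abbreviation inm where "inm a \<equiv> (a, \<zero>\<^bsub>I\<^esub>, \<zero>\<^bsub>N\<^esub>)"
abbreviation inp where "inp b \<equiv> (\<zero>\<^bsub>M\<^esub>, \<zero>\<^bsub>I\<^esub>, b)"

lemma inm_inp_bracket: "\<lbrakk>a \<in> carrier M; b \<in> carrier N\<rbrakk> \<Longrightarrow> bracket L (inm a) (inp b) = (\<zero>\<^bsub>M\<^esub>, ang a b, \<zero>\<^bsub>N\<^esub>)"
  by (simp add: tkk_bracket inner_simps M.minus_eq N.minus_eq Im.minus_eq)

lemma linear_map_decompose:
  assumes "linear_map R L K f" "a \<in> carrier M" "Z \<in> carrier I" "b \<in> carrier N"
  shows "f (a, Z, b) = (f (inm a) \<oplus>\<^bsub>K\<^esub> f (\<zero>\<^bsub>M\<^esub>, Z, \<zero>\<^bsub>N\<^esub>)) \<oplus>\<^bsub>K\<^esub> f (inp b)"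
  using linear_map_add[OF assms(1), of "inm a \<oplus>\<^bsub>L\<^esub> (\<zero>\<^bsub>M\<^esub>, Z, \<zero>\<^bsub>N\<^esub>)" "inp b"]
    linear_map_add[OF assms(1), of "inm a" "(\<zero>\<^bsub>M\<^esub>, Z, \<zero>\<^bsub>N\<^esub>)"] assms(2-4)
  by (simp add: tkk_simps)

text \<open>
  \<open>TKK(P)\<close> is generated by degrees \<open>-1\<close> and \<open>1\<close>, since \<open>[a,b] = \<langle>a,b\<rangle>\<close>.
\<close>

lemma lie_hom_tkk_eqI:
  assumes \<alpha>: "\<alpha> \<in> lie_hom R L K" and \<beta>: "\<beta> \<in> lie_hom R L K"
    and m: "\<And>a. a \<in> carrier M \<Longrightarrow> \<alpha> (inm a) = \<beta> (inm a)"
    and p: "\<And>b. b \<in> carrier N \<Longrightarrow> \<alpha> (inp b) = \<beta> (inp b)"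
  shows "\<alpha> = \<beta>"
proof (rule extensionalityI[OF lie_hom_extensional[OF \<alpha>] lie_hom_extensional[OF \<beta>]])
  fix x assume "x \<in> carrier L"
  then obtain a Z b where x: "x = (a, Z, b)" "a \<in> carrier M" "Z \<in> carrier I" "b \<in> carrier N"
    by (auto simp: tkk_simps)
  have "\<alpha> (\<zero>\<^bsub>M\<^esub>, Z, \<zero>\<^bsub>N\<^esub>) = \<beta> (\<zero>\<^bsub>M\<^esub>, Z, \<zero>\<^bsub>N\<^esub>)"
  proof (rule linear_map_inner_eqI[OF linear_map_comp[OF tkk_inj_linear(2) lie_hom_linear[OF \<alpha>]]
        linear_map_comp[OF tkk_inj_linear(2) lie_hom_linear[OF \<beta>]] _ x(3)])
    fix a b assume ab: "a \<in> carrier M" "b \<in> carrier N"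
    then show "\<alpha> (\<zero>\<^bsub>M\<^esub>, ang a b, \<zero>\<^bsub>N\<^esub>) = \<beta> (\<zero>\<^bsub>M\<^esub>, ang a b, \<zero>\<^bsub>N\<^esub>)"
      using lie_hom_bracket[OF \<alpha>, of "inm a" "inp b"] lie_hom_bracket[OF \<beta>, of "inm a" "inp b"]
      by (simp add: inm_inp_bracket m p tkk_simps)
  qed
  then show "\<alpha> x = \<beta> x"
    using x m p linear_map_decompose[OF lie_hom_linear[OF \<alpha>] x(2-4)]
      linear_map_decompose[OF lie_hom_linear[OF \<beta>] x(2-4)] by simp
qed

end

text \<open>
  A homomorphism from \<open>P\<close> to the Jordan pair of \<open>K\<close> and its extension to \<open>TKK(P)\<close>. The extension
  is built in three steps: \<open>lift0\<close> on the tensor product, \<open>lift1\<close> on the inner part and \<open>lift\<close> on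
  \<open>TKK(P)\<close>.
\<close>

locale tkk_lift = jpair R P + K: gla R K
  for R :: "('k, 'r) ring_scheme" and P :: "('k, 'a, 'b) jordan_pair"
    and K :: "('k, 'l) graded_lie_algebra" +
  fixes \<gamma>m :: "'a \<Rightarrow> 'l" and \<gamma>p :: "'b \<Rightarrow> 'l"
  assumes hom: "(\<gamma>m, \<gamma>p) \<in> jp_hom R P (jp_of_gla K)"
begin

abbreviation kb where "kb \<equiv> bracket K"

lemma \<gamma>_grade [simp]:
  "a \<in> carrier M \<Longrightarrow> \<gamma>m a \<in> grade K (- 1)"
  "b \<in> carrier N \<Longrightarrow> \<gamma>p b \<in> grade K 1"
  using hom by (auto simp: jp_hom_def linear_map_def)

lemma \<gamma>_linear: "linear_map R M K \<gamma>m" "linear_map R N K \<gamma>p"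
  using hom by (auto simp: jp_hom_def intro: linear_map_into_carrier K.grade_subset)

lemma \<gamma>_closed [simp]:
  "a \<in> carrier M \<Longrightarrow> \<gamma>m a \<in> carrier K"
  "b \<in> carrier N \<Longrightarrow> \<gamma>p b \<in> carrier K"
  using \<gamma>_grade by blast+

lemma \<gamma>_triple:
  "\<lbrakk>a \<in> carrier M; b \<in> carrier N; c \<in> carrier M\<rbrakk> \<Longrightarrow> \<gamma>m (t a b c) = kb (kb (\<gamma>m a) (\<gamma>p b)) (\<gamma>m c)"
  "\<lbrakk>b \<in> carrier N; a \<in> carrier M; d \<in> carrier N\<rbrakk> \<Longrightarrow> \<gamma>p (s b a d) = kb (kb (\<gamma>p b) (\<gamma>m a)) (\<gamma>p d)"
  using hom by (auto simp: jp_hom_def)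

lemma \<gamma>_bilinear: "bilinear_map R M N K (\<lambda>a b. kb (\<gamma>m a) (\<gamma>p b))"
  by (rule bilinear_map_precomp[OF K.lb_bilinear \<gamma>_linear])

definition lift0 where "lift0 = tensor_lift R K (\<lambda>a b. kb (\<gamma>m a) (\<gamma>p b))"

lemma lift0_linear: "linear_map R T K lift0"
  unfolding lift0_def by (rule tensor_lift_linear[OF K.module_lie \<gamma>_bilinear])

lemma lift0_pure: "\<lbrakk>a \<in> carrier M; b \<in> carrier N\<rbrakk> \<Longrightarrow> lift0 (pure a b) = kb (\<gamma>m a) (\<gamma>p b)"
  unfolding lift0_def by (rule tensor_lift_pure[OF K.module_lie \<gamma>_bilinear])

lemma lift0_closed [simp]: "u \<in> carrier T \<Longrightarrow> lift0 u \<in> carrier K"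
  by (rule linear_map_closed[OF lift0_linear])

lemmas lift0_simps = linear_map_add[OF lift0_linear] lift0_pure

text \<open>
  In degrees \<open>-1\<close> and \<open>1\<close> the operator \<open>\<lambda>(u)\<close> corresponds to bracketing with the image of \<open>u\<close>,
  because \<open>\<gamma>\<close> preserves the triple products.
\<close>

lemma \<gamma>_act:
  assumes "u \<in> carrier T"
  shows "c \<in> carrier M \<Longrightarrow> \<gamma>m (act_m u c) = kb (lift0 u) (\<gamma>m c)"
    and "d \<in> carrier N \<Longrightarrow> \<gamma>p (act_p u d) = kb (lift0 u) (\<gamma>p d)"
  using assms
proof (induction rule: tensor_induct)
  case (pure a b)
  {
    case 1
    then show ?case using pure by (simp add: act_pure lift0_pure \<gamma>_triple)
  next
    case 2
    then show ?case
      using pure K.lb_antisym[of "\<gamma>p b" "\<gamma>m a"]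
      by (simp add: act_pure lift0_pure linear_map_neg[OF module_N K.module_lie \<gamma>_linear(2)] \<gamma>_triple
          K.lb_simps)
  }
qed (simp_all add: act_simps linear_map_add[OF \<gamma>_linear(1)] linear_map_add[OF \<gamma>_linear(2)]
  linear_map_add[OF lift0_linear] K.lb_simps)

text \<open>
  Bracketing with the image of \<open>u\<close> is a derivation of \<open>K\<close>, and so is \<open>\<lambda>(u)\<close> of the tensor
  product.
\<close>

lemma lift0_tact:
  assumes "u \<in> carrier T" "w \<in> carrier T"
  shows "lift0 (tact u w) = kb (lift0 u) (lift0 w)"
  using assms(2)
proof (induction rule: tensor_induct)
  case (pure a b)
  show ?case
    by (rule K.M.eq_if_signed)
      (use pure assms(1) in \<open>simp_all add: tact_pure lift0_simps \<gamma>_act K.lie_norm\<close>)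
next
  case (add x y)
  then show ?case using assms(1) by (simp add: tact_simps lift0_simps K.lb_simps)
qed

definition lift1 where "lift1 = inner_lift R K (\<lambda>a b. kb (\<gamma>m a) (\<gamma>p b))"

lemma lift0_square:
  "m \<in> carrier T \<Longrightarrow> tensor_lift R K (\<lambda>a b. kb (\<gamma>m a) (\<gamma>p b)) (tact m m) = \<zero>\<^bsub>K\<^esub>"
  using lift0_tact[of m m] by (simp add: lift0_def[symmetric] K.lb_self)

lemma lift1_linear: "linear_map R I K lift1"
  unfolding lift1_def by (rule inner_lift_linear[OF K.module_lie \<gamma>_bilinear lift0_square])

lemma lift1_cos: "u \<in> carrier T \<Longrightarrow> lift1 (cos u) = lift0 u"
  unfolding lift1_def lift0_def by (rule inner_lift_cos[OF K.module_lie \<gamma>_bilinear lift0_square])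

lemma lift1_ang: "\<lbrakk>a \<in> carrier M; b \<in> carrier N\<rbrakk> \<Longrightarrow> lift1 (ang a b) = kb (\<gamma>m a) (\<gamma>p b)"
  unfolding lift1_def by (rule inner_lift_ang[OF K.module_lie \<gamma>_bilinear lift0_square])

lemma lift1_grade: "Z \<in> carrier I \<Longrightarrow> lift1 Z \<in> grade K 0"
proof (induction rule: inner_induct)
  case (ang a b)
  then show ?case using K.grade_bracket[OF \<gamma>_grade] by (simp add: lift1_ang)
next
  case (add Z Y)
  then show ?case
    using K.submoduleE(5)[OF K.submodule_grade] by (simp add: linear_map_add[OF lift1_linear])
qed

lemma lift1_closed [simp]: "Z \<in> carrier I \<Longrightarrow> lift1 Z \<in> carrier K"
  by (rule linear_map_closed[OF lift1_linear])

lemma lift1_am: "\<lbrakk>Z \<in> carrier I; c \<in> carrier M\<rbrakk> \<Longrightarrow> \<gamma>m (am Z c) = kb (lift1 Z) (\<gamma>m c)"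
  using carrier_I[of Z] by (auto simp: am_cos lift1_cos \<gamma>_act)

lemma lift1_ap: "\<lbrakk>Z \<in> carrier I; d \<in> carrier N\<rbrakk> \<Longrightarrow> \<gamma>p (ap Z d) = kb (lift1 Z) (\<gamma>p d)"
  using carrier_I[of Z] by (auto simp: ap_cos lift1_cos \<gamma>_act)

lemma lift1_br: "\<lbrakk>Z \<in> carrier I; Y \<in> carrier I\<rbrakk> \<Longrightarrow> lift1 (br Z Y) = kb (lift1 Z) (lift1 Y)"
  using carrier_I[of Z] carrier_I[of Y] by (auto simp: br_cos lift1_cos lift0_tact)

definition lift where
  "lift = (\<lambda>(a, Z, b)\<in>carrier L. (\<gamma>m a \<oplus>\<^bsub>K\<^esub> lift1 Z) \<oplus>\<^bsub>K\<^esub> \<gamma>p b)"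

lemma lift_apply:
  "\<lbrakk>a \<in> carrier M; Z \<in> carrier I; b \<in> carrier N\<rbrakk> \<Longrightarrow>
    lift (a, Z, b) = (\<gamma>m a \<oplus>\<^bsub>K\<^esub> lift1 Z) \<oplus>\<^bsub>K\<^esub> \<gamma>p b"
  by (simp add: lift_def tkk_simps)

lemma lift_linear: "linear_map R L K lift"
proof (rule linear_map_cong[OF module_L])
  show "linear_map R L K (\<lambda>x. (\<gamma>m (fst x) \<oplus>\<^bsub>K\<^esub> lift1 (fst (snd x))) \<oplus>\<^bsub>K\<^esub> \<gamma>p (snd (snd x)))"
    by (intro linear_map_plus K.module_lie linear_map_comp[OF tkk_proj_linear(1) \<gamma>_linear(1)]
      linear_map_comp[OF tkk_proj_linear(2) lift1_linear] linear_map_comp[OF tkk_proj_linear(3)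
          \<gamma>_linear(2)])
qed (auto simp: lift_def)

lemmas \<gamma>_zero =
  linear_map_zero[OF module_M K.module_lie \<gamma>_linear(1)] linear_map_zero[OF module_N K.module_lie
      \<gamma>_linear(2)]
  linear_map_zero[OF module_I K.module_lie lift1_linear]

lemmas \<gamma>_simps =
  linear_map_minus[OF module_M K.module_lie \<gamma>_linear(1)] linear_map_minus[OF module_N K.module_lie
      \<gamma>_linear(2)]
  linear_map_minus[OF module_I K.module_lie lift1_linear] linear_map_add[OF lift1_linear]

lemma lift_inm: "a \<in> carrier M \<Longrightarrow> lift (inm a) = \<gamma>m a"
  and lift_inp: "b \<in> carrier N \<Longrightarrow> lift (inp b) = \<gamma>p b"
  by (simp_all add: lift_apply \<gamma>_zero)

text \<open>
  The products not covered by the lemmas above lie in degrees \<open>\<plusminus>2\<close> and vanish on both sides.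
\<close>

lemma lift_graded_hom: "lift \<in> graded_hom R L K"
proof -
  have "lift (bracket L x y) = kb (lift x) (lift y)" if "x \<in> carrier L" "y \<in> carrier L" for x y
  proof -
    obtain a Z b where x: "x = (a, Z, b)" "a \<in> carrier M" "Z \<in> carrier I" "b \<in> carrier N"
      using \<open>x \<in> carrier L\<close> by (auto simp: tkk_simps)
    obtain c Y d where y: "y = (c, Y, d)" "c \<in> carrier M" "Y \<in> carrier I" "d \<in> carrier N"
      using \<open>y \<in> carrier L\<close> by (auto simp: tkk_simps)
    have comm: "kb (\<gamma>m a) (\<gamma>m c) = \<zero>\<^bsub>K\<^esub>" "kb (\<gamma>p b) (\<gamma>p d) = \<zero>\<^bsub>K\<^esub>"
      using x y by (auto intro!: K.grade_commute \<gamma>_grade)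
    have anti: "kb (\<gamma>m a) (lift1 Y) = \<ominus>\<^bsub>K\<^esub> kb (lift1 Y) (\<gamma>m a)" "kb (\<gamma>p b) (lift1 Y) = \<ominus>\<^bsub>K\<^esub> kb (lift1 Y) (\<gamma>p
        b)"
      "kb (\<gamma>p b) (\<gamma>m c) = \<ominus>\<^bsub>K\<^esub> kb (\<gamma>m c) (\<gamma>p b)"
      using x y by (auto intro!: K.lb_antisym)
    show ?thesis
      by (rule K.M.eq_if_signed)
        (use x y in \<open>simp_all add: tkk_bracket lift_apply \<gamma>_simps lift1_am lift1_ap lift1_br lift1_ang
          K.lb_simps comm anti K.M.signed_norm\<close>)
  qed
  moreover have "lift ` grade L i \<subseteq> grade K i" for i
  proof -
    consider "i = - 1" | "i = 0" | "i = 1" | "1 < \<bar>i\<bar>" by linarith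
    then show ?thesis
      by cases (auto simp: tkk_grade lift_apply \<gamma>_zero lift1_grade linear_map_zero[OF module_L
          K.module_lie lift_linear])
  qed
  ultimately show ?thesis
    using lift_linear by (auto simp: graded_hom_def lie_hom_def lift_def)
qed

end

section \<open>Jordan pairs and 3-graded Lie algebras\<close>

text \<open>
  Morphisms that are functions extensional on a carrier form a category once identities and
  composites are morphisms.
\<close>

lemma concrete_category:
  assumes "\<And>A. Cmp C A = compose (S A)" and "\<And>A. Idn C A = (\<lambda>x\<in>S A. x)"
    and ext: "\<And>A B f. \<lbrakk>A \<in> Ob C; B \<in> Ob C; f \<in> Hom C A B\<rbrakk> \<Longrightarrow> f \<in> extensional (S A)"
    and clo: "\<And>A B f. \<lbrakk>A \<in> Ob C; B \<in> Ob C; f \<in> Hom C A B\<rbrakk> \<Longrightarrow> f \<in> S A \<rightarrow> S B"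
    and "\<And>A. A \<in> Ob C \<Longrightarrow> (\<lambda>x\<in>S A. x) \<in> Hom C A A"
    and "\<And>A B D f g. \<lbrakk>A \<in> Ob C; B \<in> Ob C; D \<in> Ob C; f \<in> Hom C A B; g \<in> Hom C B D\<rbrakk> \<Longrightarrow>
      compose (S A) g f \<in> Hom C A D"
  shows "is_category C"
  unfolding is_category_def assms(1,2)
proof (intro conjI ballI)
  fix A B f assume f: "A \<in> Ob C" "B \<in> Ob C" "f \<in> Hom C A B"
  show "compose (S A) f (\<lambda>x\<in>S A. x) = f" "compose (S A) (\<lambda>x\<in>S B. x) f = f"
    using ext[OF f] clo[OF f] by (auto simp: fun_eq_iff compose_def extensional_def)
  fix D E g h assume "D \<in> Ob C" "E \<in> Ob C" "g \<in> Hom C B D" "h \<in> Hom C D E"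
  then show "compose (S A) h (compose (S A) g f) = compose (S A) (compose (S B) h g) f"
    using clo[OF f] by (auto simp: fun_eq_iff compose_def)
qed (use assms in auto)

lemma lie_hom_id: "is_lie_algebra R L \<Longrightarrow> (\<lambda>x\<in>carrier L. x) \<in> lie_hom R L L"
proof -
  assume "is_lie_algebra R L"
  then interpret lie R L by unfold_locales
  show ?thesis by (simp add: lie_hom_def linear_map_def)
qed

lemma lie_hom_compose:
  assumes "is_lie_algebra R L" and \<alpha>: "\<alpha> \<in> lie_hom R L K" and \<beta>: "\<beta> \<in> lie_hom R K W"
  shows "compose (carrier L) \<beta> \<alpha> \<in> lie_hom R L W"
proof -
  interpret lie R L by unfold_locales (rule assms(1))
  note c = linear_map_closed[OF lie_hom_linear[OF \<alpha>]]
  have "linear_map R L W (compose (carrier L) \<beta> \<alpha>)"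
    using linear_map_comp[OF lie_hom_linear[OF \<alpha>] lie_hom_linear[OF \<beta>]]
    by (rule linear_map_cong[OF module_lie]) (simp add: compose_def)
  then show ?thesis
    by (simp add: lie_hom_def compose_extensional compose_eq lie_hom_bracket[OF \<alpha>] lie_hom_bracket[OF \<beta>]
        c)
qed

lemma graded_hom_lie_hom: "\<alpha> \<in> graded_hom R L K \<Longrightarrow> \<alpha> \<in> lie_hom R L K"
  and graded_hom_grade: "\<alpha> \<in> graded_hom R L K \<Longrightarrow> x \<in> grade L i \<Longrightarrow> \<alpha> x \<in> grade K i"
  by (auto simp: graded_hom_def)

lemma graded_hom_id: "is_3graded R L \<Longrightarrow> (\<lambda>x\<in>carrier L. x) \<in> graded_hom R L L"
proof -
  assume "is_3graded R L"
  then interpret gla R L by unfold_locales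
  show ?thesis using lie_hom_id[OF lie_algebra] by (auto simp: graded_hom_def)
qed

lemma graded_hom_compose:
  assumes "is_3graded R L" and \<alpha>: "\<alpha> \<in> graded_hom R L K" and \<beta>: "\<beta> \<in> graded_hom R K W"
  shows "compose (carrier L) \<beta> \<alpha> \<in> graded_hom R L W"
proof -
  interpret gla R L by unfold_locales (rule assms(1))
  show ?thesis
    using lie_hom_compose[OF lie_algebra graded_hom_lie_hom[OF \<alpha>] graded_hom_lie_hom[OF \<beta>]]
      graded_hom_grade[OF \<alpha>] graded_hom_grade[OF \<beta>]
    by (auto simp: graded_hom_def compose_eq)
qed

lemma gla_category: "is_category (gla_cat R)"
  by (rule concrete_category[where S = carrier])
    (auto simp: gla_cat_def graded_hom_id graded_hom_compose
      dest: graded_hom_lie_hom lie_hom_extensional linear_map_closed[OF lie_hom_linear])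

lemma jp_homD:
  assumes "\<gamma> \<in> jp_hom R P Q"
  shows "fst \<gamma> \<in> extensional (carrier (jpm P))" "linear_map R (jpm P) (jpm Q) (fst \<gamma>)"
    "snd \<gamma> \<in> extensional (carrier (jpp P))" "linear_map R (jpp P) (jpp Q) (snd \<gamma>)"
    "\<lbrakk>a \<in> carrier (jpm P); b \<in> carrier (jpp P); c \<in> carrier (jpm P)\<rbrakk> \<Longrightarrow>
      fst \<gamma> (trm P a b c) = trm Q (fst \<gamma> a) (snd \<gamma> b) (fst \<gamma> c)"
    "\<lbrakk>b \<in> carrier (jpp P); a \<in> carrier (jpm P); d \<in> carrier (jpp P)\<rbrakk> \<Longrightarrow>
      snd \<gamma> (trp P b a d) = trp Q (snd \<gamma> b) (fst \<gamma> a) (snd \<gamma> d)"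
  using assms by (auto simp: jp_hom_def)

lemma jp_homI:
  assumes "g \<in> extensional (carrier (jpm P))" "linear_map R (jpm P) (jpm Q) g"
    "h \<in> extensional (carrier (jpp P))" "linear_map R (jpp P) (jpp Q) h"
    "\<And>a b c. \<lbrakk>a \<in> carrier (jpm P); b \<in> carrier (jpp P); c \<in> carrier (jpm P)\<rbrakk> \<Longrightarrow>
      g (trm P a b c) = trm Q (g a) (h b) (g c)"
    "\<And>a b d. \<lbrakk>b \<in> carrier (jpp P); a \<in> carrier (jpm P); d \<in> carrier (jpp P)\<rbrakk> \<Longrightarrow>
      h (trp P b a d) = trp Q (h b) (g a) (h d)"
  shows "(g, h) \<in> jp_hom R P Q"
  using assms by (simp add: jp_hom_def)

lemma linear_map_restrict:
  assumes "module R M" "linear_map R M N f"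
  shows "linear_map R M N (restrict f (carrier M))"
  using assms(2) by (rule linear_map_cong[OF assms(1)]) simp

lemma linear_map_compose:
  assumes "module R M" "linear_map R M N f" "linear_map R N K g"
  shows "linear_map R M K (compose (carrier M) g f)"
  using linear_map_comp[OF assms(2,3)] by (rule linear_map_cong[OF assms(1)]) (simp add: compose_eq)

lemma jp_hom_id:
  assumes "is_jordan_pair R P"
  shows "(\<lambda>x\<in>carrier (jpm P). x, \<lambda>x\<in>carrier (jpp P). x) \<in> jp_hom R P P"
proof -
  interpret jpair R P by unfold_locales (rule assms)
  show ?thesis
    by (rule jp_homI) (auto simp: linear_map_def)
qed

lemma jp_hom_compose:
  assumes "is_jordan_pair R P" and \<gamma>: "\<gamma> \<in> jp_hom R P Q" and \<delta>: "\<delta> \<in> jp_hom R Q W"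
  shows "jp_comp P \<delta> \<gamma> \<in> jp_hom R P W"
proof -
  interpret jpair R P by unfold_locales (rule assms)
  note c = linear_map_closed[OF jp_homD(2)[OF \<gamma>]] linear_map_closed[OF jp_homD(4)[OF \<gamma>]]
  show ?thesis
    unfolding jp_comp_def
    by (rule jp_homI)
      (simp_all add: linear_map_compose[OF module_M jp_homD(2)[OF \<gamma>] jp_homD(2)[OF \<delta>]]
        linear_map_compose[OF module_N jp_homD(4)[OF \<gamma>] jp_homD(4)[OF \<delta>]]
        compose_eq jp_homD(5,6)[OF \<gamma>] jp_homD(5,6)[OF \<delta>] c)
qed

lemma jp_category: "is_category (jp_cat R)"
  unfolding is_category_def
proof (intro conjI ballI)
  fix P Q f assume P: "P \<in> Ob (jp_cat R)" and f: "f \<in> Hom (jp_cat R) P Q"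
  then have f': "f \<in> jp_hom R P Q" by (simp add: jp_cat_def)
  note c = linear_map_closed[OF jp_homD(2)[OF f']] linear_map_closed[OF jp_homD(4)[OF f']]
    jp_homD(1,3)[OF f']
  show "Cmp (jp_cat R) P f (Idn (jp_cat R) P) = f" "Cmp (jp_cat R) P (Idn (jp_cat R) Q) f = f"
    using c by (auto simp: jp_cat_def jp_comp_def prod_eq_iff fun_eq_iff compose_def extensional_def)
  fix U V g h assume "g \<in> Hom (jp_cat R) Q U" "h \<in> Hom (jp_cat R) U V"
  then show "Cmp (jp_cat R) P h (Cmp (jp_cat R) P g f) = Cmp (jp_cat R) P (Cmp (jp_cat R) Q h g) f"
    using c by (auto simp: jp_cat_def jp_comp_def prod_eq_iff fun_eq_iff compose_def)
qed (auto simp: jp_cat_def jp_hom_id jp_hom_compose)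

lemma jp_of_gla_map_hom:
  assumes "is_3graded R L" "is_3graded R K" and \<alpha>: "\<alpha> \<in> graded_hom R L K"
  shows "jp_of_gla_map L K \<alpha> \<in> jp_hom R (jp_of_gla L) (jp_of_gla K)"
proof -
  interpret L: gla R L by unfold_locales (rule assms)
  interpret K: gla R K by unfold_locales (rule assms)
  note \<alpha>' = graded_hom_lie_hom[OF \<alpha>]
  have lin: "linear_map R (restrict_module L (grade L i)) (restrict_module K (grade K i)) (restrict \<alpha>
      (grade L i))" for i
    using linear_map_restrict[OF L.module_grade linear_map_restrict_codom[OF linear_map_restrict_dom[OF
        lie_hom_linear[OF \<alpha>'] L.grade_subset]]]
      graded_hom_grade[OF \<alpha>] by simp
  show ?thesis
    unfolding jp_of_gla_map_def
    by (rule jp_homI)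
      (use L.grade_triple[of _ "-1"] L.grade_triple[of _ 1] in \<open>auto simp: lin lie_hom_bracket[OF \<alpha>']\<close>)
qed

lemma jp_of_gla_functor: "is_functor (gla_cat R) (jp_cat R) jp_of_gla jp_of_gla_map"
  unfolding is_functor_def
proof (intro conjI ballI gla_category jp_category)
  fix L K W f g
  assume L: "L \<in> Ob (gla_cat R)" and "K \<in> Ob (gla_cat R)" "W \<in> Ob (gla_cat R)"
    and f: "f \<in> Hom (gla_cat R) L K" and "g \<in> Hom (gla_cat R) K W"
  then have *: "is_3graded R L" "f \<in> graded_hom R L K" by (auto simp: gla_cat_def)
  interpret L: gla R L by unfold_locales (rule *)
  show "jp_of_gla_map L W (Cmp (gla_cat R) L g f) =
      Cmp (jp_cat R) (jp_of_gla L) (jp_of_gla_map K W g) (jp_of_gla_map L K f)"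
    using graded_hom_grade[OF *(2)]
    by (auto simp: gla_cat_def jp_cat_def jp_comp_def jp_of_gla_map_def compose_def fun_eq_iff
        restrict_def)
next
  fix L assume "L \<in> Ob (gla_cat R)"
  then interpret L: gla R L by unfold_locales (simp add: gla_cat_def)
  show "jp_of_gla_map L L (Idn (gla_cat R) L) = Idn (jp_cat R) (jp_of_gla L)"
    by (auto simp: gla_cat_def jp_cat_def jp_of_gla_map_def fun_eq_iff restrict_def)
qed (auto simp: gla_cat_def jp_cat_def gla.jordan_pair_gla[OF gla.intro] jp_of_gla_map_hom)

text \<open>
  The restriction of a map to degrees \<open>-1\<close> and \<open>1\<close>, read as a pair of maps on \<open>P\<close>. It, or its
  second component, is the bijection of each of the three adjunctions.
\<close>

definition tkk_restrict ::
  "('k, 'r) ring_scheme \<Rightarrow> ('k, 'a, 'b) jordan_pair \<Rightarrow> (('k, 'a, 'b) tkk \<Rightarrow> 'l) \<Rightarrow> ('a \<Rightarrow> 'l) \<times> ('b \<Rightarrow> 'l)"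
      where
  "tkk_restrict R P \<alpha> =
     (\<lambda>a\<in>carrier (jpm P). \<alpha> (a, \<zero>\<^bsub>inner_module R P\<^esub>, \<zero>\<^bsub>jpp P\<^esub>),
      \<lambda>b\<in>carrier (jpp P). \<alpha> (\<zero>\<^bsub>jpm P\<^esub>, \<zero>\<^bsub>inner_module R P\<^esub>, b))"

context jpair
begin

lemma inm_inp_closed [simp]:
  "a \<in> carrier M \<Longrightarrow> inm a \<in> carrier L" "b \<in> carrier N \<Longrightarrow> inp b \<in> carrier L"
  "a \<in> carrier M \<Longrightarrow> inm a \<in> grade L (- 1)" "b \<in> carrier N \<Longrightarrow> inp b \<in> grade L 1"
  by (simp_all add: tkk_simps tkk_grade)

lemma triple_tkk:
  assumes "a \<in> carrier M" "b \<in> carrier N"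
  shows "c \<in> carrier M \<Longrightarrow> bracket L (bracket L (inm a) (inp b)) (inm c) = inm (t a b c)"
    and "d \<in> carrier N \<Longrightarrow> bracket L (bracket L (inp b) (inm a)) (inp d) = inp (s b a d)"
  using assms
  by (simp_all add: tkk_bracket inner_simps ang_act M.minus_eq N.minus_eq Im.minus_eq)

lemma tkk_restrict_hom:
  assumes "is_3graded R K" and \<alpha>: "\<alpha> \<in> graded_hom R L K"
  shows "tkk_restrict R P \<alpha> \<in> jp_hom R P (jp_of_gla K)"
proof -
  note \<alpha>' = graded_hom_lie_hom[OF \<alpha>]
  note lin = linear_map_comp[OF tkk_inj_linear(1) lie_hom_linear[OF \<alpha>']]
    linear_map_comp[OF tkk_inj_linear(3) lie_hom_linear[OF \<alpha>']]
  have tri: "\<alpha> (bracket L (bracket L x y) z) = bracket K (bracket K (\<alpha> x) (\<alpha> y)) (\<alpha> z)"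
    if "x \<in> carrier L" "y \<in> carrier L" "z \<in> carrier L" for x y z
    using that linear_map_closed[OF bilinear_map_right[OF bracket_bilinear]]
      by (simp add: lie_hom_bracket[OF \<alpha>'])
  show ?thesis
    unfolding tkk_restrict_def
    by (rule jp_homI)
      (simp_all add: linear_map_restrict[OF module_M linear_map_restrict_codom[OF lin(1)
          graded_hom_grade[OF \<alpha>]]]
        linear_map_restrict[OF module_N linear_map_restrict_codom[OF lin(2) graded_hom_grade[OF \<alpha>]]]
        tri flip: triple_tkk)
qed

lemma graded_hom_tkk_eqI:
  assumes \<alpha>: "\<alpha> \<in> graded_hom R L K" and \<beta>: "\<beta> \<in> graded_hom R L K"
    and eq: "tkk_restrict R P \<alpha> = tkk_restrict R P \<beta>"
  shows "\<alpha> = \<beta>"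
proof (rule lie_hom_tkk_eqI[OF graded_hom_lie_hom[OF \<alpha>] graded_hom_lie_hom[OF \<beta>]])
  show "\<alpha> (inm a) = \<beta> (inm a)" if "a \<in> carrier M" for a
    using that fun_cong[OF arg_cong[OF eq, of fst], of a] by (simp add: tkk_restrict_def)
  show "\<alpha> (inp b) = \<beta> (inp b)" if "b \<in> carrier N" for b
    using that fun_cong[OF arg_cong[OF eq, of snd], of b] by (simp add: tkk_restrict_def)
qed

end

lemma (in tkk_lift) tkk_restrict_lift: "tkk_restrict R P lift = (\<gamma>m, \<gamma>p)"
  using hom by (auto simp: tkk_restrict_def lift_inm lift_inp jp_hom_def extensional_def fun_eq_iff)

text \<open>
  Injective as \<open>TKK(P)\<close> is generated by \<open>P\<close>, surjective by the extension just constructed.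
\<close>

lemma tkk_restrict_bij:
  assumes "is_jordan_pair R P" "is_3graded R K"
  shows "bij_betw (tkk_restrict R P) (graded_hom R (tkk R P) K) (jp_hom R P (jp_of_gla K))"
proof -
  interpret jpair R P by unfold_locales (rule assms)
  have "\<gamma> \<in> tkk_restrict R P ` graded_hom R (tkk R P) K" if "\<gamma> \<in> jp_hom R P (jp_of_gla K)" for \<gamma>
  proof -
    interpret tkk_lift R P K "fst \<gamma>" "snd \<gamma>"
      using that assms by unfold_locales simp_all
    show ?thesis using tkk_restrict_lift lift_graded_hom by force
  qed
  then show ?thesis
    using tkk_restrict_hom[OF assms(2)] graded_hom_tkk_eqI
    by (auto simp: bij_betw_def inj_on_def)
qed

subsection \<open>The functor on morphisms\<close>

text \<open>
  Composing \<open>\<gamma>\<close> with the inclusion of \<open>Q\<close> in \<open>TKK(Q)\<close> makes \<open>TKK(\<gamma>)\<close> an instance of the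
  extension.
\<close>

locale jpair_hom = P: jpair R P + Q: jpair R Q
  for R :: "('k, 'r) ring_scheme" and P :: "('k, 'a, 'b) jordan_pair" and Q :: "('k, 'c, 'd) jordan_pair"
      +
  fixes \<gamma>
  assumes hom: "\<gamma> \<in> jp_hom R P Q"
begin

abbreviation \<delta>m where "\<delta>m \<equiv> \<lambda>a\<in>carrier (jpm P). Q.inm (fst \<gamma> a)"
abbreviation \<delta>p where "\<delta>p \<equiv> \<lambda>b\<in>carrier (jpp P). Q.inp (snd \<gamma> b)"

lemma \<gamma>_closed [simp]:
  "a \<in> carrier P.M \<Longrightarrow> fst \<gamma> a \<in> carrier Q.M" "b \<in> carrier P.N \<Longrightarrow> snd \<gamma> b \<in> carrier Q.N"
  by (rule linear_map_closed[OF jp_homD(2)[OF hom]] linear_map_closed[OF jp_homD(4)[OF hom]];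
      assumption)+

lemma \<delta>_hom: "(\<delta>m, \<delta>p) \<in> jp_hom R P (jp_of_gla (tkk R Q))"
proof (rule jp_homI)
  show "linear_map R P.M (jpm (jp_of_gla Q.L)) \<delta>m"
    using linear_map_comp[OF jp_homD(2)[OF hom] Q.tkk_inj_linear(1)]
    by (auto intro!: linear_map_restrict P.module_M linear_map_restrict_codom)
  show "linear_map R P.N (jpp (jp_of_gla Q.L)) \<delta>p"
    using linear_map_comp[OF jp_homD(4)[OF hom] Q.tkk_inj_linear(3)]
    by (auto intro!: linear_map_restrict P.module_N linear_map_restrict_codom)
qed (simp_all add: Q.triple_tkk jp_homD(5,6)[OF hom])

sublocale tkk_lift R P Q.L \<delta>m \<delta>p
  by (intro tkk_lift.intro P.jpair_axioms gla.intro Q.tkk_3graded tkk_lift_axioms.intro \<delta>_hom)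

text \<open>
  Both maps send \<open>\<langle>c,d\<rangle>\<close> to \<open>\<langle>\<gamma> c, \<gamma> d\<rangle>\<close>; the lift into \<open>TKK(Q)\<close> takes values in degree 0 there.
\<close>

lemma tkk_map_eq_lift: "tkk_map R P Q \<gamma> = lift"
proof -
  have lin: "linear_map R P.I Q.I (\<lambda>Z. fst (snd (lift1 Z)))"
    using linear_map_comp[OF lift1_linear Q.tkk_proj_linear(2)] .
  have lift1: "lift1 Z = (\<zero>\<^bsub>Q.M\<^esub>, fst (snd (lift1 Z)), \<zero>\<^bsub>Q.N\<^esub>)" if "Z \<in> carrier P.I" for Z
    using lift1_grade[OF that] by (auto simp: Q.tkk_grade)
  have "inner_lift R Q.I (\<lambda>c d. Q.ang (fst \<gamma> c) (snd \<gamma> d)) Z = fst (snd (lift1 Z))" if "Z \<in> carrier P.I"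
      for Z
    by (rule P.inner_lift_eq[OF Q.module_I lin _ that]) (simp add: lift1_ang Q.inm_inp_bracket)
  moreover have "lift (a, Z, b) = (fst \<gamma> a, fst (snd (lift1 Z)), snd \<gamma> b)"
    if "a \<in> carrier P.M" "Z \<in> carrier P.I" "b \<in> carrier P.N" for a Z b
  proof -
    define z where "z = fst (snd (lift1 Z))"
    have "z \<in> carrier Q.I" "lift1 Z = (\<zero>\<^bsub>Q.M\<^esub>, z, \<zero>\<^bsub>Q.N\<^esub>)"
      using linear_map_closed[OF lin that(2)] lift1[OF that(2)] by (simp_all add: z_def)
    then show ?thesis
      using that \<gamma>_closed by (simp add: lift_apply Q.tkk_simps)
  qed
  ultimately have "tkk_map R P Q \<gamma> x = lift x" if "x \<in> carrier P.L" for x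
    using that by (auto simp: tkk_map_def P.tkk_simps)
  then show ?thesis
    using lie_hom_extensional[OF graded_hom_lie_hom[OF lift_graded_hom]]
    by (intro extensionalityI[of _ "carrier P.L"]) (simp_all add: tkk_map_def)
qed

lemma tkk_map_hom: "tkk_map R P Q \<gamma> \<in> graded_hom R P.L Q.L"
  unfolding tkk_map_eq_lift by (rule lift_graded_hom)

lemma tkk_map_inm: "a \<in> carrier P.M \<Longrightarrow> tkk_map R P Q \<gamma> (P.inm a) = Q.inm (fst \<gamma> a)"
  and tkk_map_inp: "b \<in> carrier P.N \<Longrightarrow> tkk_map R P Q \<gamma> (P.inp b) = Q.inp (snd \<gamma> b)"
  unfolding tkk_map_eq_lift by (simp_all add: lift_inm lift_inp)

end

lemma jp_comp_simps [simp]: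
  "fst (jp_comp P \<delta> \<gamma>) = compose (carrier (jpm P)) (fst \<delta>) (fst \<gamma>)"
  "snd (jp_comp P \<delta> \<gamma>) = compose (carrier (jpp P)) (snd \<delta>) (snd \<gamma>)"
  by (simp_all add: jp_comp_def)

lemma tkk_map_comp:
  assumes "is_jordan_pair R P" "is_jordan_pair R Q" "is_jordan_pair R W"
    and f: "f \<in> jp_hom R P Q" and g: "g \<in> jp_hom R Q W"
  shows "tkk_map R P W (jp_comp P g f) = compose (carrier (tkk R P)) (tkk_map R Q W g) (tkk_map R P Q f)"
proof -
  interpret f: jpair_hom R P Q f by unfold_locales (use assms in auto)
  interpret g: jpair_hom R Q W g by unfold_locales (use assms in auto)
  interpret gf: jpair_hom R P W "jp_comp P g f" by unfold_locales (simp_all add: assms jp_hom_compose[OF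
      assms(1) f g])
  show ?thesis
    by (rule f.P.lie_hom_tkk_eqI[OF graded_hom_lie_hom[OF gf.tkk_map_hom]
        graded_hom_lie_hom[OF graded_hom_compose[OF f.P.tkk_3graded f.tkk_map_hom g.tkk_map_hom]]])
      (simp_all add: compose_eq f.tkk_map_inm g.tkk_map_inm gf.tkk_map_inm
        f.tkk_map_inp g.tkk_map_inp gf.tkk_map_inp)
qed

lemma tkk_map_id:
  assumes "is_jordan_pair R P"
  shows "tkk_map R P P (\<lambda>x\<in>carrier (jpm P). x, \<lambda>x\<in>carrier (jpp P). x) = (\<lambda>x\<in>carrier (tkk R P). x)"
proof -
  interpret jpair_hom R P P "(\<lambda>x\<in>carrier (jpm P). x, \<lambda>x\<in>carrier (jpp P). x)"
    by unfold_locales (simp_all add: assms jp_hom_id)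
  show ?thesis
    by (rule P.lie_hom_tkk_eqI[OF graded_hom_lie_hom[OF tkk_map_hom] lie_hom_id[OF P.tkk_lie]])
      (simp_all add: tkk_map_inm tkk_map_inp)
qed

lemma tkk_functor: "is_functor (jp_cat R) (gla_cat R) (tkk R) (tkk_map R)"
  unfolding is_functor_def
proof (intro conjI ballI gla_category jp_category)
  fix P Q f assume "P \<in> Ob (jp_cat R)" "Q \<in> Ob (jp_cat R)" "f \<in> Hom (jp_cat R) P Q"
  then interpret jpair_hom R P Q f by unfold_locales (auto simp: jp_cat_def)
  show "tkk_map R P Q f \<in> Hom (gla_cat R) (tkk R P) (tkk R Q)"
    using tkk_map_hom by (simp add: gla_cat_def)
qed (auto simp: jp_cat_def gla_cat_def jpair.tkk_3graded[OF jpair.intro] tkk_map_id tkk_map_comp)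

lemma tkk_map_inj:
  assumes "is_jordan_pair R P" "is_jordan_pair R Q" "\<gamma> \<in> jp_hom R P Q" "\<gamma>' \<in> jp_hom R P Q"
    and eq: "tkk_map R P Q \<gamma> = tkk_map R P Q \<gamma>'"
  shows "\<gamma> = \<gamma>'"
proof -
  interpret g: jpair_hom R P Q \<gamma> by unfold_locales (use assms in auto)
  interpret g': jpair_hom R P Q \<gamma>' by unfold_locales (use assms in auto)
  have "fst \<gamma> a = fst \<gamma>' a" for a
    using g.tkk_map_inm[of a] g'.tkk_map_inm[of a] eq jp_homD(1)[OF g.hom] jp_homD(1)[OF g'.hom]
    by (cases "a \<in> carrier (jpm P)") (auto simp: extensional_def)
  moreover have "snd \<gamma> b = snd \<gamma>' b" for b
    using g.tkk_map_inp[of b] g'.tkk_map_inp[of b] eq jp_homD(3)[OF g.hom] jp_homD(3)[OF g'.hom]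
    by (cases "b \<in> carrier (jpp P)") (auto simp: extensional_def)
  ultimately show ?thesis by (simp add: prod_eq_iff fun_eq_iff)
qed

lemma tkk_faithful: "is_faithful (jp_cat R) (tkk_map R)"
  unfolding is_faithful_def inj_on_def by (intro ballI impI tkk_map_inj) (simp_all add: jp_cat_def)

text \<open>
  A graded homomorphism \<open>\<alpha>\<close> restricts to \<open>P \<rightarrow> Q\<close> because \<open>P\<close> and \<open>Q\<close> are the Jordan pairs of
  their algebras.
\<close>

lemma tkk_map_surj:
  assumes "is_jordan_pair R P" "is_jordan_pair R Q" and \<alpha>: "\<alpha> \<in> graded_hom R (tkk R P) (tkk R Q)"
  obtains \<gamma> where "\<gamma> \<in> jp_hom R P Q" "\<alpha> = tkk_map R P Q \<gamma>"
proof -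
  interpret P: jpair R P by unfold_locales (rule assms)
  interpret Q: jpair R Q by unfold_locales (rule assms)
  define \<gamma> where "\<gamma> = (\<lambda>a\<in>carrier P.M. fst (\<alpha> (P.inm a)), \<lambda>b\<in>carrier P.N. snd (snd (\<alpha> (P.inp b))))"
  note \<alpha>' = graded_hom_lie_hom[OF \<alpha>]
  have m: "\<alpha> (P.inm a) = Q.inm (fst \<gamma> a)" "fst \<gamma> a \<in> carrier Q.M" if "a \<in> carrier P.M" for a
    using graded_hom_grade[OF \<alpha> P.inm_inp_closed(3)[OF that]] that by (auto simp: Q.tkk_grade \<gamma>_def)
  have p: "\<alpha> (P.inp b) = Q.inp (snd \<gamma> b)" "snd \<gamma> b \<in> carrier Q.N" if "b \<in> carrier P.N" for b
    using graded_hom_grade[OF \<alpha> P.inm_inp_closed(4)[OF that]] that by (auto simp: Q.tkk_grade \<gamma>_def)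
  have tri: "\<alpha> (bracket P.L (bracket P.L x y) z) = bracket Q.L (bracket Q.L (\<alpha> x) (\<alpha> y)) (\<alpha> z)"
    if "x \<in> carrier P.L" "y \<in> carrier P.L" "z \<in> carrier P.L" for x y z
    using that linear_map_closed[OF bilinear_map_right[OF P.bracket_bilinear]]
      by (simp add: lie_hom_bracket[OF \<alpha>'])
  have "(fst \<gamma>, snd \<gamma>) \<in> jp_hom R P Q"
  proof (rule jp_homI)
    show "linear_map R P.M Q.M (fst \<gamma>)"
      using linear_map_restrict[OF P.module_M linear_map_comp[OF linear_map_comp[OF P.tkk_inj_linear(1)
          lie_hom_linear[OF \<alpha>']] Q.tkk_proj_linear(1)]]
      by (simp add: \<gamma>_def)
    show "linear_map R P.N Q.N (snd \<gamma>)"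
      using linear_map_restrict[OF P.module_N linear_map_comp[OF linear_map_comp[OF P.tkk_inj_linear(3)
          lie_hom_linear[OF \<alpha>']] Q.tkk_proj_linear(3)]]
      by (simp add: \<gamma>_def)
    fix a b c assume abc: "a \<in> carrier P.M" "b \<in> carrier P.N" "c \<in> carrier P.M"
    have "Q.inm (fst \<gamma> (P.t a b c)) = Q.inm (Q.t (fst \<gamma> a) (snd \<gamma> b) (fst \<gamma> c))"
      using abc tri[of "P.inm a" "P.inp b" "P.inm c"] by (simp add: P.triple_tkk m p Q.triple_tkk)
    then show "fst \<gamma> (P.t a b c) = Q.t (fst \<gamma> a) (snd \<gamma> b) (fst \<gamma> c)" by simp
  next
    fix a b d assume abd: "b \<in> carrier P.N" "a \<in> carrier P.M" "d \<in> carrier P.N"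
    have "Q.inp (snd \<gamma> (P.s b a d)) = Q.inp (Q.s (snd \<gamma> b) (fst \<gamma> a) (snd \<gamma> d))"
      using abd tri[of "P.inp b" "P.inm a" "P.inp d"] by (simp add: P.triple_tkk m p Q.triple_tkk)
    then show "snd \<gamma> (P.s b a d) = Q.s (snd \<gamma> b) (fst \<gamma> a) (snd \<gamma> d)" by simp
  qed (simp_all add: \<gamma>_def)
  then interpret jpair_hom R P Q \<gamma> by unfold_locales simp
  have "\<alpha> = tkk_map R P Q \<gamma>"
    by (rule P.lie_hom_tkk_eqI[OF \<alpha>' graded_hom_lie_hom[OF tkk_map_hom]])
      (simp_all add: m p tkk_map_inm tkk_map_inp)
  from that[OF hom this] show thesis .
qed

lemma tkk_full: "is_full (jp_cat R) (gla_cat R) (tkk R) (tkk_map R)"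
  unfolding is_full_def
proof (intro ballI subsetI)
  fix P Q \<alpha> assume "P \<in> Ob (jp_cat R)" "Q \<in> Ob (jp_cat R)" "\<alpha> \<in> Hom (gla_cat R) (tkk R P) (tkk R Q)"
  then have "is_jordan_pair R P" "is_jordan_pair R Q" "\<alpha> \<in> graded_hom R (tkk R P) (tkk R Q)"
    by (simp_all add: jp_cat_def gla_cat_def)
  from tkk_map_surj[OF this] obtain \<gamma> where "\<gamma> \<in> jp_hom R P Q" "\<alpha> = tkk_map R P Q \<gamma>" .
  then show "\<alpha> \<in> tkk_map R P Q ` Hom (jp_cat R) P Q" by (simp add: jp_cat_def)
qed

lemma tkk_adjunction: "naturally_isomorphic (jp_cat R) (gla_cat R) (hom_from_tkk R) (hom_to_jp R)"
  unfolding naturally_isomorphic_def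
proof (intro exI[of _ "\<lambda>P L. tkk_restrict R P"] conjI ballI)
  show "bij_betw (tkk_restrict R P) (bi_set (hom_from_tkk R) P L) (bi_set (hom_to_jp R) P L)"
    if "P \<in> Ob (jp_cat R)" "L \<in> Ob (gla_cat R)" for P L
    using that tkk_restrict_bij by (simp add: jp_cat_def gla_cat_def hom_from_tkk_def hom_to_jp_def)
  fix P P' L L' \<gamma> \<beta> \<alpha>
  assume "P \<in> Ob (jp_cat R)" "P' \<in> Ob (jp_cat R)" "L \<in> Ob (gla_cat R)" "L' \<in> Ob (gla_cat R)"
    and "\<gamma> \<in> Hom (jp_cat R) P' P" "\<beta> \<in> Hom (gla_cat R) L L'" "\<alpha> \<in> bi_set (hom_from_tkk R) P L"
  then have *: "is_jordan_pair R P" "is_jordan_pair R P'" "\<gamma> \<in> jp_hom R P' P"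
    and \<alpha>: "\<alpha> \<in> graded_hom R (tkk R P) L"
    by (auto simp: jp_cat_def gla_cat_def hom_from_tkk_def)
  interpret jpair_hom R P' P \<gamma> by unfold_locales (use * in auto)
  show "tkk_restrict R P' (bi_map (hom_from_tkk R) P' P L L' \<gamma> \<beta> \<alpha>) =
      bi_map (hom_to_jp R) P' P L L' \<gamma> \<beta> (tkk_restrict R P \<alpha>)"
    using graded_hom_grade[OF \<alpha>]
    by (auto simp: tkk_restrict_def hom_from_tkk_def hom_to_jp_def jp_comp_def jp_of_gla_map_def
      compose_def fun_eq_iff tkk_map_inm tkk_map_inp)
qed

section \<open>Jordan triple systems and involutions\<close>

lemma module_truncate_simps [simp]:
  "carrier (module.truncate M) = carrier M"
  "\<zero>\<^bsub>module.truncate M\<^esub> = \<zero>\<^bsub>M\<^esub>"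
  "add (module.truncate M) = add M"
  "smult (module.truncate M) = smult M"
  by (simp_all add: module.truncate_def)

lemma jp_of_jts_simps [simp]:
  "jpm (jp_of_jts T) = module.truncate T" "jpp (jp_of_jts T) = module.truncate T"
  "trm (jp_of_jts T) = trip T" "trp (jp_of_jts T) = trip T"
  by (simp_all add: jp_of_jts_def)

lemma jordan_product_cong:
  assumes "carrier M' = carrier M" "add M' = add M" "\<zero>\<^bsub>M'\<^esub> = \<zero>\<^bsub>M\<^esub>" "smult M' = smult M"
    and "carrier N' = carrier N" "add N' = add N" "smult N' = smult N"
  shows "jordan_product R M' N' t s = jordan_product R M N t s"
  using assms by (simp add: jordan_product_def trilinear_map_def linear_map_def a_inv_cong(2)[OF
      assms(1-3)])

lemma jordan_pair_jts: "is_jordan_triple_system R T \<Longrightarrow> is_jordan_pair R (jp_of_jts T)"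
  using jordan_product_cong[of "module.truncate T" T "module.truncate T" T R "trip T" "trip T"]
    module_cong[of R T "module.truncate T"]
  by (simp add: is_jordan_triple_system_def is_jordan_pair_def)

lemma jts_hom_iff: "\<gamma> \<in> jts_hom R T U \<longleftrightarrow> (\<gamma>, \<gamma>) \<in> jp_hom R (jp_of_jts T) (jp_of_jts U)"
  by (auto simp: jts_hom_def jp_hom_def linear_map_def)

lemma direct_sum3_reverse:
  assumes "module R L" and sum: "is_direct_sum3 R L A B C"
  shows "is_direct_sum3 R L C B A"
proof -
  interpret L: module R L by fact
  have sub: "A \<subseteq> carrier L" "B \<subseteq> carrier L" "C \<subseteq> carrier L"
    using sum L.submoduleE(1) by (auto simp: is_direct_sum3_def)
  have eq: "(c \<oplus>\<^bsub>L\<^esub> b) \<oplus>\<^bsub>L\<^esub> a = (a \<oplus>\<^bsub>L\<^esub> b) \<oplus>\<^bsub>L\<^esub> c" if "a \<in> A" "b \<in> B" "c \<in> C" for a b c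
    using that sub by (simp add: L.a_ac subset_iff)
  have "\<exists>!p. p \<in> C \<times> B \<times> A \<and> x = (fst p \<oplus>\<^bsub>L\<^esub> fst (snd p)) \<oplus>\<^bsub>L\<^esub> snd (snd p)" if "x \<in> carrier L" for x
  proof -
    from sum that obtain a b c where abc: "a \<in> A" "b \<in> B" "c \<in> C" "x = (a \<oplus>\<^bsub>L\<^esub> b) \<oplus>\<^bsub>L\<^esub> c"
      and unique: "\<And>p. p \<in> A \<times> B \<times> C \<Longrightarrow> x = (fst p \<oplus>\<^bsub>L\<^esub> fst (snd p)) \<oplus>\<^bsub>L\<^esub> snd (snd p) \<Longrightarrow> p = (a, b, c)"
      unfolding is_direct_sum3_def by (elim conjE) (metis (no_types, lifting) SigmaE fst_conv snd_conv)
    show ?thesis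
    proof (rule ex1I[of _ "(c, b, a)"])
      fix p assume p: "p \<in> C \<times> B \<times> A \<and> x = (fst p \<oplus>\<^bsub>L\<^esub> fst (snd p)) \<oplus>\<^bsub>L\<^esub> snd (snd p)"
      then obtain c' b' a' where "p = (c', b', a')" "a' \<in> A" "b' \<in> B" "c' \<in> C" by auto
      then show "p = (c, b, a)"
        using p unique[of "(a', b', c')"] eq[of a' b' c'] by simp
    qed (use abc eq in auto)
  qed
  then show ?thesis using sum by (simp add: is_direct_sum3_def)
qed

text \<open>
  An anti-graded map is a graded map into the algebra with reversed grading.
\<close>

definition reverse_grading :: "('k, 'a) graded_lie_algebra \<Rightarrow> ('k, 'a) graded_lie_algebra" where
  "reverse_grading L = L\<lparr>grade := \<lambda>i. grade L (- i)\<rparr>"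

lemma reverse_grading_simps [simp]:
  "carrier (reverse_grading L) = carrier L" "\<zero>\<^bsub>reverse_grading L\<^esub> = \<zero>\<^bsub>L\<^esub>"
  "add (reverse_grading L) = add L" "smult (reverse_grading L) = smult L"
  "bracket (reverse_grading L) = bracket L" "grade (reverse_grading L) i = grade L (- i)"
  by (simp_all add: reverse_grading_def)

lemma is_lie_algebra_cong:
  assumes "is_lie_algebra R L"
    and "carrier K = carrier L" "add K = add L" "\<zero>\<^bsub>K\<^esub> = \<zero>\<^bsub>L\<^esub>" "smult K = smult L" "bracket K = bracket L"
  shows "is_lie_algebra R K"
  using assms module_cong[of R L K]
  by (simp add: is_lie_algebra_def bilinear_map_def linear_map_def)

lemma submodule_cong:
  assumes "module R L" "submodule S R L"
    and "carrier K = carrier L" "add K = add L" "\<zero>\<^bsub>K\<^esub> = \<zero>\<^bsub>L\<^esub>" "smult K = smult L"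
  shows "submodule S R K"
proof -
  interpret L: module R L by fact
  interpret K: module R K by (rule module_cong[OF assms(1)]) (simp_all add: assms)
  note S = L.submoduleE[OF assms(2)] subgroup.one_closed[OF submodule.axioms(1)[OF assms(2)]]
  show ?thesis
    by (rule K.submoduleI) (use S assms(3-) a_inv_cong(1)[OF assms(3-5)] in auto)
qed

lemma reverse_grading_3graded:
  assumes "is_3graded R L"
  shows "is_3graded R (reverse_grading L)"
proof -
  interpret gla R L by unfold_locales (rule assms)
  have "is_direct_sum3 R L (grade L 1) (grade L 0) (grade L (- 1))"
    by (rule direct_sum3_reverse[OF module_lie]) (use assms in \<open>simp add: is_3graded_def\<close>)
  moreover have "submodule S R (reverse_grading L)" if "submodule S R L" for S
    by (rule submodule_cong[OF module_lie that]) simp_all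
  ultimately have "is_direct_sum3 R (reverse_grading L) (grade L 1) (grade L 0) (grade L (- 1))"
    by (simp add: is_direct_sum3_def)
  moreover have "bracket L x y \<in> grade L (- (i + j))" if "x \<in> grade L (- i)" "y \<in> grade L (- j)" for x y
      i j
    using grade_bracket[OF that] by simp
  moreover have "is_lie_algebra R (reverse_grading L)"
    by (rule is_lie_algebra_cong[OF lie_algebra]) simp_all
  ultimately show ?thesis
    using grade_outside by (simp add: is_3graded_def)
qed

locale jts =
  fixes R :: "('k, 'r) ring_scheme" and T :: "('k, 'a) triple_system"
  assumes jts: "is_jordan_triple_system R T"
begin

abbreviation P where "P \<equiv> jp_of_jts T"

sublocale P: jpair R P by unfold_locales (rule jordan_pair_jts[OF jts])

abbreviation \<kappa> where "\<kappa> \<equiv> kappa R P"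

text \<open>
  The Jordan pair of \<open>TKK(P)\<close> with reversed grading is \<open>P\<close> with exchanged components. For
  \<open>P = (T,T)\<close> the exchange is therefore a homomorphism, and its extension is \<open>\<kappa>\<close>.
\<close>

lemma swap_hom: "(\<lambda>a\<in>carrier T. P.inp a, \<lambda>b\<in>carrier T. P.inm b) \<in> jp_hom R P (jp_of_gla (reverse_grading
    P.L))"
proof (rule jp_homI)
  show "linear_map R (jpm P) (jpm (jp_of_gla (reverse_grading P.L))) (\<lambda>a\<in>carrier T. P.inp a)"
    using linear_map_restrict[OF P.module_N linear_map_restrict_codom[OF P.tkk_inj_linear(3), of "grade
        P.L 1"]]
    by (simp add: P.tkk_grade linear_map_def)
  show "linear_map R (jpp P) (jpp (jp_of_gla (reverse_grading P.L))) (\<lambda>a\<in>carrier T. P.inm a)"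
    using linear_map_restrict[OF P.module_M linear_map_restrict_codom[OF P.tkk_inj_linear(1), of "grade
        P.L (-1)"]]
    by (simp add: P.tkk_grade linear_map_def)
qed (use P.triple_tkk P.t_closed in simp_all)

sublocale swap: tkk_lift R P "reverse_grading P.L" "\<lambda>a\<in>carrier T. P.inp a" "\<lambda>b\<in>carrier T. P.inm b"
  by (intro tkk_lift.intro P.jpair_axioms gla.intro reverse_grading_3graded P.tkk_3graded
    tkk_lift_axioms.intro swap_hom)

end

lemma (in jpair) inp_inm_bracket:
  "\<lbrakk>a \<in> carrier M; b \<in> carrier N\<rbrakk> \<Longrightarrow> bracket L (inp b) (inm a) = (\<zero>\<^bsub>M\<^esub>, \<ominus>\<^bsub>I\<^esub> ang a b, \<zero>\<^bsub>N\<^esub>)"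
  by (simp add: tkk_bracket inner_simps M.minus_eq N.minus_eq Im.minus_eq)

context jts
begin

lemma kappa_eq_lift: "\<kappa> = swap.lift"
proof -
  have lin: "linear_map R P.I P.I (\<lambda>Z. fst (snd (swap.lift1 Z)))"
    using linear_map_comp[OF swap.lift1_linear, of P.I "\<lambda>x. fst (snd x)"] P.tkk_proj_linear(2)
    by (simp add: linear_map_def)
  have lift1: "swap.lift1 Z = (\<zero>\<^bsub>P.M\<^esub>, fst (snd (swap.lift1 Z)), \<zero>\<^bsub>P.N\<^esub>)" if "Z \<in> carrier P.I" for Z
    using swap.lift1_grade[OF that] by (auto simp: P.tkk_grade)
  have "inner_lift R P.I (\<lambda>c d. \<ominus>\<^bsub>P.I\<^esub> P.ang d c) Z = fst (snd (swap.lift1 Z))" if "Z \<in> carrier P.I" for Z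
  proof (rule P.inner_lift_eq[OF P.module_I lin _ that])
    fix c d assume "c \<in> carrier P.M" "d \<in> carrier P.N"
    then show "\<ominus>\<^bsub>P.I\<^esub> P.ang d c = fst (snd (swap.lift1 (P.ang c d)))"
      using swap.lift1_ang[of c d] P.inp_inm_bracket[of d c] by simp
  qed
  moreover have "swap.lift (a, Z, b) = (b, fst (snd (swap.lift1 Z)), a)"
    if "a \<in> carrier T" "Z \<in> carrier P.I" "b \<in> carrier T" for a Z b
  proof -
    define z where "z = fst (snd (swap.lift1 Z))"
    have "z \<in> carrier P.I" "swap.lift1 Z = (\<zero>\<^bsub>P.M\<^esub>, z, \<zero>\<^bsub>P.N\<^esub>)"
      using linear_map_closed[OF lin that(2)] lift1[OF that(2)] by (simp_all add: z_def)
    then show ?thesis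
      using that swap.lift_apply[of a Z b] P.M.l_zero[of b] P.M.r_zero[of a] P.M.l_zero[of a]
        P.M.l_zero[OF P.M.zero_closed]
      by (simp add: P.tkk_simps)
  qed
  ultimately have "\<kappa> x = swap.lift x" if "x \<in> carrier P.L" for x
    using that by (auto simp: kappa_def P.tkk_simps)
  then show ?thesis
    using lie_hom_extensional[OF graded_hom_lie_hom[OF swap.lift_graded_hom]]
    by (intro extensionalityI[of _ "carrier P.L"]) (simp_all add: kappa_def)
qed

lemma kappa_inm [simp]: "a \<in> carrier T \<Longrightarrow> \<kappa> (a, \<zero>\<^bsub>P.I\<^esub>, \<zero>\<^bsub>T\<^esub>) = (\<zero>\<^bsub>T\<^esub>, \<zero>\<^bsub>P.I\<^esub>, a)"
  and kappa_inp [simp]: "b \<in> carrier T \<Longrightarrow> \<kappa> (\<zero>\<^bsub>T\<^esub>, \<zero>\<^bsub>P.I\<^esub>, b) = (b, \<zero>\<^bsub>P.I\<^esub>, \<zero>\<^bsub>T\<^esub>)"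
  using swap.lift_inm[of a] swap.lift_inp[of b] by (simp_all add: kappa_eq_lift)

lemma kappa_lie_hom: "\<kappa> \<in> lie_hom R P.L P.L"
  using graded_hom_lie_hom[OF swap.lift_graded_hom]
  by (simp add: kappa_eq_lift lie_hom_def linear_map_def)

text \<open>
  \<open>\<kappa>\<^sup>2\<close> fixes the generators.
\<close>

lemma kappa_involution: "is_antigraded_involution R P.L \<kappa>"
proof -
  have sq: "compose (carrier P.L) \<kappa> \<kappa> = (\<lambda>x\<in>carrier P.L. x)"
    by (rule P.lie_hom_tkk_eqI[OF lie_hom_compose[OF P.tkk_lie kappa_lie_hom kappa_lie_hom] lie_hom_id[OF
        P.tkk_lie]])
      (use P.inm_inp_closed in \<open>simp_all add: compose_eq\<close>)
  have "\<kappa> (\<kappa> x) = x" if "x \<in> carrier P.L" for x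
    using that fun_cong[OF sq, of x] by (simp add: compose_eq)
  moreover have "\<kappa> ` grade P.L i \<subseteq> grade P.L (- i)" for i
    using swap.lift_graded_hom by (simp add: kappa_eq_lift graded_hom_def)
  ultimately show ?thesis
    by (simp add: is_antigraded_involution_def kappa_lie_hom)
qed

end

lemma involutionD:
  assumes "is_antigraded_involution R L \<epsilon>"
  shows "\<epsilon> \<in> lie_hom R L L" "x \<in> carrier L \<Longrightarrow> \<epsilon> (\<epsilon> x) = x" "x \<in> grade L i \<Longrightarrow> \<epsilon> x \<in> grade L (- i)"
  using assms by (auto simp: is_antigraded_involution_def)

lemma involutary_homD:
  assumes "\<alpha> \<in> involutary_hom R (L, \<epsilon>) (K, \<delta>)"
  shows "\<alpha> \<in> graded_hom R L K" "x \<in> carrier L \<Longrightarrow> \<alpha> (\<epsilon> x) = \<delta> (\<alpha> x)"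
  using assms by (auto simp: involutary_hom_def)

lemma involutary_homI:
  assumes "\<alpha> \<in> graded_hom R L K" "\<And>x. x \<in> carrier L \<Longrightarrow> \<alpha> (\<epsilon> x) = \<delta> (\<alpha> x)"
  shows "\<alpha> \<in> involutary_hom R (L, \<epsilon>) (K, \<delta>)"
  using assms by (auto simp: involutary_hom_def)

lemma igla_category: "is_category (igla_cat R)"
proof (rule concrete_category[where S = "\<lambda>LE. carrier (fst LE)"])
  fix A assume "A \<in> Ob (igla_cat R)"
  then obtain L \<epsilon> where A: "A = (L, \<epsilon>)" and L: "is_3graded R L" and \<epsilon>: "is_antigraded_involution R L \<epsilon>"
    by (cases A) (auto simp: igla_cat_def)
  have c: "\<epsilon> x \<in> carrier L" if "x \<in> carrier L" for x
    by (rule linear_map_closed[OF lie_hom_linear[OF involutionD(1)[OF \<epsilon>]] that])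
  show "(\<lambda>x\<in>carrier (fst A). x) \<in> Hom (igla_cat R) A A"
    using graded_hom_id[OF L] c by (simp add: A igla_cat_def involutary_hom_def)
  fix B D f g
  assume "f \<in> Hom (igla_cat R) A B" "g \<in> Hom (igla_cat R) B D"
  moreover obtain K \<delta> W \<eta> where BD: "B = (K, \<delta>)" "D = (W, \<eta>)" by (metis surj_pair)
  ultimately have f: "f \<in> involutary_hom R (L, \<epsilon>) (K, \<delta>)" and g: "g \<in> involutary_hom R (K, \<delta>) (W, \<eta>)"
    by (simp_all add: A igla_cat_def)
  note f' = linear_map_closed[OF lie_hom_linear[OF graded_hom_lie_hom[OF involutary_homD(1)[OF f]]]]
  have "compose (carrier L) g f \<in> involutary_hom R (L, \<epsilon>) (W, \<eta>)"
    by (rule involutary_homI[OF graded_hom_compose[OF L involutary_homD(1)[OF f] involutary_homD(1)[OF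
        g]]])
      (simp add: compose_eq c f' involutary_homD(2)[OF f] involutary_homD(2)[OF g])
  then show "compose (carrier (fst A)) g f \<in> Hom (igla_cat R) A D"
    by (simp add: A BD igla_cat_def)
qed (auto simp: igla_cat_def involutary_hom_def
    dest: graded_hom_lie_hom lie_hom_extensional linear_map_closed[OF lie_hom_linear])

lemma jts_homD:
  assumes "\<gamma> \<in> jts_hom R T U"
  shows "\<gamma> \<in> extensional (carrier T)" "linear_map R T U \<gamma>"
    "\<lbrakk>a \<in> carrier T; b \<in> carrier T; c \<in> carrier T\<rbrakk> \<Longrightarrow> \<gamma> (trip T a b c) = trip U (\<gamma> a) (\<gamma> b) (\<gamma> c)"
  using assms by (auto simp: jts_hom_def)

lemma jts_category: "is_category (jts_cat R)"
proof (rule concrete_category[where S = carrier])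
  fix T U W f g
  assume "T \<in> Ob (jts_cat R)"
  then have T: "is_jordan_triple_system R T" by (simp add: jts_cat_def)
  interpret jts R T by unfold_locales (rule T)
  show "(\<lambda>x\<in>carrier T. x) \<in> Hom (jts_cat R) T T"
    using jp_hom_id[OF P.jordan_pair] by (simp add: jts_cat_def jts_hom_iff)
  assume "f \<in> Hom (jts_cat R) T U" "g \<in> Hom (jts_cat R) U W"
  then show "compose (carrier T) g f \<in> Hom (jts_cat R) T W"
    using jp_hom_compose[OF P.jordan_pair, of "(f, f)" "jp_of_jts U" "(g, g)" "jp_of_jts W"]
    by (simp add: jts_cat_def jts_hom_iff jp_comp_def)
qed (auto simp: jts_cat_def dest: jts_homD(1) linear_map_closed[OF jts_homD(2)])

locale igla = gla +
  fixes \<epsilon>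
  assumes involution: "is_antigraded_involution R L \<epsilon>"
begin

lemma \<epsilon>_lie_hom: "\<epsilon> \<in> lie_hom R L L"
  by (rule involutionD(1)[OF involution])

lemma \<epsilon>_simps [simp]:
  "x \<in> carrier L \<Longrightarrow> \<epsilon> x \<in> carrier L"
  "x \<in> carrier L \<Longrightarrow> \<epsilon> (\<epsilon> x) = x"
  "\<lbrakk>x \<in> carrier L; y \<in> carrier L\<rbrakk> \<Longrightarrow> \<epsilon> (lb x y) = lb (\<epsilon> x) (\<epsilon> y)"
  "x \<in> grade L 1 \<Longrightarrow> \<epsilon> x \<in> grade L (- 1)"
  "x \<in> grade L (- 1) \<Longrightarrow> \<epsilon> x \<in> grade L 1"
  using linear_map_closed[OF lie_hom_linear[OF \<epsilon>_lie_hom]] lie_hom_bracket[OF \<epsilon>_lie_hom]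
    involutionD(2)[OF involution] involutionD(3)[OF involution, of x 1] involutionD(3)[OF involution, of
        x "- 1"]
  by simp_all

lemma jts_of_igla_simps [simp]:
  "carrier (jts_of_igla (L, \<epsilon>)) = grade L 1"
  "\<zero>\<^bsub>jts_of_igla (L, \<epsilon>)\<^esub> = \<zero>\<^bsub>L\<^esub>"
  "add (jts_of_igla (L, \<epsilon>)) = add L"
  "smult (jts_of_igla (L, \<epsilon>)) = smult L"
  "trip (jts_of_igla (L, \<epsilon>)) = (\<lambda>a b c. lb (lb a (\<epsilon> b)) c)"
  by (simp_all add: jts_of_igla_def module.extend_def triple_system.fields_def restrict_module_def
      module.truncate_def)

text \<open>
  The triple product of \<open>L\<^sub>1\<close> is that of the Jordan pair with \<open>\<epsilon>\<close> applied to the middle argument,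
  and \<open>\<epsilon>\<close> exchanges the two triple products of the pair.
\<close>

lemma jordan_triple_system_igla: "is_jordan_triple_system R (jts_of_igla (L, \<epsilon>))"
proof -
  interpret J: jpair R "jp_of_gla L" by unfold_locales (rule jordan_pair_gla)
  let ?T = "jts_of_igla (L, \<epsilon>)"
  have mod: "module R ?T"
    by (rule module_cong[OF module_grade[of 1]]) simp_all
  have \<epsilon>_lin: "linear_map R (restrict_module L (grade L 1)) (restrict_module L (grade L (- 1))) \<epsilon>"
    by (rule linear_map_restrict_codom[OF linear_map_restrict_dom[OF lie_hom_linear[OF \<epsilon>_lie_hom]
        grade_subset]]) simp
  have lin: "linear_map R ?T ?T f" if "linear_map R J.N J.N f" for f
    using that by (simp add: linear_map_def)
  have "jordan_product R ?T ?T (trip ?T) (trip ?T)"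
    unfolding jordan_product_def trilinear_map_def
  proof (intro conjI ballI lin)
    fix a b c assume asm: "a \<in> carrier ?T" "b \<in> carrier ?T" "c \<in> carrier ?T"
    then show "trip ?T a b c = trip ?T c b a"
      using J.s_commute[of a "\<epsilon> b" c] by simp
    show "linear_map R J.N J.N (\<lambda>x. trip ?T x a b)" "linear_map R J.N J.N (\<lambda>x. trip ?T a b x)"
      "linear_map R J.N J.N (\<lambda>x. trip ?T a x b)"
      using asm J.s_linear(1)[of "\<epsilon> a" b] J.s_linear(3)[of a "\<epsilon> b"]
        linear_map_comp[OF \<epsilon>_lin[folded jp_of_gla_simps] J.s_linear(2)[of a b]]
      by (simp_all add: jp_of_gla_def)
    fix d x assume asm': "d \<in> carrier ?T" "x \<in> carrier ?T"
    have "trip ?T a b (trip ?T c d x) \<ominus>\<^bsub>J.N\<^esub> trip ?T c d (trip ?T a b x) =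
      trip ?T (trip ?T a b c) d x \<ominus>\<^bsub>J.N\<^esub> trip ?T c (trip ?T b a d) x"
    proof -
      have "is_jordan_pair R (jp_of_gla L)" by (rule jordan_pair_gla)
      then have "lb (lb a (\<epsilon> b)) (lb (lb c (\<epsilon> d)) x) \<ominus>\<^bsub>J.N\<^esub> lb (lb c (\<epsilon> d)) (lb (lb a (\<epsilon> b)) x) =
        lb (lb (lb (lb a (\<epsilon> b)) c) (\<epsilon> d)) x \<ominus>\<^bsub>J.N\<^esub> lb (lb c (lb (lb (\<epsilon> b) a) (\<epsilon> d))) x"
        using asm asm' by (simp add: is_jordan_pair_def jordan_product_def jp_of_gla_def)
      then show ?thesis using asm asm' by simp
    qed
    then show "trip ?T a b (trip ?T c d x) \<ominus>\<^bsub>?T\<^esub> trip ?T c d (trip ?T a b x) =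
      trip ?T (trip ?T a b c) d x \<ominus>\<^bsub>?T\<^esub> trip ?T c (trip ?T b a d) x"
      using a_inv_cong(2)[of ?T J.N] by simp
  qed
  then show ?thesis using mod by (simp add: is_jordan_triple_system_def)
qed

end

text \<open>
  Commuting with the involutions is checked on generators, and half of these suffice because the
  involutions have square one.
\<close>

lemma (in jts) involutary_tkkI:
  assumes K: "is_3graded R K" and \<epsilon>: "is_antigraded_involution R K \<epsilon>"
    and \<alpha>: "\<alpha> \<in> graded_hom R P.L K"
    and eq: "\<And>a. a \<in> carrier T \<Longrightarrow> \<epsilon> (\<alpha> (P.inp a)) = \<alpha> (P.inm a)"
  shows "\<alpha> \<in> involutary_hom R (tkk_jts R T) (K, \<epsilon>)"
proof -
  interpret K: igla R K \<epsilon> by unfold_locales (use K \<epsilon> in auto)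
  note \<alpha>' = graded_hom_lie_hom[OF \<alpha>]
  note c = linear_map_closed[OF lie_hom_linear[OF \<alpha>']]
  have eq': "\<epsilon> (\<alpha> (P.inm a)) = \<alpha> (P.inp a)" if "a \<in> carrier T" for a
    using that eq[OF that, symmetric] c[OF P.inm_inp_closed(2)[of a]] by simp
  have sq: "compose (carrier P.L) \<alpha> \<kappa> = compose (carrier P.L) \<epsilon> \<alpha>"
    by (rule P.lie_hom_tkk_eqI[OF lie_hom_compose[OF P.tkk_lie kappa_lie_hom \<alpha>']
        lie_hom_compose[OF P.tkk_lie \<alpha>' K.\<epsilon>_lie_hom]])
      (use P.inm_inp_closed eq eq' in \<open>simp_all add: compose_eq\<close>)
  have "\<alpha> (\<kappa> x) = \<epsilon> (\<alpha> x)" if "x \<in> carrier P.L" for x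
    using that fun_cong[OF sq, of x] by (simp add: compose_eq)
  with \<alpha> show ?thesis by (auto simp: tkk_jts_def intro: involutary_homI)
qed

lemma tkk_jts_object:
  assumes "is_jordan_triple_system R T"
  shows "is_3graded R (tkk R (jp_of_jts T))" "is_antigraded_involution R (tkk R (jp_of_jts T)) (kappa R
      (jp_of_jts T))"
proof -
  interpret jts R T by unfold_locales (rule assms)
  show "is_3graded R P.L" "is_antigraded_involution R P.L \<kappa>"
    by (rule P.tkk_3graded kappa_involution)+
qed

lemma tkk_jts_map_hom:
  assumes T: "is_jordan_triple_system R T" and U: "is_jordan_triple_system R U" and \<gamma>: "\<gamma> \<in> jts_hom R T
      U"
  shows "tkk_jts_map R T U \<gamma> \<in> involutary_hom R (tkk_jts R T) (tkk_jts R U)"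
proof -
  interpret T: jts R T by unfold_locales (rule T)
  interpret U: jts R U by unfold_locales (rule U)
  interpret jpair_hom R T.P U.P "(\<gamma>, \<gamma>)"
    using \<gamma> by unfold_locales (simp add: jts_hom_iff)
  have "tkk_map R T.P U.P (\<gamma>, \<gamma>) \<in> involutary_hom R (tkk_jts R T) (U.P.L, U.\<kappa>)"
  proof (rule T.involutary_tkkI[OF U.P.tkk_3graded U.kappa_involution tkk_map_hom])
    fix a assume "a \<in> carrier T"
    then show "U.\<kappa> (tkk_map R T.P U.P (\<gamma>, \<gamma>) (T.P.inp a)) = tkk_map R T.P U.P (\<gamma>, \<gamma>) (T.P.inm a)"
      using tkk_map_inm[of a] tkk_map_inp[of a] U.kappa_inp[of "\<gamma> a"] \<gamma>_closed(1)[of a] by simp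
  qed
  then show ?thesis by (simp add: tkk_jts_def tkk_jts_map_def)
qed

lemma tkk_jts_functor: "is_functor (jts_cat R) (igla_cat R) (tkk_jts R) (tkk_jts_map R)"
  unfolding is_functor_def
proof (intro conjI ballI jts_category igla_category)
  fix T assume "T \<in> Ob (jts_cat R)"
  then have T: "is_jordan_triple_system R T" by (simp add: jts_cat_def)
  show "tkk_jts R T \<in> Ob (igla_cat R)"
    using tkk_jts_object[OF T] by (simp add: tkk_jts_def igla_cat_def)
  show "tkk_jts_map R T T (Idn (jts_cat R) T) = Idn (igla_cat R) (tkk_jts R T)"
    using tkk_map_id[OF jordan_pair_jts[OF T]]
      by (simp add: tkk_jts_map_def tkk_jts_def jts_cat_def igla_cat_def)
  fix U f assume "U \<in> Ob (jts_cat R)" and f: "f \<in> Hom (jts_cat R) T U"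
  then have U: "is_jordan_triple_system R U" by (simp add: jts_cat_def)
  show "tkk_jts_map R T U f \<in> Hom (igla_cat R) (tkk_jts R T) (tkk_jts R U)"
    using tkk_jts_map_hom[OF T U] f by (simp add: jts_cat_def igla_cat_def)
  fix W g assume "W \<in> Ob (jts_cat R)" and g: "g \<in> Hom (jts_cat R) U W"
  then have W: "is_jordan_triple_system R W" by (simp add: jts_cat_def)
  show "tkk_jts_map R T W (Cmp (jts_cat R) T g f) =
      Cmp (igla_cat R) (tkk_jts R T) (tkk_jts_map R U W g) (tkk_jts_map R T U f)"
    using tkk_map_comp[OF jordan_pair_jts[OF T] jordan_pair_jts[OF U] jordan_pair_jts[OF W], of "(f, f)"
        "(g, g)"] f g
    by (simp add: tkk_jts_map_def tkk_jts_def jts_cat_def igla_cat_def jp_comp_def jts_hom_iff)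
qed

lemma jts_of_igla_map_hom:
  assumes "is_3graded R L" "is_antigraded_involution R L \<epsilon>" "is_3graded R K" "is_antigraded_involution R
      K \<delta>"
    and \<alpha>: "\<alpha> \<in> involutary_hom R (L, \<epsilon>) (K, \<delta>)"
  shows "jts_of_igla_map (L, \<epsilon>) (K, \<delta>) \<alpha> \<in> jts_hom R (jts_of_igla (L, \<epsilon>)) (jts_of_igla (K, \<delta>))"
proof -
  interpret L: igla R L \<epsilon> by unfold_locales (use assms in auto)
  interpret K: igla R K \<delta> by unfold_locales (use assms in auto)
  have "(restrict \<alpha> (grade L (- 1)), restrict \<alpha> (grade L 1)) \<in> jp_hom R (jp_of_gla L) (jp_of_gla K)"
    using jp_of_gla_map_hom[OF assms(1,3) involutary_homD(1)[OF \<alpha>]] by (simp add: jp_of_gla_map_def)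
  from jp_homD(3,4,6)[OF this] show ?thesis
    by (auto simp: jts_hom_def jts_of_igla_map_def linear_map_def involutary_homD(2)[OF \<alpha>]
        L.grade_triple[of _ 1]
      dest: L.\<epsilon>_simps(4))
qed

lemma jts_of_igla_functor: "is_functor (igla_cat R) (jts_cat R) jts_of_igla jts_of_igla_map"
  unfolding is_functor_def
proof (intro conjI ballI jts_category igla_category)
  fix A assume "A \<in> Ob (igla_cat R)"
  then obtain L \<epsilon> where A: "A = (L, \<epsilon>)" "is_3graded R L" "is_antigraded_involution R L \<epsilon>"
    by (cases A) (auto simp: igla_cat_def)
  interpret L: igla R L \<epsilon> by unfold_locales (use A in auto)
  show "jts_of_igla A \<in> Ob (jts_cat R)"
    using L.jordan_triple_system_igla by (simp add: A jts_cat_def)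
  show "jts_of_igla_map A A (Idn (igla_cat R) A) = Idn (jts_cat R) (jts_of_igla A)"
    by (auto simp: A jts_cat_def igla_cat_def jts_of_igla_map_def fun_eq_iff restrict_def)
  fix B f assume "B \<in> Ob (igla_cat R)" and f: "f \<in> Hom (igla_cat R) A B"
  then obtain K \<delta> where B: "B = (K, \<delta>)" "is_3graded R K" "is_antigraded_involution R K \<delta>"
    by (cases B) (auto simp: igla_cat_def)
  have f': "f \<in> involutary_hom R (L, \<epsilon>) (K, \<delta>)" using f by (simp add: A B igla_cat_def)
  show "jts_of_igla_map A B f \<in> Hom (jts_cat R) (jts_of_igla A) (jts_of_igla B)"
    using jts_of_igla_map_hom[OF A(2,3) B(2,3) f'] by (simp add: A B jts_cat_def)
  fix D g
  show "jts_of_igla_map A D (Cmp (igla_cat R) A g f) =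
      Cmp (jts_cat R) (jts_of_igla A) (jts_of_igla_map B D g) (jts_of_igla_map A B f)"
    using graded_hom_grade[OF involutary_homD(1)[OF f'], of _ 1]
    by (auto simp: A B jts_cat_def igla_cat_def jts_of_igla_map_def compose_def fun_eq_iff restrict_def)
qed

text \<open>
  An involutary homomorphism is determined by its degree \<open>1\<close> part \<open>\<gamma>\<close>: in degree \<open>-1\<close> it is
  \<open>\<epsilon> \<gamma>\<close>. Conversely \<open>(\<epsilon> \<gamma>, \<gamma>)\<close> is a homomorphism of Jordan pairs.
\<close>

lemma tkk_jts_bij:
  assumes T: "is_jordan_triple_system R T" and K: "is_3graded R K" "is_antigraded_involution R K \<epsilon>"
  shows "bij_betw (\<lambda>\<alpha>. snd (tkk_restrict R (jp_of_jts T) \<alpha>))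
    (involutary_hom R (tkk_jts R T) (K, \<epsilon>)) (jts_hom R T (jts_of_igla (K, \<epsilon>)))"
proof -
  interpret jts R T by unfold_locales (rule T)
  interpret K: igla R K \<epsilon> by unfold_locales (use K in auto)
  let ?res = "tkk_restrict R P"
  have fst_res: "fst (?res \<alpha>) = (\<lambda>a\<in>carrier T. \<epsilon> (snd (?res \<alpha>) a))"
    if "\<alpha> \<in> involutary_hom R (tkk_jts R T) (K, \<epsilon>)" for \<alpha>
    using involutary_homD(2)[OF that[unfolded tkk_jts_def], symmetric] P.inm_inp_closed(2)
    by (auto simp: tkk_restrict_def fun_eq_iff)
  show ?thesis
    unfolding bij_betw_def
  proof (intro conjI inj_onI equalityI subsetI)
    fix \<alpha> \<beta> assume \<alpha>: "\<alpha> \<in> involutary_hom R (tkk_jts R T) (K, \<epsilon>)" and \<beta>: "\<beta> \<in> involutary_hom R (tkk_jts R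
        T) (K, \<epsilon>)"
      and eq: "snd (?res \<alpha>) = snd (?res \<beta>)"
    show "\<alpha> = \<beta>"
      using involutary_homD(1)[OF \<alpha>[unfolded tkk_jts_def]] involutary_homD(1)[OF \<beta>[unfolded tkk_jts_def]]
    proof (rule P.graded_hom_tkk_eqI)
      show "?res \<alpha> = ?res \<beta>" using fst_res[OF \<alpha>] fst_res[OF \<beta>] eq by (simp add: prod_eq_iff)
    qed
  next
    fix \<gamma> assume "\<gamma> \<in> (\<lambda>\<alpha>. snd (?res \<alpha>)) ` involutary_hom R (tkk_jts R T) (K, \<epsilon>)"
    then obtain \<alpha> where \<alpha>: "\<alpha> \<in> involutary_hom R (tkk_jts R T) (K, \<epsilon>)" and \<gamma>: "\<gamma> = snd (?res \<alpha>)" by blast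
    have "?res \<alpha> \<in> jp_hom R P (jp_of_gla K)"
      by (rule P.tkk_restrict_hom[OF K(1) involutary_homD(1)[OF \<alpha>[unfolded tkk_jts_def]]])
    from jp_homD(3,4,6)[OF this] show "\<gamma> \<in> jts_hom R T (jts_of_igla (K, \<epsilon>))"
      by (simp add: jts_hom_def \<gamma> fst_res[OF \<alpha>] linear_map_def)
  next
    fix \<gamma> assume \<gamma>: "\<gamma> \<in> jts_hom R T (jts_of_igla (K, \<epsilon>))"
    have lin: "linear_map R T K \<gamma>" "\<And>x. x \<in> carrier T \<Longrightarrow> \<gamma> x \<in> grade K 1"
      using jts_homD(2)[OF \<gamma>] K.gradeD[of _ 1] by (auto simp: linear_map_def Pi_iff)
    have linm: "linear_map R T K (\<lambda>x. \<epsilon> (\<gamma> x))"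
      by (rule linear_map_comp[OF lin(1) lie_hom_linear[OF K.\<epsilon>_lie_hom]])
    have "(\<lambda>a\<in>carrier T. \<epsilon> (\<gamma> a), \<gamma>) \<in> jp_hom R P (jp_of_gla K)"
    proof (rule jp_homI)
      show "linear_map R (jpm P) (jpm (jp_of_gla K)) (\<lambda>a\<in>carrier T. \<epsilon> (\<gamma> a))"
        using linear_map_restrict[OF P.module_M linear_map_restrict_codom, of K "\<lambda>x. \<epsilon> (\<gamma> x)" "grade K (-
            1)"] linm lin(2)
        by (simp add: linear_map_def)
      show "linear_map R (jpp P) (jpp (jp_of_gla K)) \<gamma>"
        using linear_map_restrict_codom[OF lin] by (simp add: linear_map_def)
    qed (use jts_homD[OF \<gamma>] lin(2) P.t_closed in \<open>simp_all add: K.gradeD[of _ 1]\<close>)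
    then interpret tkk_lift R P K "\<lambda>a\<in>carrier T. \<epsilon> (\<gamma> a)" \<gamma>
      using K by unfold_locales
    have "lift \<in> involutary_hom R (tkk_jts R T) (K, \<epsilon>)"
    proof (rule involutary_tkkI[OF K lift_graded_hom])
      fix a assume "a \<in> carrier T"
      then show "\<epsilon> (lift (P.inp a)) = lift (P.inm a)" using lift_inm[of a] lift_inp[of a] by simp
    qed
    then show "\<gamma> \<in> (\<lambda>\<alpha>. snd (?res \<alpha>)) ` involutary_hom R (tkk_jts R T) (K, \<epsilon>)"
      using tkk_restrict_lift by force
  qed
qed

lemma tkk_jts_adjunction:
  "naturally_isomorphic (jts_cat R) (igla_cat R) (hom_from_tkk_jts R) (hom_to_jts R)"
  unfolding naturally_isomorphic_def
proof (intro exI[of _ "\<lambda>T LE \<alpha>. snd (tkk_restrict R (jp_of_jts T) \<alpha>)"] conjI ballI)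
  show "bij_betw (\<lambda>\<alpha>. snd (tkk_restrict R (jp_of_jts T) \<alpha>)) (bi_set (hom_from_tkk_jts R) T A) (bi_set
      (hom_to_jts R) T A)"
    if "T \<in> Ob (jts_cat R)" "A \<in> Ob (igla_cat R)" for T A
    using that
    by (cases A) (simp add: jts_cat_def igla_cat_def hom_from_tkk_jts_def hom_to_jts_def tkk_jts_bij)
  fix T T' A A' \<gamma> \<beta> \<alpha>
  assume "T \<in> Ob (jts_cat R)" "T' \<in> Ob (jts_cat R)" "A \<in> Ob (igla_cat R)" "A' \<in> Ob (igla_cat R)"
    and "\<gamma> \<in> Hom (jts_cat R) T' T" "\<beta> \<in> Hom (igla_cat R) A A'" "\<alpha> \<in> bi_set (hom_from_tkk_jts R) T A"
  then have T: "is_jordan_triple_system R T" "is_jordan_triple_system R T'" and \<gamma>: "\<gamma> \<in> jts_hom R T' T"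
    and \<alpha>: "\<alpha> \<in> involutary_hom R (tkk_jts R T) A"
    by (auto simp: jts_cat_def hom_from_tkk_jts_def)
  have \<alpha>': "\<alpha> \<in> graded_hom R (tkk R (jp_of_jts T)) (fst A)"
    using \<alpha> by (simp add: involutary_hom_def tkk_jts_def)
  interpret jpair_hom R "jp_of_jts T'" "jp_of_jts T" "(\<gamma>, \<gamma>)"
    using T \<gamma> by unfold_locales (simp_all add: jordan_pair_jts jts_hom_iff)
  have "\<alpha> (Q.inp b) \<in> grade (fst A) 1" if "b \<in> carrier T" for b
    using graded_hom_grade[OF \<alpha>' Q.inm_inp_closed(4)] that by simp
  then show "snd (tkk_restrict R (jp_of_jts T') (bi_map (hom_from_tkk_jts R) T' T A A' \<gamma> \<beta> \<alpha>)) =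
      bi_map (hom_to_jts R) T' T A A' \<gamma> \<beta> (snd (tkk_restrict R (jp_of_jts T) \<alpha>))"
    using tkk_map_inp P.inm_inp_closed(2) \<gamma>_closed(2)
    by (auto simp: tkk_restrict_def hom_from_tkk_jts_def hom_to_jts_def jts_of_igla_map_def
        tkk_jts_map_def tkk_jts_def
      compose_def fun_eq_iff)
qed

lemma tkk_jts_faithful: "is_faithful (jts_cat R) (tkk_jts_map R)"
  unfolding is_faithful_def inj_on_def
proof (intro ballI impI)
  fix T U f g assume "T \<in> Ob (jts_cat R)" "U \<in> Ob (jts_cat R)" "f \<in> Hom (jts_cat R) T U" "g \<in> Hom
      (jts_cat R) T U"
    and "tkk_jts_map R T U f = tkk_jts_map R T U g"
  then have "(f, f) = (g, g)"
    by (intro tkk_map_inj[of R "jp_of_jts T" "jp_of_jts U"])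
      (simp_all add: jts_cat_def jordan_pair_jts jts_hom_iff tkk_jts_map_def)
  then show "f = g" by simp
qed

lemma tkk_jts_full: "is_full (jts_cat R) (igla_cat R) (tkk_jts R) (tkk_jts_map R)"
  unfolding is_full_def
proof (intro ballI subsetI)
  fix T U \<alpha> assume "T \<in> Ob (jts_cat R)" "U \<in> Ob (jts_cat R)" "\<alpha> \<in> Hom (igla_cat R) (tkk_jts R T) (tkk_jts
      R U)"
  then have T: "is_jordan_triple_system R T" and U: "is_jordan_triple_system R U"
    and \<alpha>: "\<alpha> \<in> involutary_hom R (tkk R (jp_of_jts T), kappa R (jp_of_jts T)) (tkk R (jp_of_jts U), kappa
        R (jp_of_jts U))"
    by (simp_all add: jts_cat_def igla_cat_def tkk_jts_def)
  interpret T: jts R T by unfold_locales (rule T)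
  interpret U: jts R U by unfold_locales (rule U)
  from tkk_map_surj[OF T.P.jordan_pair U.P.jordan_pair involutary_homD(1)[OF \<alpha>]]
  obtain \<gamma> where \<gamma>: "\<gamma> \<in> jp_hom R T.P U.P" "\<alpha> = tkk_map R T.P U.P \<gamma>" .
  interpret jpair_hom R T.P U.P \<gamma> by unfold_locales (rule \<gamma>)
  have "fst \<gamma> a = snd \<gamma> a" for a
  proof (cases "a \<in> carrier T")
    case True
    then have "\<alpha> (T.\<kappa> (T.P.inp a)) = U.\<kappa> (\<alpha> (T.P.inp a))"
      using involutary_homD(2)[OF \<alpha>, of "T.P.inp a"] T.P.inm_inp_closed(2)[of a] by simp
    then show ?thesis
      using True tkk_map_inm[of a] tkk_map_inp[of a] \<gamma>_closed(2)[of a] by (simp add: \<gamma>(2))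
  next
    case False
    then show ?thesis using jp_homD(1,3)[OF hom] by (simp add: extensional_def)
  qed
  then have "\<gamma> = (snd \<gamma>, snd \<gamma>)" by (simp add: prod_eq_iff fun_eq_iff)
  then have "snd \<gamma> \<in> jts_hom R T U" "\<alpha> = tkk_jts_map R T U (snd \<gamma>)"
    using \<gamma> by (simp_all add: jts_hom_iff tkk_jts_map_def)
  then show "\<alpha> \<in> tkk_jts_map R T U ` Hom (jts_cat R) T U"
    by (simp add: jts_cat_def)
qed

section \<open>Unital Jordan algebras\<close>

lemma (in abelian_group) a_inv_zero [simp]: "\<ominus> \<zero> = \<zero>"
  by (rule minus_equality) simp_all

lemma module_two_torsion:
  assumes "module R M" and two: "[(2::nat)] \<cdot>\<^bsub>R\<^esub> \<one>\<^bsub>R\<^esub> \<in> Units R" and x: "x \<in> carrier M" "x \<oplus>\<^bsub>M\<^esub> x = \<zero>\<^bsub>M\<^esub>"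
  shows "x = \<zero>\<^bsub>M\<^esub>"
proof -
  interpret M: module R M by fact
  let ?two = "[(2::nat)] \<cdot>\<^bsub>R\<^esub> \<one>\<^bsub>R\<^esub>"
  have "?two \<odot>\<^bsub>M\<^esub> x = \<zero>\<^bsub>M\<^esub>"
    using x by (simp add: numeral_2_eq_2 M.smult_l_distr)
  moreover have "(inv\<^bsub>R\<^esub> ?two) \<odot>\<^bsub>M\<^esub> (?two \<odot>\<^bsub>M\<^esub> x) = x"
    using two x(1) by (subst M.smult_assoc1[symmetric]) (simp_all add: M.R.Units_closed)
  ultimately show ?thesis
    using two by simp
qed

lemma module_three_torsion:
  assumes "module R M" and three: "[(3::nat)] \<cdot>\<^bsub>R\<^esub> \<one>\<^bsub>R\<^esub> \<in> Units R" and x: "x \<in> carrier M" "(x \<oplus>\<^bsub>M\<^esub> x) \<oplus>\<^bsub>M\<^esub> x =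
      \<zero>\<^bsub>M\<^esub>"
  shows "x = \<zero>\<^bsub>M\<^esub>"
proof -
  interpret M: module R M by fact
  let ?three = "[(3::nat)] \<cdot>\<^bsub>R\<^esub> \<one>\<^bsub>R\<^esub>"
  have "?three \<odot>\<^bsub>M\<^esub> x = \<zero>\<^bsub>M\<^esub>"
    using x by (simp add: numeral_3_eq_3 M.smult_l_distr)
  moreover have "(inv\<^bsub>R\<^esub> ?three) \<odot>\<^bsub>M\<^esub> (?three \<odot>\<^bsub>M\<^esub> x) = x"
    using three x(1) by (subst M.smult_assoc1[symmetric]) (simp_all add: M.R.Units_closed)
  ultimately show ?thesis
    using three by simp
qed

lemma module_eq_if_minus_zero:
  assumes "module R M" "x \<in> carrier M" "y \<in> carrier M" "x \<ominus>\<^bsub>M\<^esub> y = \<zero>\<^bsub>M\<^esub>"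
  shows "x = y"
proof -
  interpret M: module R M by fact
  show ?thesis
    by (rule M.eq_if_signed) (use assms in \<open>simp_all add: signed_def M.minus_eq\<close>)
qed

lemma module_double_cancel:
  assumes M: "module R M" and two: "[(2::nat)] \<cdot>\<^bsub>R\<^esub> \<one>\<^bsub>R\<^esub> \<in> Units R"
    and xy: "x \<in> carrier M" "y \<in> carrier M" and eq: "x \<oplus>\<^bsub>M\<^esub> x = y \<oplus>\<^bsub>M\<^esub> y"
  shows "x = y"
proof -
  interpret M: module R M by fact
  have "(x \<ominus>\<^bsub>M\<^esub> y) \<oplus>\<^bsub>M\<^esub> (x \<ominus>\<^bsub>M\<^esub> y) = (x \<oplus>\<^bsub>M\<^esub> x) \<ominus>\<^bsub>M\<^esub> (y \<oplus>\<^bsub>M\<^esub> y)"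
    by (rule M.eq_if_signed) (use xy in \<open>simp_all add: M.signed_norm\<close>)
  also have "\<dots> = \<zero>\<^bsub>M\<^esub>"
    using xy by (simp add: eq M.minus_eq M.r_neg)
  finally have "x \<ominus>\<^bsub>M\<^esub> y = \<zero>\<^bsub>M\<^esub>"
    by (rule module_two_torsion[OF M two, rotated]) (use xy in simp)
  then show ?thesis by (rule module_eq_if_minus_zero[OF M xy])
qed

lemma module_triple_cancel:
  assumes M: "module R M" and three: "[(3::nat)] \<cdot>\<^bsub>R\<^esub> \<one>\<^bsub>R\<^esub> \<in> Units R"
    and xy: "x \<in> carrier M" "y \<in> carrier M" and eq: "(x \<oplus>\<^bsub>M\<^esub> x) \<oplus>\<^bsub>M\<^esub> x = (y \<oplus>\<^bsub>M\<^esub> y) \<oplus>\<^bsub>M\<^esub> y"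
  shows "x = y"
proof -
  interpret M: module R M by fact
  have "((x \<ominus>\<^bsub>M\<^esub> y) \<oplus>\<^bsub>M\<^esub> (x \<ominus>\<^bsub>M\<^esub> y)) \<oplus>\<^bsub>M\<^esub> (x \<ominus>\<^bsub>M\<^esub> y) =
    ((x \<oplus>\<^bsub>M\<^esub> x) \<oplus>\<^bsub>M\<^esub> x) \<ominus>\<^bsub>M\<^esub> ((y \<oplus>\<^bsub>M\<^esub> y) \<oplus>\<^bsub>M\<^esub> y)"
    by (rule M.eq_if_signed) (use xy in \<open>simp_all add: M.signed_norm\<close>)
  also have "\<dots> = \<zero>\<^bsub>M\<^esub>"
    unfolding eq using xy by (simp add: M.minus_eq M.r_neg)
  finally have "x \<ominus>\<^bsub>M\<^esub> y = \<zero>\<^bsub>M\<^esub>"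
    by (rule module_three_torsion[OF M three, rotated]) (use xy in simp)
  then show ?thesis by (rule module_eq_if_minus_zero[OF M xy])
qed

locale jordan_algebra =
  fixes R :: "('k, 'r) ring_scheme" and J :: "('k, 'a) module"
  assumes jordan_algebra: "is_unital_jordan_algebra R J"
    and two_unit: "[(2::nat)] \<cdot>\<^bsub>R\<^esub> \<one>\<^bsub>R\<^esub> \<in> Units R"
begin

abbreviation mu (infixl "\<bullet>" 70) where "a \<bullet> b \<equiv> a \<otimes>\<^bsub>J\<^esub> b"

lemma module_J: "module R J" using jordan_algebra by (simp add: is_unital_jordan_algebra_def)

sublocale J: module R J by (rule module_J)

lemma mu_bilinear: "bilinear_map R J J J mu" using jordan_algebra
  by (simp add: is_unital_jordan_algebra_def)

lemmas mu_left = bilinear_map_left[OF mu_bilinear]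
lemmas mu_right = bilinear_map_right[OF mu_bilinear]

lemma mu_closed [simp]: "\<lbrakk>a \<in> carrier J; b \<in> carrier J\<rbrakk> \<Longrightarrow> a \<bullet> b \<in> carrier J"
  by (rule linear_map_closed[OF mu_right])

lemma mu_comm: "\<lbrakk>a \<in> carrier J; b \<in> carrier J\<rbrakk> \<Longrightarrow> a \<bullet> b = b \<bullet> a"
  using jordan_algebra by (simp add: is_unital_jordan_algebra_def)

lemma one_closed [simp]: "\<one>\<^bsub>J\<^esub> \<in> carrier J"
  using jordan_algebra by (simp add: is_unital_jordan_algebra_def)

lemma one_mu [simp]: "a \<in> carrier J \<Longrightarrow> \<one>\<^bsub>J\<^esub> \<bullet> a = a"
  using jordan_algebra unfolding is_unital_jordan_algebra_def by blast

lemma mu_one [simp]: "a \<in> carrier J \<Longrightarrow> a \<bullet> \<one>\<^bsub>J\<^esub> = a"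
  by (simp add: mu_comm[of a "\<one>\<^bsub>J\<^esub>"])

lemma mu_jordan: "\<lbrakk>a \<in> carrier J; b \<in> carrier J\<rbrakk> \<Longrightarrow> ((a \<bullet> a) \<bullet> b) \<bullet> a = (a \<bullet> a) \<bullet> (b \<bullet> a)"
  using jordan_algebra unfolding is_unital_jordan_algebra_def by blast

lemmas mu_simps =
  mu_left[THEN linear_map_add] mu_right[THEN linear_map_add]
  mu_left[THEN linear_map_neg[OF module_J module_J]] mu_right[THEN linear_map_neg[OF module_J module_J]]

lemmas ja_norm = mu_simps J.minus_eq J.signed_norm

lemma two_torsion: "\<lbrakk>x \<in> carrier J; x \<oplus>\<^bsub>J\<^esub> x = \<zero>\<^bsub>J\<^esub>\<rbrakk> \<Longrightarrow> x = \<zero>\<^bsub>J\<^esub>"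
  by (rule module_two_torsion[OF module_J two_unit])

text \<open>
  The full linearization of the Jordan identity. Replacing \<open>a\<close> by \<open>a + c\<close> and by \<open>a - c\<close> and
  subtracting isolates, up to the part that is cubic in \<open>c\<close>, twice the part \<open>G\<close> that is quadratic
  in \<open>a\<close> and linear in \<open>c\<close>; polarizing \<open>G\<close> gives twice the identity. Both times 2 is cancelled.
\<close>

lemma jordan_linearized:
  assumes "a \<in> carrier J" "b \<in> carrier J" "c \<in> carrier J" "d \<in> carrier J"
  shows "((a \<bullet> b) \<bullet> d) \<bullet> c \<oplus>\<^bsub>J\<^esub> ((b \<bullet> c) \<bullet> d) \<bullet> a \<oplus>\<^bsub>J\<^esub> ((c \<bullet> a) \<bullet> d) \<bullet> b =
    (a \<bullet> b) \<bullet> (d \<bullet> c) \<oplus>\<^bsub>J\<^esub> (b \<bullet> c) \<bullet> (d \<bullet> a) \<oplus>\<^bsub>J\<^esub> (c \<bullet> a) \<bullet> (d \<bullet> b)"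
proof -
  define K where "K = (\<lambda>a. ((a \<bullet> a) \<bullet> d) \<bullet> a \<ominus>\<^bsub>J\<^esub> (a \<bullet> a) \<bullet> (d \<bullet> a))"
  define H where "H = (\<lambda>a c. ((a \<bullet> c) \<bullet> d) \<bullet> a \<ominus>\<^bsub>J\<^esub> (a \<bullet> c) \<bullet> (d \<bullet> a))"
  define G where "G = (\<lambda>a c. (H a c \<oplus>\<^bsub>J\<^esub> H a c) \<oplus>\<^bsub>J\<^esub> (((a \<bullet> a) \<bullet> d) \<bullet> c \<ominus>\<^bsub>J\<^esub> (a \<bullet> a) \<bullet> (d \<bullet> c)))"
  have K: "K a = \<zero>\<^bsub>J\<^esub>" if "a \<in> carrier J" for a
    using that assms(4) by (simp add: K_def mu_jordan J.minus_eq J.r_neg)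
  have G: "G a c = \<zero>\<^bsub>J\<^esub>" if "a \<in> carrier J" "c \<in> carrier J" for a c
  proof (rule two_torsion)
    have "G a c \<oplus>\<^bsub>J\<^esub> G a c = (K (a \<oplus>\<^bsub>J\<^esub> c) \<ominus>\<^bsub>J\<^esub> K (a \<ominus>\<^bsub>J\<^esub> c)) \<ominus>\<^bsub>J\<^esub> (K c \<oplus>\<^bsub>J\<^esub> K c)"
      by (rule J.eq_if_signed)
        (use that assms(4) in \<open>simp_all add: G_def K_def H_def ja_norm mu_comm\<close>)
    then show "G a c \<oplus>\<^bsub>J\<^esub> G a c = \<zero>\<^bsub>J\<^esub>" using that by (simp add: K J.minus_eq)
  qed (use that assms(4) in \<open>simp add: G_def H_def\<close>)
  let ?l = "((a \<bullet> b) \<bullet> d) \<bullet> c \<oplus>\<^bsub>J\<^esub> ((b \<bullet> c) \<bullet> d) \<bullet> a \<oplus>\<^bsub>J\<^esub> ((c \<bullet> a) \<bullet> d) \<bullet> b"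
  let ?r = "(a \<bullet> b) \<bullet> (d \<bullet> c) \<oplus>\<^bsub>J\<^esub> (b \<bullet> c) \<bullet> (d \<bullet> a) \<oplus>\<^bsub>J\<^esub> (c \<bullet> a) \<bullet> (d \<bullet> b)"
  have "(?l \<ominus>\<^bsub>J\<^esub> ?r) \<oplus>\<^bsub>J\<^esub> (?l \<ominus>\<^bsub>J\<^esub> ?r) = (G (a \<oplus>\<^bsub>J\<^esub> b) c \<ominus>\<^bsub>J\<^esub> G a c) \<ominus>\<^bsub>J\<^esub> G b c"
    by (rule J.eq_if_signed)
      (use assms in \<open>simp_all add: G_def H_def ja_norm mu_comm\<close>)
  then have "(?l \<ominus>\<^bsub>J\<^esub> ?r) \<oplus>\<^bsub>J\<^esub> (?l \<ominus>\<^bsub>J\<^esub> ?r) = \<zero>\<^bsub>J\<^esub>"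
    using assms by (simp add: G J.minus_eq)
  then have zero: "?l \<ominus>\<^bsub>J\<^esub> ?r = \<zero>\<^bsub>J\<^esub>"
    by (rule two_torsion[rotated]) (use assms in simp)
  show "?l = ?r"
    by (rule module_eq_if_minus_zero[OF module_J _ _ zero]) (use assms in simp_all)
qed

text \<open>
  The right hand side of the linearized identity is symmetric in all four variables, hence so is
  the left hand side. Exchanging \<open>d\<close> with one of the other variables gives the derivation rule.
\<close>

lemma inner_derivation:
  assumes "a \<in> carrier J" "b \<in> carrier J" "x \<in> carrier J" "y \<in> carrier J"
  defines "D \<equiv> \<lambda>x. a \<bullet> (b \<bullet> x) \<ominus>\<^bsub>J\<^esub> b \<bullet> (a \<bullet> x)"
  shows "D (x \<bullet> y) = D x \<bullet> y \<oplus>\<^bsub>J\<^esub> x \<bullet> D y"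
proof -
  let ?l = "\<lambda>a b. ((b \<bullet> x) \<bullet> a) \<bullet> y \<oplus>\<^bsub>J\<^esub> ((x \<bullet> y) \<bullet> a) \<bullet> b \<oplus>\<^bsub>J\<^esub> ((y \<bullet> b) \<bullet> a) \<bullet> x"
  have "?l a b = ?l b a"
    using assms(1-4) by (simp add: jordan_linearized) (simp add: mu_comm J.a_ac)
  moreover have "(D x \<bullet> y \<oplus>\<^bsub>J\<^esub> x \<bullet> D y) \<ominus>\<^bsub>J\<^esub> D (x \<bullet> y) = ?l a b \<ominus>\<^bsub>J\<^esub> ?l b a"
    unfolding D_def
    by (rule J.eq_if_signed) (use assms(1-4) in \<open>simp_all add: ja_norm mu_comm\<close>)
  ultimately have zero: "(D x \<bullet> y \<oplus>\<^bsub>J\<^esub> x \<bullet> D y) \<ominus>\<^bsub>J\<^esub> D (x \<bullet> y) = \<zero>\<^bsub>J\<^esub>"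
    using assms(1-4) by (simp add: J.minus_eq J.r_neg)
  have cl: "D z \<in> carrier J" if "z \<in> carrier J" for z
    using that assms(1-4) by (simp add: D_def)
  have "D x \<bullet> y \<oplus>\<^bsub>J\<^esub> x \<bullet> D y = D (x \<bullet> y)"
    by (rule module_eq_if_minus_zero[OF module_J _ _ zero]) (use assms(1-4) cl in simp_all)
  then show ?thesis by simp
qed

definition tr where "tr a b c = ((a \<bullet> b) \<bullet> c \<oplus>\<^bsub>J\<^esub> a \<bullet> (b \<bullet> c)) \<ominus>\<^bsub>J\<^esub> b \<bullet> (c \<bullet> a)"

lemma tr_closed: "\<lbrakk>a \<in> carrier J; b \<in> carrier J; c \<in> carrier J\<rbrakk> \<Longrightarrow> tr a b c \<in> carrier J"
  by (simp add: tr_def)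

text \<open>
  With \<open>p = a b\<close>, \<open>D = [L\<^sub>a, L\<^sub>b]\<close> and \<open>E = [L\<^sub>c, L\<^sub>d]\<close> one has \<open>V\<^bsub>a,b\<^esub> = L\<^sub>p + D\<close> and \<open>V\<^bsub>b,a\<^esub> = L\<^sub>p - D\<close>.
  Expanding with the derivation rule for \<open>D\<close>, the two sides differ by an instance of the
  linearized Jordan identity for \<open>p, c, d\<close> and by an instance of the derivation rule for \<open>E\<close>.
\<close>

lemma jordan_identity_tr:
  assumes "a \<in> carrier J" "b \<in> carrier J" "c \<in> carrier J" "d \<in> carrier J" "x \<in> carrier J"
  shows "tr a b (tr c d x) \<ominus>\<^bsub>J\<^esub> tr c d (tr a b x) = tr (tr a b c) d x \<ominus>\<^bsub>J\<^esub> tr c (tr b a d) x"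
proof -
  define D where "D = (\<lambda>x. a \<bullet> (b \<bullet> x) \<ominus>\<^bsub>J\<^esub> b \<bullet> (a \<bullet> x))"
  define E where "E = (\<lambda>x. c \<bullet> (d \<bullet> x) \<ominus>\<^bsub>J\<^esub> d \<bullet> (c \<bullet> x))"
  define p where "p = a \<bullet> b"
  have p: "p \<in> carrier J" using assms by (simp add: p_def)
  have D_closed: "D z \<in> carrier J" if "z \<in> carrier J" for z
    using that assms by (simp add: D_def)
  have D_add: "D (y \<oplus>\<^bsub>J\<^esub> z) = D y \<oplus>\<^bsub>J\<^esub> D z" if "y \<in> carrier J" "z \<in> carrier J" for y z
    unfolding D_def by (rule J.eq_if_signed) (use that assms in \<open>simp_all add: ja_norm\<close>)
  have D_neg: "D (\<ominus>\<^bsub>J\<^esub> y) = \<ominus>\<^bsub>J\<^esub> D y" if "y \<in> carrier J" for y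
    unfolding D_def by (rule J.eq_if_signed) (use that assms in \<open>simp_all add: ja_norm\<close>)
  have D_mu: "D (y \<bullet> z) = D y \<bullet> z \<oplus>\<^bsub>J\<^esub> y \<bullet> D z" if "y \<in> carrier J" "z \<in> carrier J" for y z
    unfolding D_def using assms(1,2) that by (rule inner_derivation)
  have ab: "tr a b z = p \<bullet> z \<oplus>\<^bsub>J\<^esub> D z" "tr b a z = p \<bullet> z \<ominus>\<^bsub>J\<^esub> D z" if "z \<in> carrier J" for z
    unfolding D_def p_def tr_def
    by (rule J.eq_if_signed; use that assms in \<open>simp add: ja_norm mu_comm\<close>)+
  let ?l = "((p \<bullet> c) \<bullet> x) \<bullet> d \<oplus>\<^bsub>J\<^esub> ((c \<bullet> d) \<bullet> x) \<bullet> p \<oplus>\<^bsub>J\<^esub> ((d \<bullet> p) \<bullet> x) \<bullet> c"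
  let ?r = "(p \<bullet> c) \<bullet> (x \<bullet> d) \<oplus>\<^bsub>J\<^esub> (c \<bullet> d) \<bullet> (x \<bullet> p) \<oplus>\<^bsub>J\<^esub> (d \<bullet> p) \<bullet> (x \<bullet> c)"
  have lr: "?l = ?r" using p assms by (intro jordan_linearized)
  have "(p \<bullet> tr c d x \<oplus>\<^bsub>J\<^esub> D (tr c d x)) \<ominus>\<^bsub>J\<^esub> tr c d (p \<bullet> x \<oplus>\<^bsub>J\<^esub> D x) =
    (tr (p \<bullet> c \<oplus>\<^bsub>J\<^esub> D c) d x \<ominus>\<^bsub>J\<^esub> tr c (p \<bullet> d \<ominus>\<^bsub>J\<^esub> D d) x) \<oplus>\<^bsub>J\<^esub> (?l \<ominus>\<^bsub>J\<^esub> ?r) \<oplus>\<^bsub>J\<^esub>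
    ((E p \<bullet> x \<oplus>\<^bsub>J\<^esub> p \<bullet> E x) \<ominus>\<^bsub>J\<^esub> E (p \<bullet> x))"
    unfolding tr_def E_def
    by (rule J.eq_if_signed)
      (use p assms D_closed in \<open>simp_all add: ja_norm D_add D_neg D_mu mu_comm\<close>)
  moreover have "E (p \<bullet> x) = E p \<bullet> x \<oplus>\<^bsub>J\<^esub> p \<bullet> E x"
    unfolding E_def using assms(3,4) p assms(5) by (rule inner_derivation)
  moreover have "E z \<in> carrier J" if "z \<in> carrier J" for z
    using that assms by (simp add: E_def)
  ultimately show ?thesis
    using p assms D_closed by (simp add: ab lr J.minus_eq J.r_neg tr_closed)
qed

end

subsection \<open>The triple product of a Jordan algebra\<close>

context jordan_algebra
begin

lemma tr_linear:
  "\<lbrakk>b \<in> carrier J; c \<in> carrier J\<rbrakk> \<Longrightarrow> linear_map R J J (\<lambda>a. tr a b c)"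
  "\<lbrakk>a \<in> carrier J; c \<in> carrier J\<rbrakk> \<Longrightarrow> linear_map R J J (\<lambda>b. tr a b c)"
  "\<lbrakk>a \<in> carrier J; b \<in> carrier J\<rbrakk> \<Longrightarrow> linear_map R J J (\<lambda>c. tr a b c)"
  unfolding tr_def
  by (intro linear_map_diff linear_map_plus module_J linear_map_comp[OF mu_left mu_left]
    linear_map_comp[OF mu_left mu_right] linear_map_comp[OF mu_right mu_right]
    linear_map_comp[OF mu_right mu_left] mu_left mu_right mu_closed; assumption)+

lemma tr_commute: "\<lbrakk>a \<in> carrier J; b \<in> carrier J; c \<in> carrier J\<rbrakk> \<Longrightarrow> tr a b c = tr c b a"
  unfolding tr_def by (rule J.eq_if_signed) (simp_all add: ja_norm mu_comm)

lemma jts_of_ja_simps [simp]: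
  "carrier (jts_of_ja J) = carrier J" "\<zero>\<^bsub>jts_of_ja J\<^esub> = \<zero>\<^bsub>J\<^esub>" "add (jts_of_ja J) = add J"
  "smult (jts_of_ja J) = smult J" "trip (jts_of_ja J) = tr"
  by (simp_all add: jts_of_ja_def module.extend_def triple_system.fields_def tr_def fun_eq_iff)

lemma jordan_triple_system_ja: "is_jordan_triple_system R (jts_of_ja J)"
proof -
  have "jordan_product R J J tr tr"
    unfolding jordan_product_def trilinear_map_def
    by (intro conjI ballI tr_linear tr_commute jordan_identity_tr)
  then show ?thesis
    using module_cong[OF module_J, of "jts_of_ja J"]
      jordan_product_cong[of "jts_of_ja J" J "jts_of_ja J" J R tr tr]
    by (simp add: is_jordan_triple_system_def)
qed

lemma tr_one: "a \<in> carrier J \<Longrightarrow> b \<in> carrier J \<Longrightarrow> tr a \<one>\<^bsub>J\<^esub> b = a \<bullet> b"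
  unfolding tr_def by (rule J.eq_if_signed) (simp_all add: ja_norm mu_comm)

lemma one_tr_one: "a \<in> carrier J \<Longrightarrow> tr \<one>\<^bsub>J\<^esub> a \<one>\<^bsub>J\<^esub> = a"
  unfolding tr_def by (rule J.eq_if_signed) (simp_all add: ja_norm mu_comm)

end

subsection \<open>Homotopes of Jordan pairs\<close>

text \<open>
  Exchanging the components turns a statement on \<open>P\<^sub>+\<close> into the corresponding one on \<open>P\<^sub>-\<close>.
\<close>

definition opposite_pair :: "('k, 'a, 'b) jordan_pair \<Rightarrow> ('k, 'b, 'a) jordan_pair" where
  "opposite_pair P = \<lparr>jpm = jpp P, jpp = jpm P, trm = trp P, trp = trm P\<rparr>"

lemma opposite_pair_simps [simp]:
  "jpm (opposite_pair P) = jpp P" "jpp (opposite_pair P) = jpm P"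
  "trm (opposite_pair P) = trp P" "trp (opposite_pair P) = trm P"
  by (simp_all add: opposite_pair_def)

locale jpair_torsion = jpair +
  assumes two: "[(2::nat)] \<cdot>\<^bsub>R\<^esub> \<one>\<^bsub>R\<^esub> \<in> Units R" and three: "[(3::nat)] \<cdot>\<^bsub>R\<^esub> \<one>\<^bsub>R\<^esub> \<in> Units R"
begin

lemma opposite: "jpair_torsion R (opposite_pair P)"
  using jordan_pair two three
  by unfold_locales (simp_all add: is_jordan_pair_def)

text \<open>
  Let \<open>p = {a,b,{a,d,a}}\<close>, \<open>q = {a,d,{a,b,a}}\<close> and \<open>r = {a,{b,a,d},a}\<close>. The Jordan pair identity
  gives \<open>p = 2 q - r\<close> and, with \<open>b\<close> and \<open>d\<close> exchanged, \<open>q = 2 p - r\<close>. So \<open>3 p = 3 q\<close>, and all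
  three agree.
\<close>

lemma quadratic_commute:
  assumes "a \<in> carrier N" "b \<in> carrier M" "d \<in> carrier M"
  shows "s a b (s a d a) = s a (t b a d) a"
proof -
  define p where "p = s a b (s a d a)"
  define q where "q = s a d (s a b a)"
  define r where "r = s a (t b a d) a"
  have cl: "p \<in> carrier N" "q \<in> carrier N" "r \<in> carrier N"
    using assms by (simp_all add: p_def q_def r_def)
  have 1: "p = (q \<ominus>\<^bsub>N\<^esub> r) \<oplus>\<^bsub>N\<^esub> q"
    using assms jordan_s[of a b a d a] s_commute[of "s a b a" d a] by (simp add: p_def q_def r_def)
  have 2: "q = (p \<ominus>\<^bsub>N\<^esub> r) \<oplus>\<^bsub>N\<^esub> p"
    using assms jordan_s[of a d a b a] s_commute[of "s a d a" b a] t_commute[of d a b]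
      by (simp add: p_def q_def r_def)
  have "p = q"
  proof (rule module_triple_cancel[OF module_N three cl(1,2)])
    have "(p \<oplus>\<^bsub>N\<^esub> p) \<oplus>\<^bsub>N\<^esub> p = (((p \<ominus>\<^bsub>N\<^esub> r) \<oplus>\<^bsub>N\<^esub> p) \<oplus>\<^bsub>N\<^esub> p) \<oplus>\<^bsub>N\<^esub> r"
      by (rule N.eq_if_signed) (use cl in \<open>simp_all add: N.signed_norm\<close>)
    also have "\<dots> = (q \<oplus>\<^bsub>N\<^esub> ((q \<ominus>\<^bsub>N\<^esub> r) \<oplus>\<^bsub>N\<^esub> q)) \<oplus>\<^bsub>N\<^esub> r" using 1 2 by simp
    also have "\<dots> = (q \<oplus>\<^bsub>N\<^esub> q) \<oplus>\<^bsub>N\<^esub> q"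
      by (rule N.eq_if_signed) (use cl in \<open>simp_all add: N.signed_norm\<close>)
    finally show "(p \<oplus>\<^bsub>N\<^esub> p) \<oplus>\<^bsub>N\<^esub> p = (q \<oplus>\<^bsub>N\<^esub> q) \<oplus>\<^bsub>N\<^esub> q" .
  qed
  have "r = ((p \<ominus>\<^bsub>N\<^esub> ((p \<ominus>\<^bsub>N\<^esub> r) \<oplus>\<^bsub>N\<^esub> p))) \<oplus>\<^bsub>N\<^esub> p"
    by (rule N.eq_if_signed) (use cl in \<open>simp_all add: N.signed_norm\<close>)
  also have "\<dots> = (p \<ominus>\<^bsub>N\<^esub> q) \<oplus>\<^bsub>N\<^esub> p" using 2 by simp
  also have "\<dots> = p" using cl \<open>p = q\<close> by (simp add: N.minus_eq N.r_neg)
  finally show ?thesis by (simp add: p_def r_def)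
qed

text \<open>
  The linearization of \<open>[V\<^bsub>a,b\<^esub>, V\<^bsub>a,b\<^esub>] = 0\<close> in \<open>b\<close>: the commutators \<open>[V\<^bsub>a,b\<^esub>, V\<^bsub>a,d\<^esub>]\<close> and
  \<open>[V\<^bsub>a,d\<^esub>, V\<^bsub>a,b\<^esub>]\<close> add up to zero.
\<close>

lemma V_quadratic:
  assumes "a \<in> carrier N" "b \<in> carrier M" "d \<in> carrier M" "x \<in> carrier N"
  shows "s (s a b a) d x \<oplus>\<^bsub>N\<^esub> s (s a d a) b x = s a (t b a d) x \<oplus>\<^bsub>N\<^esub> s a (t b a d) x"
proof -
  define u where "u = s a b (s a d x)"
  define v where "v = s a d (s a b x)"
  define p where "p = s (s a b a) d x"
  define q where "q = s (s a d a) b x"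
  define r where "r = s a (t b a d) x"
  have cl: "u \<in> carrier N" "v \<in> carrier N" "p \<in> carrier N" "q \<in> carrier N" "r \<in> carrier N"
    using assms by (simp_all add: u_def v_def p_def q_def r_def)
  have 1: "u = (p \<ominus>\<^bsub>N\<^esub> r) \<oplus>\<^bsub>N\<^esub> v"
    using assms jordan_s[of a b a d x] by (simp add: u_def v_def p_def r_def)
  have 2: "v = (q \<ominus>\<^bsub>N\<^esub> r) \<oplus>\<^bsub>N\<^esub> u"
    using assms jordan_s[of a d a b x] t_commute[of d a b] by (simp add: u_def v_def q_def r_def)
  have "p \<oplus>\<^bsub>N\<^esub> q = (((p \<ominus>\<^bsub>N\<^esub> r) \<oplus>\<^bsub>N\<^esub> v) \<ominus>\<^bsub>N\<^esub> v) \<oplus>\<^bsub>N\<^esub> (((q \<ominus>\<^bsub>N\<^esub> r) \<oplus>\<^bsub>N\<^esub> u) \<ominus>\<^bsub>N\<^esub> u) \<oplus>\<^bsub>N\<^esub> (r \<oplus>\<^bsub>N\<^esub> r)"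
    by (rule N.eq_if_signed) (use cl in \<open>simp_all add: N.signed_norm\<close>)
  also have "\<dots> = (u \<ominus>\<^bsub>N\<^esub> v) \<oplus>\<^bsub>N\<^esub> (v \<ominus>\<^bsub>N\<^esub> u) \<oplus>\<^bsub>N\<^esub> (r \<oplus>\<^bsub>N\<^esub> r)"
    using 1 2 by simp
  also have "\<dots> = r \<oplus>\<^bsub>N\<^esub> r"
    by (rule N.eq_if_signed) (use cl in \<open>simp_all add: N.signed_norm\<close>)
  finally show ?thesis by (simp add: p_def q_def r_def)
qed

text \<open>
  In the homotope, where \<open>x y = {x,f,y}\<close>, the right hand side is the triple product of a Jordan
  algebra. So the triple product of the homotope is that of the pair with \<open>c\<close> transported by
  \<open>c \<mapsto> {f,c,f}\<close>.
\<close>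

lemma homotope_U:
  assumes "f \<in> carrier M" "a \<in> carrier N" "c \<in> carrier N" "x \<in> carrier N"
  shows "s a (t f c f) x = (s (s c f a) f x \<oplus>\<^bsub>N\<^esub> s a f (s c f x)) \<ominus>\<^bsub>N\<^esub> s c f (s a f x)"
  unfolding jordan_s[OF assms(3,1,2,1,4)]
  by (rule N.eq_if_signed) (use assms in \<open>simp_all add: N.signed_norm\<close>)

end

context jpair_torsion
begin

interpretation op: jpair_torsion R "opposite_pair P" by (rule opposite)

text \<open>
  The claim is \<open>[V\<^bsub>a,f\<^esub>, V\<^bsub>a2,f\<^esub>] = 0\<close> for \<open>a2 = {a,f,a}\<close>, evaluated at \<open>x\<close>. With \<open>a3 = {a,f,a2}\<close>,
  \<open>g = {f,a,f}\<close> and \<open>w = {f,a,g}\<close>, the Jordan pair identity computes this commutator as \<open>A - B\<close>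
  and its negative as \<open>A - C\<close>, for \<open>A = V\<^bsub>a3,f\<^esub>\<close>, \<open>B = V\<^bsub>a2,g\<^esub>\<close> and \<open>C = V\<^bsub>a,w\<^esub>\<close>; here \<open>{f,a2,f} = w\<close>
  by \<open>quadratic_commute\<close>. So \<open>2 A = B + C\<close>. As \<open>{a,g,a} = a3\<close>, \<open>V_quadratic\<close> gives \<open>A + B = 2 C\<close>.
  Together \<open>3 A = 3 C\<close>, and then \<open>B = A\<close>.
\<close>

lemma homotope_jordan:
  assumes f: "f \<in> carrier M" and a: "a \<in> carrier N" and x: "x \<in> carrier N"
  shows "s a f (s (s a f a) f x) = s (s a f a) f (s a f x)"
proof -
  define a2 where "a2 = s a f a"
  define g where "g = t f a f"
  define A where "A = s (s a f a2) f x"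
  define B where "B = s a2 g x"
  define C where "C = s a (t f a g) x"
  define u where "u = s a f (s a2 f x)"
  define v where "v = s a2 f (s a f x)"
  have cl: "a2 \<in> carrier N" "g \<in> carrier M" "A \<in> carrier N" "B \<in> carrier N" "C \<in> carrier N"
    "u \<in> carrier N" "v \<in> carrier N"
    using assms by (simp_all add: a2_def g_def A_def B_def C_def u_def v_def)
  have a3: "s a g a = s a f a2"
    using quadratic_commute[OF a f f] by (simp add: a2_def g_def)
  have w: "t f a2 f = t f a g"
    using op.quadratic_commute[of f a a] f a by (simp add: a2_def g_def)
  have 1: "u = (A \<ominus>\<^bsub>N\<^esub> B) \<oplus>\<^bsub>N\<^esub> v"
    using jordan_s[OF a f cl(1) f x] by (simp add: A_def B_def u_def v_def g_def)
  have 2: "v = (A \<ominus>\<^bsub>N\<^esub> C) \<oplus>\<^bsub>N\<^esub> u"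
    using jordan_s[OF cl(1) f a f x] s_commute[OF cl(1) f a] w by (simp add: A_def C_def u_def v_def)
  have 3: "B \<oplus>\<^bsub>N\<^esub> A = C \<oplus>\<^bsub>N\<^esub> C"
    using V_quadratic[OF a f cl(2) x] a3 by (simp add: A_def B_def C_def a2_def)
  have "A \<oplus>\<^bsub>N\<^esub> A = (((A \<ominus>\<^bsub>N\<^esub> B) \<oplus>\<^bsub>N\<^esub> v) \<ominus>\<^bsub>N\<^esub> v) \<oplus>\<^bsub>N\<^esub> (((A \<ominus>\<^bsub>N\<^esub> C) \<oplus>\<^bsub>N\<^esub> u) \<ominus>\<^bsub>N\<^esub> u) \<oplus>\<^bsub>N\<^esub> (B \<oplus>\<^bsub>N\<^esub> C)"
    by (rule N.eq_if_signed) (use cl in \<open>simp_all add: N.signed_norm\<close>)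
  also have "\<dots> = (u \<ominus>\<^bsub>N\<^esub> v) \<oplus>\<^bsub>N\<^esub> (v \<ominus>\<^bsub>N\<^esub> u) \<oplus>\<^bsub>N\<^esub> (B \<oplus>\<^bsub>N\<^esub> C)"
    using 1 2 by simp
  also have "\<dots> = B \<oplus>\<^bsub>N\<^esub> C"
    by (rule N.eq_if_signed) (use cl in \<open>simp_all add: N.signed_norm\<close>)
  finally have 4: "A \<oplus>\<^bsub>N\<^esub> A = B \<oplus>\<^bsub>N\<^esub> C" .
  have "A = C"
  proof (rule module_triple_cancel[OF module_N three cl(3,5)])
    have "(A \<oplus>\<^bsub>N\<^esub> A) \<oplus>\<^bsub>N\<^esub> A = (B \<oplus>\<^bsub>N\<^esub> A) \<oplus>\<^bsub>N\<^esub> C"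
      unfolding 4 by (rule N.eq_if_signed) (use cl in \<open>simp_all add: N.signed_norm\<close>)
    then show "(A \<oplus>\<^bsub>N\<^esub> A) \<oplus>\<^bsub>N\<^esub> A = (C \<oplus>\<^bsub>N\<^esub> C) \<oplus>\<^bsub>N\<^esub> C" unfolding 3 .
  qed
  then have "B = A" using 4 cl by simp
  with 1 show ?thesis using cl by (simp add: u_def v_def a2_def N.minus_eq N.r_neg)
qed

end

text \<open>
  What remains of an \<open>sl\<^sub>2\<close>-triple in terms of the Jordan pair: \<open>h = [e,f]\<close> acts as \<open>2\<close> on the
  component of \<open>e\<close> and as \<open>-2\<close> on that of \<open>f\<close>.
\<close>

locale jpair_sl2 = jpair_torsion +
  fixes e f
  assumes e: "e \<in> carrier N" and f: "f \<in> carrier M"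
    and sef: "y \<in> carrier N \<Longrightarrow> s e f y = y \<oplus>\<^bsub>N\<^esub> y"
    and tfe: "z \<in> carrier M \<Longrightarrow> t f e z = z \<oplus>\<^bsub>M\<^esub> z"
begin

interpretation op: jpair_torsion R "opposite_pair P" by (rule opposite)

lemma sfe: "y \<in> carrier N \<Longrightarrow> s y f e = y \<oplus>\<^bsub>N\<^esub> y"
  using sef s_commute[of e f y] e f by simp

lemma tef: "z \<in> carrier M \<Longrightarrow> t z e f = z \<oplus>\<^bsub>M\<^esub> z"
  using tfe t_commute[of f e z] e f by simp

text \<open>
  The isomorphism between the two components given by \<open>f\<close>. Its inverse is \<open>y \<mapsto> {e,y,e} / 4\<close>
  (\<open>s_e_\<psi>_e\<close>).
\<close>

definition \<psi> where "\<psi> x = t f x f"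

lemma \<psi>_linear: "linear_map R N M \<psi>"
  unfolding \<psi>_def using f f by (rule t_linear(2))

lemma \<psi>_closed [simp]: "x \<in> carrier N \<Longrightarrow> \<psi> x \<in> carrier M"
  by (rule linear_map_closed[OF \<psi>_linear])

lemmas \<psi>_simps = linear_map_add[OF \<psi>_linear] linear_map_neg[OF module_N module_M \<psi>_linear]

lemma s_e_\<psi>:
  assumes "a \<in> carrier N" "b \<in> carrier N"
  shows "s e (\<psi> a) b = s a f b \<oplus>\<^bsub>N\<^esub> s a f b"
  unfolding \<psi>_def homotope_U[OF f e assms]
  by (rule N.eq_if_signed) (use assms e f in \<open>simp_all add: sef sfe N_norm\<close>)

lemma s_e_\<psi>_e:
  "a \<in> carrier N \<Longrightarrow> s e (\<psi> a) e = (a \<oplus>\<^bsub>N\<^esub> a) \<oplus>\<^bsub>N\<^esub> (a \<oplus>\<^bsub>N\<^esub> a)"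
  using e by (simp add: s_e_\<psi> sfe)

text \<open>
  Up to the factor \<open>2\<close>, \<open>\<psi>\<close> is an isomorphism from the homotope given by \<open>f\<close> to the one given by
  \<open>e\<close>. The derivation \<open>V\<^bsub>\<psi> a,e\<^esub>\<close> is applied to \<open>\<psi> b = {f,b,f}\<close>; the outer terms become \<open>2 \<psi>(a b)\<close>
  each by \<open>quadratic_commute\<close>, the middle one is \<open>-2 \<psi>(a b)\<close>.
\<close>

lemma t_\<psi>_e_\<psi>:
  assumes a: "a \<in> carrier N" and b: "b \<in> carrier N"
  shows "t (\<psi> a) e (\<psi> b) = \<psi> (s a f b) \<oplus>\<^bsub>M\<^esub> \<psi> (s a f b)"
proof -
  have 1: "t f b (\<psi> a) = \<psi> (s a f b)"
    using op.quadratic_commute[of f b a] a b f s_commute[OF b f a] by (simp add: \<psi>_def)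
  have "t (\<psi> a) e (\<psi> b) = (t (t (\<psi> a) e f) b f \<ominus>\<^bsub>M\<^esub> t f (s e (\<psi> a) b) f) \<oplus>\<^bsub>M\<^esub> t f b (t (\<psi> a) e f)"
    using jordan_t[of "\<psi> a" e f b f] a b e f by (simp add: \<psi>_def)
  also have "t f (s e (\<psi> a) b) f = \<psi> (s a f b) \<oplus>\<^bsub>M\<^esub> \<psi> (s a f b)"
    using a b f by (simp add: s_e_\<psi>[OF a b] \<psi>_simps flip: \<psi>_def)
  also have "t (t (\<psi> a) e f) b f = t f b (t (\<psi> a) e f)"
    using a b e f by (intro t_commute) simp_all
  also have "t f b (t (\<psi> a) e f) = \<psi> (s a f b) \<oplus>\<^bsub>M\<^esub> \<psi> (s a f b)"
    using a b f by (simp add: tef t_simps 1)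
  finally show ?thesis
    using a b f by (simp add: M.minus_eq M.r_neg)
qed

text \<open>
  The triple product of the homotope as a Jordan algebra.
\<close>

definition htr where "htr a b c = (s (s a f b) f c \<oplus>\<^bsub>N\<^esub> s a f (s b f c)) \<ominus>\<^bsub>N\<^esub> s b f (s c f a)"

lemma htr_s:
  assumes "a \<in> carrier N" "b \<in> carrier N" "c \<in> carrier N"
  shows "s a (\<psi> b) c = htr a b c"
  unfolding \<psi>_def homotope_U[OF f assms] htr_def
  using s_commute[of b f a] s_commute[of c f a] assms f by simp

text \<open>
  With \<open>4 b = {e, \<psi> b, e}\<close>, four times the left hand side is the triple product of \<open>\<psi> a\<close>, \<open>\<psi> b\<close>,
  \<open>\<psi> c\<close> in the homotope given by \<open>e\<close>, which by \<open>t_\<psi>_e_\<psi>\<close> corresponds to \<open>4\<close> times that of \<open>a\<close>,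
  \<open>b\<close>, \<open>c\<close>.
\<close>

lemma htr_t:
  assumes a: "a \<in> carrier N" and b: "b \<in> carrier N" and c: "c \<in> carrier N"
  shows "t (\<psi> a) b (\<psi> c) = \<psi> (htr a b c)"
proof -
  have cl: "t (\<psi> a) b (\<psi> c) \<in> carrier M" "\<psi> (htr a b c) \<in> carrier M"
    using assms f by (simp_all add: htr_def)
  have "t (\<psi> a) (s e (\<psi> b) e) (\<psi> c) =
    (t (t (\<psi> b) e (\<psi> a)) e (\<psi> c) \<oplus>\<^bsub>M\<^esub> t (\<psi> a) e (t (\<psi> b) e (\<psi> c))) \<ominus>\<^bsub>M\<^esub> t (\<psi> b) e (t (\<psi> a) e (\<psi> c))"
    using op.homotope_U[of e "\<psi> a" "\<psi> b" "\<psi> c"] e assms by simp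
  also have "\<dots> = (\<psi> (htr a b c) \<oplus>\<^bsub>M\<^esub> \<psi> (htr a b c)) \<oplus>\<^bsub>M\<^esub> (\<psi> (htr a b c) \<oplus>\<^bsub>M\<^esub> \<psi> (htr a b c))"
    unfolding htr_def
    by (rule M.eq_if_signed)
      (use assms e f in \<open>simp_all add: t_\<psi>_e_\<psi> t_simps \<psi>_simps s_commute N.minus_eq M.signed_norm\<close>)
  also have "t (\<psi> a) (s e (\<psi> b) e) (\<psi> c) =
     (t (\<psi> a) b (\<psi> c) \<oplus>\<^bsub>M\<^esub> t (\<psi> a) b (\<psi> c)) \<oplus>\<^bsub>M\<^esub> (t (\<psi> a) b (\<psi> c) \<oplus>\<^bsub>M\<^esub> t (\<psi> a) b (\<psi> c))"
    using assms by (simp add: s_e_\<psi>_e t_simps)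
  finally have "t (\<psi> a) b (\<psi> c) \<oplus>\<^bsub>M\<^esub> t (\<psi> a) b (\<psi> c) = \<psi> (htr a b c) \<oplus>\<^bsub>M\<^esub> \<psi> (htr a b c)"
    by (rule module_double_cancel[OF module_M two, rotated 2]) (use cl in simp_all)
  then show ?thesis
    by (rule module_double_cancel[OF module_M two, rotated 2]) (use cl in simp_all)
qed

end

section \<open>\<open>A\<^sub>1\<close>-graded Lie algebras\<close>

lemma (in abelian_group) int_multiple_simps:
  assumes "x \<in> carrier G"
  shows "[(2::int)] \<cdot> x = x \<oplus> x" "[(-2::int)] \<cdot> x = \<ominus> (x \<oplus> x)" "[(0::int)] \<cdot> x = \<zero>"
  using assms
  by (simp_all add: add_pow_int_ge add_pow_int_lt numeral_2_eq_2)

text \<open>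
  An \<open>A\<^sub>1\<close>-graded Lie algebra as a 3-graded one. The \<open>h\<close>-eigenspaces are used in degrees \<open>-1\<close>,
  \<open>0\<close>, \<open>1\<close> only: over a ring with torsion an element may be an eigenvector for several of the
  values \<open>2 i\<close>.
\<close>

definition h_graded :: "('k, 'a) lie_algebra \<Rightarrow> 'a \<Rightarrow> ('k, 'a) graded_lie_algebra" where
  "h_graded L h =
     lie_algebra.extend L (graded_lie_algebra.fields (\<lambda>i. if \<bar>i\<bar> \<le> 1 then h_grade L h i else {\<zero>\<^bsub>L\<^esub>}))"

lemma h_graded_simps [simp]:
  "carrier (h_graded L h) = carrier L" "\<zero>\<^bsub>h_graded L h\<^esub> = \<zero>\<^bsub>L\<^esub>" "add (h_graded L h) = add L"
  "smult (h_graded L h) = smult L" "bracket (h_graded L h) = bracket L"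
  "grade (h_graded L h) i = (if \<bar>i\<bar> \<le> 1 then h_grade L h i else {\<zero>\<^bsub>L\<^esub>})"
  by (simp_all add: h_graded_def lie_algebra.extend_def graded_lie_algebra.fields_def)

lemma (in lie) h_grade_iff:
  "x \<in> h_grade L h 1 \<longleftrightarrow> x \<in> carrier L \<and> lb h x = x \<oplus>\<^bsub>L\<^esub> x"
  "x \<in> h_grade L h (- 1) \<longleftrightarrow> x \<in> carrier L \<and> lb h x = \<ominus>\<^bsub>L\<^esub> (x \<oplus>\<^bsub>L\<^esub> x)"
  "x \<in> h_grade L h 0 \<longleftrightarrow> x \<in> carrier L \<and> lb h x = \<zero>\<^bsub>L\<^esub>"
  by (auto simp: h_grade_def M.int_multiple_simps)

locale A1 = lie R L for R :: "('k, 'r) ring_scheme" and L :: "('k, 'l) lie_algebra" +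
  fixes h e f
  assumes A1: "is_A1_graded R L h e f"
    and two: "[(2::nat)] \<cdot>\<^bsub>R\<^esub> \<one>\<^bsub>R\<^esub> \<in> Units R" and three: "[(3::nat)] \<cdot>\<^bsub>R\<^esub> \<one>\<^bsub>R\<^esub> \<in> Units R"
begin

lemma sl2 [simp]:
  "h \<in> carrier L" "e \<in> carrier L" "f \<in> carrier L"
  "lb e f = h" "lb h e = e \<oplus>\<^bsub>L\<^esub> e" "lb h f = \<ominus>\<^bsub>L\<^esub> (f \<oplus>\<^bsub>L\<^esub> f)"
  using A1 by (simp_all add: is_A1_graded_def is_sl2_triple_def M.int_multiple_simps)

lemma e_grade: "e \<in> h_grade L h 1" and f_grade: "f \<in> h_grade L h (- 1)"
  by (simp_all add: h_grade_iff)

lemma direct_sum: "is_direct_sum3 R L (h_grade L h (- 1)) (h_grade L h 0) (h_grade L h 1)"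
  using A1 unfolding is_A1_graded_def by blast

lemmas double_cancel = module_double_cancel[OF module_lie two]

text \<open>
  \<open>ad h\<close> has the eigenvalues \<open>-2\<close>, \<open>0\<close>, \<open>2\<close>, so it is annihilated by \<open>x\<^sup>3 - 4 x\<close>.
\<close>

lemma ad_h_cubic:
  assumes z: "z \<in> carrier L"
  shows "lb h (lb h (lb h z)) = (lb h z \<oplus>\<^bsub>L\<^esub> lb h z) \<oplus>\<^bsub>L\<^esub> (lb h z \<oplus>\<^bsub>L\<^esub> lb h z)"
proof -
  obtain p where p: "p \<in> h_grade L h (- 1) \<times> h_grade L h 0 \<times> h_grade L h 1"
    "z = (fst p \<oplus>\<^bsub>L\<^esub> fst (snd p)) \<oplus>\<^bsub>L\<^esub> snd (snd p)"
    using direct_sum z unfolding is_direct_sum3_def by blast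
  then obtain u v w where uvw: "u \<in> h_grade L h (- 1)" "v \<in> h_grade L h 0" "w \<in> h_grade L h 1"
    and z': "z = (u \<oplus>\<^bsub>L\<^esub> v) \<oplus>\<^bsub>L\<^esub> w"
    by auto
  show ?thesis
    unfolding z'
    by (rule M.eq_if_signed) (use uvw in \<open>simp_all add: h_grade_iff lb_simps M.signed_norm\<close>)
qed

text \<open>
  On an eigenvector \<open>z\<close> with eigenvalue \<open>\<plusminus>4\<close> the cubic gives \<open>64 z = 16 z\<close>, and \<open>48\<close> is a unit.
  This is why \<open>[L\<^sub>1, L\<^sub>1] = 0\<close>.
\<close>

lemma weight_four_zero:
  assumes z: "z \<in> carrier L"
    and eq: "lb h z = (z \<oplus>\<^bsub>L\<^esub> z) \<oplus>\<^bsub>L\<^esub> (z \<oplus>\<^bsub>L\<^esub> z) \<or> lb h z = \<ominus>\<^bsub>L\<^esub> ((z \<oplus>\<^bsub>L\<^esub> z) \<oplus>\<^bsub>L\<^esub> (z \<oplus>\<^bsub>L\<^esub> z))"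
  shows "z = \<zero>\<^bsub>L\<^esub>"
proof -
  define d where "d = (\<lambda>x. x \<oplus>\<^bsub>L\<^esub> x)"
  have cl [simp]: "d x \<in> carrier L" if "x \<in> carrier L" for x using that by (simp add: d_def)
  have ad: "lb h (d x) = d (lb h x)" if "x \<in> carrier L" for x
    using that by (simp add: d_def lb_simps)
  have neg: "d (\<ominus>\<^bsub>L\<^esub> x) = \<ominus>\<^bsub>L\<^esub> d x" if "x \<in> carrier L" for x
    using that by (simp add: d_def M.minus_add)
  have inj: "x = y" if "d x = d y" "x \<in> carrier L" "y \<in> carrier L" for x y
    using double_cancel[of x y] that by (simp add: d_def)
  have cubic: "lb h (lb h (lb h z)) = d (d (lb h z))"
    using ad_h_cubic[OF z] by (simp add: d_def)
  have "d (d (d (d (d (d z))))) = d (d (d (d z)))"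
    using eq
  proof
    assume "lb h z = (z \<oplus>\<^bsub>L\<^esub> z) \<oplus>\<^bsub>L\<^esub> (z \<oplus>\<^bsub>L\<^esub> z)"
    then have "lb h z = d (d z)" by (simp add: d_def)
    then show ?thesis using cubic z by (simp add: ad)
  next
    assume "lb h z = \<ominus>\<^bsub>L\<^esub> ((z \<oplus>\<^bsub>L\<^esub> z) \<oplus>\<^bsub>L\<^esub> (z \<oplus>\<^bsub>L\<^esub> z))"
    then have hz: "lb h z = \<ominus>\<^bsub>L\<^esub> d (d z)" by (simp add: d_def)
    have "\<ominus>\<^bsub>L\<^esub> d (d (d (d (d (d z))))) = \<ominus>\<^bsub>L\<^esub> d (d (d (d z)))"
      using cubic z by (simp add: hz ad neg lb_simps)
    then show ?thesis using z M.minus_minus cl by metis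
  qed
  then have "d (d z) = z"
    using z by (intro inj[of "d (d z)" z] inj[of "d (d (d z))" "d z"] inj[of "d (d (d (d z)))" "d (d z)"]
      inj[of "d (d (d (d (d z))))" "d (d (d z))"]) simp_all
  then have four: "(z \<oplus>\<^bsub>L\<^esub> z) \<oplus>\<^bsub>L\<^esub> (z \<oplus>\<^bsub>L\<^esub> z) = z" by (simp add: d_def)
  have "(z \<oplus>\<^bsub>L\<^esub> z) \<oplus>\<^bsub>L\<^esub> z = ((z \<oplus>\<^bsub>L\<^esub> z) \<oplus>\<^bsub>L\<^esub> (z \<oplus>\<^bsub>L\<^esub> z)) \<ominus>\<^bsub>L\<^esub> z"
    by (rule M.eq_if_signed) (use z in \<open>simp_all add: M.signed_norm\<close>)
  also have "\<dots> = \<zero>\<^bsub>L\<^esub>" unfolding four using z by (simp add: M.minus_eq M.r_neg)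
  finally show ?thesis by (rule module_three_torsion[OF module_lie three z])
qed

lemma ad_h_bracket:
  "\<lbrakk>x \<in> carrier L; y \<in> carrier L\<rbrakk> \<Longrightarrow> lb h (lb x y) = lb (lb h x) y \<oplus>\<^bsub>L\<^esub> lb x (lb h y)"
  by (rule M.eq_if_signed) (simp_all add: lb_lb M.signed_norm)

lemma h_grade_bracket:
  assumes "x \<in> h_grade L h i" "y \<in> h_grade L h j" "i \<in> {-1, 0, 1}" "j \<in> {-1, 0, 1}"
  shows "if \<bar>i + j\<bar> \<le> 1 then lb x y \<in> h_grade L h (i + j) else lb x y = \<zero>\<^bsub>L\<^esub>"
proof -
  have xy: "x \<in> carrier L" "y \<in> carrier L" using assms by (auto simp: h_grade_def)
  have outside: "lb x y = \<zero>\<^bsub>L\<^esub>" if "i = j" "i = 1 \<or> i = - 1"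
  proof (rule weight_four_zero)
    show "lb h (lb x y) = (lb x y \<oplus>\<^bsub>L\<^esub> lb x y) \<oplus>\<^bsub>L\<^esub> (lb x y \<oplus>\<^bsub>L\<^esub> lb x y) \<or>
      lb h (lb x y) = \<ominus>\<^bsub>L\<^esub> ((lb x y \<oplus>\<^bsub>L\<^esub> lb x y) \<oplus>\<^bsub>L\<^esub> (lb x y \<oplus>\<^bsub>L\<^esub> lb x y))"
      using that(2)
    proof
      assume "i = 1"
      then show ?thesis
        using that assms(1,2) xy by (simp add: ad_h_bracket h_grade_iff lb_simps)
    next
      assume "i = - 1"
      then show ?thesis
        using that assms(1,2) xy by (simp add: ad_h_bracket h_grade_iff lb_simps M.minus_add)
    qed
  qed (use xy in simp)
  show ?thesis
    using assms(3,4,1,2) xy outside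
    by (elim insertE emptyE) (simp_all add: h_grade_iff ad_h_bracket lb_simps M.l_neg M.r_neg)
qed

abbreviation G where "G \<equiv> h_graded L h"

lemma lie_G: "is_lie_algebra R G"
  by (rule is_lie_algebra_cong[OF lie_algebra]) simp_all

lemma graded_G: "is_3graded R G"
proof -
  have sub: "submodule S R G" if "submodule S R L" for S
    by (rule submodule_cong[OF module_lie that]) simp_all
  have "is_direct_sum3 R G (grade G (- 1)) (grade G 0) (grade G 1)"
    using direct_sum sub by (simp add: is_direct_sum3_def)
  moreover have "bracket G x y \<in> grade G (i + j)" if xy: "x \<in> grade G i" "y \<in> grade G j" for i j x y
  proof -
    have zero: "\<zero>\<^bsub>L\<^esub> \<in> h_grade L h k" if "\<bar>k\<bar> \<le> 1" for k
    proof -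
      have "k = 1 \<or> k = -1 \<or> k = 0" using that by auto
      then show ?thesis by (auto simp: h_grade_iff lb_simps)
    qed
    have car: "x \<in> carrier L" "y \<in> carrier L"
      using xy by (auto simp: h_grade_def split: if_splits)
    show ?thesis
    proof (cases "\<bar>i\<bar> \<le> 1 \<and> \<bar>j\<bar> \<le> 1")
      case True
      then have "i \<in> {-1, 0, 1}" "j \<in> {-1, 0, 1}" by auto
      with True xy show ?thesis
        using h_grade_bracket[of x i y j] by (simp split: if_splits)
    next
      case False
      then have "lb x y = \<zero>\<^bsub>L\<^esub>" using xy car by (auto simp: lb_simps split: if_splits)
      then show ?thesis using zero by simp
    qed
  qed
  ultimately show ?thesis
    using lie_G by (simp add: is_3graded_def)
qed

sublocale G: gla R G by unfold_locales (rule graded_G)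

sublocale jp: jpair_sl2 R "jp_of_gla G" e f
proof
  show "is_jordan_pair R (jp_of_gla G)" by (rule G.jordan_pair_gla)
  show "e \<in> carrier (jpp (jp_of_gla G))" "f \<in> carrier (jpm (jp_of_gla G))"
    using e_grade f_grade by simp_all
  show "trp (jp_of_gla G) e f y = y \<oplus>\<^bsub>jpp (jp_of_gla G)\<^esub> y" if "y \<in> carrier (jpp (jp_of_gla G))" for y
    using that by (simp add: h_grade_iff)
  show "trm (jp_of_gla G) f e z = z \<oplus>\<^bsub>jpm (jp_of_gla G)\<^esub> z" if "z \<in> carrier (jpm (jp_of_gla G))" for z
    using that lb_antisym[of f e] by (simp add: h_grade_iff lb_simps)
qed (rule two three)+

abbreviation Q where "Q \<equiv> ja_of_A1 R (L, h, e, f)"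

lemma ja_of_A1_simps [simp]:
  "carrier Q = h_grade L h 1" "\<zero>\<^bsub>Q\<^esub> = \<zero>\<^bsub>L\<^esub>" "add Q = add L" "smult Q = smult L"
  "monoid.mult Q = (\<lambda>a b. lb (lb a f) b)"
  "monoid.one Q = (inv\<^bsub>R\<^esub> ([(2::nat)] \<cdot>\<^bsub>R\<^esub> \<one>\<^bsub>R\<^esub>)) \<odot>\<^bsub>L\<^esub> e"
  by (simp_all add: ja_of_A1_def restrict_module_def module.truncate_def)

text \<open>
  The identity is \<open>e / 2\<close>; it is mostly used through its double.
\<close>

lemma one_Q: "\<one>\<^bsub>Q\<^esub> \<in> h_grade L h 1" "\<one>\<^bsub>Q\<^esub> \<oplus>\<^bsub>L\<^esub> \<one>\<^bsub>Q\<^esub> = e"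
proof -
  let ?half = "inv\<^bsub>R\<^esub> ([(2::nat)] \<cdot>\<^bsub>R\<^esub> \<one>\<^bsub>R\<^esub>)"
  have half: "?half \<in> carrier R" using two by simp
  show "\<one>\<^bsub>Q\<^esub> \<in> h_grade L h 1"
    using G.submoduleE(4)[OF G.submodule_grade[of 1] half, of e] e_grade by simp
  have "\<one>\<^bsub>Q\<^esub> \<oplus>\<^bsub>L\<^esub> \<one>\<^bsub>Q\<^esub> = (?half \<otimes>\<^bsub>R\<^esub> ([(2::nat)] \<cdot>\<^bsub>R\<^esub> \<one>\<^bsub>R\<^esub>)) \<odot>\<^bsub>L\<^esub> e"
    using half by (simp add: numeral_2_eq_2 R.r_distr smult_l_distr)
  then show "\<one>\<^bsub>Q\<^esub> \<oplus>\<^bsub>L\<^esub> \<one>\<^bsub>Q\<^esub> = e"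
    using two by simp
qed

lemma jordan_algebra_A1: "is_unital_jordan_algebra R Q"
proof -
  have mod: "module R Q"
    by (rule module_cong[OF G.module_grade[of 1]]) simp_all
  have f': "f \<in> carrier jp.M" using f_grade by simp
  have "bilinear_map R Q Q Q (monoid.mult Q)"
    unfolding bilinear_map_def
    using jp.s_linear(1)[OF f'] jp.s_linear(3)[OF _ f'] by (simp add: linear_map_def jp_of_gla_def)
  moreover have "a \<otimes>\<^bsub>Q\<^esub> b = b \<otimes>\<^bsub>Q\<^esub> a" if "a \<in> carrier Q" "b \<in> carrier Q" for a b
    using jp.s_commute[of a f b] f' that by simp
  moreover have "((a \<otimes>\<^bsub>Q\<^esub> a) \<otimes>\<^bsub>Q\<^esub> b) \<otimes>\<^bsub>Q\<^esub> a = (a \<otimes>\<^bsub>Q\<^esub> a) \<otimes>\<^bsub>Q\<^esub> (b \<otimes>\<^bsub>Q\<^esub> a)"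
    if "a \<in> carrier Q" "b \<in> carrier Q" for a b
    using jp.homotope_jordan[OF f', of a b] jp.s_commute[OF _ f', of a b]
      jp.s_commute[OF _ f', of "jp.s (jp.s a f a) f b" a] jp.s_closed[OF _ f'] f' that by simp
  moreover have "\<one>\<^bsub>Q\<^esub> \<otimes>\<^bsub>Q\<^esub> a = a" if "a \<in> carrier Q" for a
  proof (rule double_cancel)
    have a: "a \<in> carrier L" "lb h a = a \<oplus>\<^bsub>L\<^esub> a" using that by (simp_all add: h_grade_iff)
    have one: "\<one>\<^bsub>Q\<^esub> \<in> carrier L" using one_Q(1) by (auto simp: h_grade_def)
    show "\<one>\<^bsub>Q\<^esub> \<otimes>\<^bsub>Q\<^esub> a \<oplus>\<^bsub>L\<^esub> \<one>\<^bsub>Q\<^esub> \<otimes>\<^bsub>Q\<^esub> a = a \<oplus>\<^bsub>L\<^esub> a"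
    proof -
      have "lb (lb \<one>\<^bsub>Q\<^esub> f) a \<oplus>\<^bsub>L\<^esub> lb (lb \<one>\<^bsub>Q\<^esub> f) a = lb (lb (\<one>\<^bsub>Q\<^esub> \<oplus>\<^bsub>L\<^esub> \<one>\<^bsub>Q\<^esub>) f) a"
        using one a(1) by (simp add: lb_simps del: ja_of_A1_simps(6))
      also have "\<dots> = a \<oplus>\<^bsub>L\<^esub> a" unfolding one_Q(2) using a by simp
      finally show ?thesis by simp
    qed
    show "\<one>\<^bsub>Q\<^esub> \<otimes>\<^bsub>Q\<^esub> a \<in> carrier L" using one a(1) by (simp del: ja_of_A1_simps(6))
    show "a \<in> carrier L" by (rule a(1))
  qed
  ultimately show ?thesis
    using mod one_Q(1) unfolding is_unital_jordan_algebra_def by (simp del: ja_of_A1_simps(6)) 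
qed

end

lemma lie_hom_cong:
  assumes "carrier L' = carrier L" "add L' = add L" "smult L' = smult L" "bracket L' = bracket L"
    and "carrier K' = carrier K" "add K' = add K" "smult K' = smult K" "bracket K' = bracket K"
  shows "lie_hom R L' K' = lie_hom R L K"
  using assms by (simp add: lie_hom_def linear_map_def)

lemma A1_hom_graded:
  assumes "is_lie_algebra R L" "is_lie_algebra R K" "h \<in> carrier L"
    and \<alpha>: "\<alpha> \<in> A1_hom R (L, h, e, f) (K, h', e', f')"
  shows "\<alpha> \<in> graded_hom R (h_graded L h) (h_graded K h')" "\<alpha> h = h'" "\<alpha> e = e'" "\<alpha> f = f'"
proof -
  interpret L: lie R L by unfold_locales (rule assms)
  interpret K: lie R K by unfold_locales (rule assms)
  have \<alpha>': "\<alpha> \<in> lie_hom R L K" and h: "\<alpha> h = h'" and "\<alpha> e = e'" "\<alpha> f = f'"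
    using \<alpha> by (auto simp: A1_hom_def)
  then show "\<alpha> h = h'" "\<alpha> e = e'" "\<alpha> f = f'" by auto
  have lin: "linear_map R L K \<alpha>" by (rule lie_hom_linear[OF \<alpha>'])
  have hx: "K.lb h' (\<alpha> x) = \<alpha> (L.lb h x)" if "x \<in> carrier L" for x
    using lie_hom_bracket[OF \<alpha>' assms(3) that] h by simp
  note simps = linear_mapD[OF lin] linear_map_neg[OF L.module_lie K.module_lie lin]
    linear_map_zero[OF L.module_lie K.module_lie lin]
  have "\<alpha> ` grade (h_graded L h) i \<subseteq> grade (h_graded K h') i" for i
  proof -
    consider "i = - 1" | "i = 0" | "i = 1" | "1 < \<bar>i\<bar>" by linarith
    then show ?thesis
      by cases (auto simp: L.h_grade_iff K.h_grade_iff hx simps)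
  qed
  moreover have "\<alpha> \<in> lie_hom R (h_graded L h) (h_graded K h')"
    using \<alpha>' lie_hom_cong[of "h_graded L h" L "h_graded K h'" K R] by simp
  ultimately show "\<alpha> \<in> graded_hom R (h_graded L h) (h_graded K h')"
    by (simp add: graded_hom_def)
qed

lemma A1_homI:
  assumes "\<alpha> \<in> lie_hom R L K" "\<alpha> h = h'" "\<alpha> e = e'" "\<alpha> f = f'"
  shows "\<alpha> \<in> A1_hom R (L, h, e, f) (K, h', e', f')"
  using assms by (simp add: A1_hom_def)

lemma A1_homD:
  assumes "\<alpha> \<in> A1_hom R (L, h, e, f) (K, h', e', f')"
  shows "\<alpha> \<in> lie_hom R L K" "\<alpha> h = h'" "\<alpha> e = e'" "\<alpha> f = f'"
  using assms by (simp_all add: A1_hom_def)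

lemma ja_homD:
  assumes "\<gamma> \<in> ja_hom R J K"
  shows "\<gamma> \<in> extensional (carrier J)" "linear_map R J K \<gamma>"
    "\<lbrakk>a \<in> carrier J; b \<in> carrier J\<rbrakk> \<Longrightarrow> \<gamma> (a \<otimes>\<^bsub>J\<^esub> b) = \<gamma> a \<otimes>\<^bsub>K\<^esub> \<gamma> b" "\<gamma> \<one>\<^bsub>J\<^esub> = \<one>\<^bsub>K\<^esub>"
  using assms by (auto simp: ja_hom_def)

lemma ja_homI:
  assumes "\<gamma> \<in> extensional (carrier J)" "linear_map R J K \<gamma>"
    "\<And>a b. \<lbrakk>a \<in> carrier J; b \<in> carrier J\<rbrakk> \<Longrightarrow> \<gamma> (a \<otimes>\<^bsub>J\<^esub> b) = \<gamma> a \<otimes>\<^bsub>K\<^esub> \<gamma> b" "\<gamma> \<one>\<^bsub>J\<^esub> = \<one>\<^bsub>K\<^esub>"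
  shows "\<gamma> \<in> ja_hom R J K"
  using assms by (auto simp: ja_hom_def)

lemma ja_category:
  assumes "[(2::nat)] \<cdot>\<^bsub>R\<^esub> \<one>\<^bsub>R\<^esub> \<in> Units R"
  shows "is_category (ja_cat R)"
proof (rule concrete_category[where S = carrier])
  fix J K W f g
  assume "J \<in> Ob (ja_cat R)"
  then interpret jordan_algebra R J by unfold_locales (simp_all add: ja_cat_def assms)
  show "(\<lambda>x\<in>carrier J. x) \<in> Hom (ja_cat R) J J"
    by (simp add: ja_cat_def) (rule ja_homI, auto simp: linear_map_def)
  assume "f \<in> Hom (ja_cat R) J K" "g \<in> Hom (ja_cat R) K W"
  then have f: "f \<in> ja_hom R J K" and g: "g \<in> ja_hom R K W" by (simp_all add: ja_cat_def)
  have "compose (carrier J) g f \<in> ja_hom R J W"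
    by (rule ja_homI) (simp_all add: linear_map_compose[OF module_J ja_homD(2)[OF f] ja_homD(2)[OF g]]
      compose_eq ja_homD(3,4)[OF f] ja_homD(3,4)[OF g] linear_map_closed[OF ja_homD(2)[OF f]])
  then show "compose (carrier J) g f \<in> Hom (ja_cat R) J W" by (simp add: ja_cat_def)
qed (auto simp: ja_cat_def dest: ja_homD(1) linear_map_closed[OF ja_homD(2)])

lemma A1_category: "is_category (A1_cat R)"
proof (rule concrete_category[where S = "\<lambda>LS. carrier (fst LS)"])
  fix A assume "A \<in> Ob (A1_cat R)"
  then obtain L h e f where A: "A = (L, h, e, f)" "is_A1_graded R L h e f"
    by (cases A) (auto simp: A1_cat_def)
  then have L: "is_lie_algebra R L" "h \<in> carrier L" "e \<in> carrier L" "f \<in> carrier L"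
    by (auto simp: is_A1_graded_def is_sl2_triple_def)
  show "(\<lambda>x\<in>carrier (fst A). x) \<in> Hom (A1_cat R) A A"
    using lie_hom_id[OF L(1)] L by (simp add: A A1_cat_def A1_hom_def)
  fix B D g k
  assume gk: "g \<in> Hom (A1_cat R) A B" "k \<in> Hom (A1_cat R) B D"
  obtain K h' e' f' where B: "B = (K, h', e', f')" by (cases B)
  obtain W h'' e'' f'' where D: "D = (W, h'', e'', f'')" by (cases D)
  have g: "g \<in> A1_hom R (L, h, e, f) (K, h', e', f')" and k: "k \<in> A1_hom R (K, h', e', f') (W, h'', e'',
      f'')"
    using gk by (simp_all add: A B D A1_cat_def)
  have "compose (carrier L) k g \<in> A1_hom R (L, h, e, f) (W, h'', e'', f'')"
    by (rule A1_homI) (simp_all add: lie_hom_compose[OF L(1) A1_homD(1)[OF g] A1_homD(1)[OF k]]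
      compose_eq L A1_homD(2-4)[OF g] A1_homD(2-4)[OF k])
  then show "compose (carrier (fst A)) k g \<in> Hom (A1_cat R) A D"
    by (simp add: A B D A1_cat_def)
next
  show "f \<in> extensional (carrier (fst A))" "f \<in> carrier (fst A) \<rightarrow> carrier (fst B)"
    if "f \<in> Hom (A1_cat R) A B" for A B f
    using that by (cases A; cases B; auto simp: A1_cat_def dest: A1_homD(1) lie_hom_extensional
        linear_map_closed[OF lie_hom_linear])+
qed (simp_all add: A1_cat_def)

subsection \<open>The \<open>A\<^sub>1\<close>-graded Lie algebra of a Jordan algebra\<close>

lemma lie_algebra_truncate_simps [simp]:
  "carrier (lie_algebra.truncate L) = carrier L" "\<zero>\<^bsub>lie_algebra.truncate L\<^esub> = \<zero>\<^bsub>L\<^esub>"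
  "add (lie_algebra.truncate L) = add L" "smult (lie_algebra.truncate L) = smult L"
  "bracket (lie_algebra.truncate L) = bracket L"
  by (simp_all add: lie_algebra.truncate_def)

context jordan_algebra
begin

lemma jp_of_ja_simps [simp]:
  "carrier (jpm (jp_of_ja J)) = carrier J" "carrier (jpp (jp_of_ja J)) = carrier J"
  "\<zero>\<^bsub>jpm (jp_of_ja J)\<^esub> = \<zero>\<^bsub>J\<^esub>" "\<zero>\<^bsub>jpp (jp_of_ja J)\<^esub> = \<zero>\<^bsub>J\<^esub>"
  "add (jpm (jp_of_ja J)) = add J" "add (jpp (jp_of_ja J)) = add J"
  "smult (jpm (jp_of_ja J)) = smult J" "smult (jpp (jp_of_ja J)) = smult J"
  "trm (jp_of_ja J) = tr" "trp (jp_of_ja J) = tr"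
  by (simp_all add: jp_of_ja_def)

lemma a_inv_jp [simp]:
  "a_inv (jpm (jp_of_ja J)) = a_inv J" "a_inv (jpp (jp_of_ja J)) = a_inv J"
  "a_minus (jpm (jp_of_ja J)) = a_minus J" "a_minus (jpp (jp_of_ja J)) = a_minus J"
  by (rule a_inv_cong; simp)+

lemma jordan_pair_ja: "is_jordan_pair R (jp_of_ja J)"
  unfolding jp_of_ja_def by (rule jordan_pair_jts[OF jordan_triple_system_ja])

sublocale P: jpair R "jp_of_ja J" by unfold_locales (rule jordan_pair_ja)

abbreviation two_J where "two_J \<equiv> \<one>\<^bsub>J\<^esub> \<oplus>\<^bsub>J\<^esub> \<one>\<^bsub>J\<^esub>"
abbreviation LJ where "LJ \<equiv> lie_algebra.truncate P.L"
abbreviation hJ where "hJ \<equiv> (\<zero>\<^bsub>J\<^esub>, \<ominus>\<^bsub>P.I\<^esub> P.ang \<one>\<^bsub>J\<^esub> two_J, \<zero>\<^bsub>J\<^esub>)"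
abbreviation eJ where "eJ \<equiv> (\<zero>\<^bsub>J\<^esub>, \<zero>\<^bsub>P.I\<^esub>, two_J)"
abbreviation fJ where "fJ \<equiv> (\<one>\<^bsub>J\<^esub>, \<zero>\<^bsub>P.I\<^esub>, \<zero>\<^bsub>J\<^esub>)"

lemma tkk_ja_eq: "tkk_ja R J = (LJ, hJ, eJ, fJ)"
  by (simp add: tkk_ja_def Let_def)

lemma two_mu: "a \<in> carrier J \<Longrightarrow> two_J \<bullet> a = a \<oplus>\<^bsub>J\<^esub> a" "a \<in> carrier J \<Longrightarrow> a \<bullet> two_J = a \<oplus>\<^bsub>J\<^esub> a"
  by (simp_all add: mu_simps)

lemma tr_two:
  assumes "a \<in> carrier J"
  shows "tr \<one>\<^bsub>J\<^esub> two_J a = a \<oplus>\<^bsub>J\<^esub> a" "tr two_J \<one>\<^bsub>J\<^esub> a = a \<oplus>\<^bsub>J\<^esub> a"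
  using assms by (simp_all add: tr_one two_mu) (simp add: tr_def mu_simps J.minus_eq J.r_neg J.a_assoc)

text \<open>
  \<open>\<langle>1,2\<rangle>\<close> acts on \<open>\<langle>c,d\<rangle>\<close> by \<open>\<langle>2 c,d\<rangle> - \<langle>c,2 d\<rangle>\<close>.
\<close>

lemma br_h:
  assumes "Z \<in> carrier P.I"
  shows "P.br (\<ominus>\<^bsub>P.I\<^esub> P.ang \<one>\<^bsub>J\<^esub> two_J) Z = \<zero>\<^bsub>P.I\<^esub>"
proof -
  have ang: "P.ang \<one>\<^bsub>J\<^esub> two_J \<in> carrier P.I" using P.ang_closed[of "\<one>\<^bsub>J\<^esub>" two_J] by simp
  have "P.br (P.ang \<one>\<^bsub>J\<^esub> two_J) Z = \<zero>\<^bsub>P.I\<^esub>"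
    using assms
  proof (induction rule: P.inner_induct)
    case (ang c d)
    then have cd: "c \<in> carrier J" "d \<in> carrier J" by simp_all
    have "P.ang (c \<oplus>\<^bsub>J\<^esub> c) d = P.ang c d \<oplus>\<^bsub>P.I\<^esub> P.ang c d" "P.ang c (d \<oplus>\<^bsub>J\<^esub> d) = P.ang c d \<oplus>\<^bsub>P.I\<^esub> P.ang c d"
      "P.ang c (\<ominus>\<^bsub>J\<^esub> (d \<oplus>\<^bsub>J\<^esub> d)) = \<ominus>\<^bsub>P.I\<^esub> P.ang c (d \<oplus>\<^bsub>J\<^esub> d)"
      using linear_map_add[OF P.ang_left, of d c c] linear_map_add[OF P.ang_right, of c d d] cd
        linear_map_neg[OF P.module_N P.module_I P.ang_right, of c "d \<oplus>\<^bsub>J\<^esub> d"] by simp_all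
    then show ?case
      using P.br_ang[of "P.ang \<one>\<^bsub>J\<^esub> two_J" c d] ang cd P.ang_act(1)[of "\<one>\<^bsub>J\<^esub>" two_J c] P.ang_act(2)[of "\<one>\<^bsub>J\<^esub>"
          two_J d]
        P.ang_closed[of c d]
      by (simp add: tr_two P.Im.r_neg)
  next
    case (add Z Y)
    then show ?case using linear_map_add[OF P.br_linear2[OF ang]] by simp
  qed
  then show ?thesis
    using linear_map_neg[OF P.module_I P.module_I P.br_linear1[OF assms] ang] by simp
qed

lemma ad_hJ:
  assumes "a \<in> carrier J" "Z \<in> carrier P.I" "b \<in> carrier J"
  shows "bracket P.L hJ (a, Z, b) = (\<ominus>\<^bsub>J\<^esub> (a \<oplus>\<^bsub>J\<^esub> a), \<zero>\<^bsub>P.I\<^esub>, b \<oplus>\<^bsub>J\<^esub> b)"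
proof -
  have ang: "P.ang \<one>\<^bsub>J\<^esub> two_J \<in> carrier P.I" using P.ang_closed[of "\<one>\<^bsub>J\<^esub>" two_J] by simp
  have "P.am (\<ominus>\<^bsub>P.I\<^esub> P.ang \<one>\<^bsub>J\<^esub> two_J) a = \<ominus>\<^bsub>J\<^esub> (a \<oplus>\<^bsub>J\<^esub> a)"
    using linear_map_neg[OF P.module_I P.module_M P.am_linear1 ang, of a] P.ang_act(1)[of "\<one>\<^bsub>J\<^esub>" two_J a]
        assms
    by (simp add: tr_two)
  moreover have "P.ap (\<ominus>\<^bsub>P.I\<^esub> P.ang \<one>\<^bsub>J\<^esub> two_J) b = b \<oplus>\<^bsub>J\<^esub> b"
    using linear_map_neg[OF P.module_I P.module_N P.ap_linear1 ang, of b] P.ang_act(2)[of "\<one>\<^bsub>J\<^esub>" two_J b]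
        assms
    by (simp add: tr_two)
  moreover have "P.am Z \<zero>\<^bsub>J\<^esub> = \<zero>\<^bsub>J\<^esub>" "P.ap Z \<zero>\<^bsub>J\<^esub> = \<zero>\<^bsub>J\<^esub>"
    using linear_map_zero[OF P.module_M P.module_M P.am_linear2] linear_map_zero[OF P.module_N P.module_N
        P.ap_linear2]
      assms by simp_all
  moreover have "P.ang \<zero>\<^bsub>J\<^esub> b = \<zero>\<^bsub>P.I\<^esub>" "P.ang a \<zero>\<^bsub>J\<^esub> = \<zero>\<^bsub>P.I\<^esub>"
    using linear_map_zero[OF P.module_M P.module_I P.ang_left, of b] linear_map_zero[OF P.module_N
        P.module_I P.ang_right, of a]
      assms by simp_all
  ultimately show ?thesis
    using br_h[OF assms(2)] assms by (simp add: P.tkk_bracket J.minus_eq P.Im.minus_eq)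
qed

lemma hef_closed: "hJ \<in> carrier P.L" "eJ \<in> carrier P.L" "fJ \<in> carrier P.L"
  using P.ang_closed[of "\<one>\<^bsub>J\<^esub>" two_J] by (simp_all add: P.tkk_simps)

lemma lie_LJ: "is_lie_algebra R LJ"
  by (rule is_lie_algebra_cong[OF P.tkk_lie]) simp_all

lemma h_grade_tkk: "h_grade LJ hJ (- 1) = grade P.L (- 1)" "h_grade LJ hJ 0 = grade P.L 0" "h_grade LJ hJ
    1 = grade P.L 1"
proof -
  interpret LJ: lie R LJ by unfold_locales (rule lie_LJ)
  have zJ: "a = \<zero>\<^bsub>J\<^esub>" if "a \<oplus>\<^bsub>J\<^esub> a = \<zero>\<^bsub>J\<^esub>" "a \<in> carrier J" for a using two_torsion that by blast
  have zJ': "a = \<zero>\<^bsub>J\<^esub>" if eq: "\<ominus>\<^bsub>J\<^esub> (a \<oplus>\<^bsub>J\<^esub> a) = a \<oplus>\<^bsub>J\<^esub> a" and a: "a \<in> carrier J" for a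
  proof -
    have "(a \<oplus>\<^bsub>J\<^esub> a) \<oplus>\<^bsub>J\<^esub> (a \<oplus>\<^bsub>J\<^esub> a) = \<ominus>\<^bsub>J\<^esub> (a \<oplus>\<^bsub>J\<^esub> a) \<oplus>\<^bsub>J\<^esub> (a \<oplus>\<^bsub>J\<^esub> a)"
      using eq by simp
    also have "\<dots> = \<zero>\<^bsub>J\<^esub>" using a by (intro J.l_neg) simp
    finally show ?thesis using zJ[of "a \<oplus>\<^bsub>J\<^esub> a"] zJ[of a] a by simp
  qed
  have zI: "Z = \<zero>\<^bsub>P.I\<^esub>" if "\<zero>\<^bsub>P.I\<^esub> = Z \<oplus>\<^bsub>P.I\<^esub> Z" "Z \<in> carrier P.I" for Z
    using module_two_torsion[OF P.module_I two_unit that(2)] that(1) by simp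
  have zI': "Z = \<zero>\<^bsub>P.I\<^esub>" if "\<zero>\<^bsub>P.I\<^esub> = \<ominus>\<^bsub>P.I\<^esub> (Z \<oplus>\<^bsub>P.I\<^esub> Z)" "Z \<in> carrier P.I" for Z
  proof (rule zI)
    have "\<ominus>\<^bsub>P.I\<^esub> \<zero>\<^bsub>P.I\<^esub> = \<ominus>\<^bsub>P.I\<^esub> (\<ominus>\<^bsub>P.I\<^esub> (Z \<oplus>\<^bsub>P.I\<^esub> Z))" using that(1) by simp
    then show "\<zero>\<^bsub>P.I\<^esub> = Z \<oplus>\<^bsub>P.I\<^esub> Z" using that(2) by simp
  qed (rule that)
  have neg: "\<ominus>\<^bsub>P.L\<^esub> (a, Z, b) = (\<ominus>\<^bsub>J\<^esub> a, \<ominus>\<^bsub>P.I\<^esub> Z, \<ominus>\<^bsub>J\<^esub> b)"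
    if "a \<in> carrier J" "Z \<in> carrier P.I" "b \<in> carrier J" for a Z b
    using that by (intro P.L.minus_equality) (simp_all add: P.tkk_simps J.l_neg P.Im.l_neg)
  have neg': "\<ominus>\<^bsub>LJ\<^esub> x = \<ominus>\<^bsub>P.L\<^esub> x" for x
    by (rule fun_cong[OF a_inv_cong(1)]) simp_all
  have iffJ: "\<ominus>\<^bsub>J\<^esub> (a \<oplus>\<^bsub>J\<^esub> a) = a \<oplus>\<^bsub>J\<^esub> a \<longleftrightarrow> a = \<zero>\<^bsub>J\<^esub>" "a \<oplus>\<^bsub>J\<^esub> a = \<ominus>\<^bsub>J\<^esub> (a \<oplus>\<^bsub>J\<^esub> a) \<longleftrightarrow> a = \<zero>\<^bsub>J\<^esub>"
    "a \<oplus>\<^bsub>J\<^esub> a = \<zero>\<^bsub>J\<^esub> \<longleftrightarrow> a = \<zero>\<^bsub>J\<^esub>" "\<ominus>\<^bsub>J\<^esub> (a \<oplus>\<^bsub>J\<^esub> a) = \<zero>\<^bsub>J\<^esub> \<longleftrightarrow> a = \<zero>\<^bsub>J\<^esub>" if "a \<in> carrier J" for a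
  proof -
    have "a = \<zero>\<^bsub>J\<^esub>" if "\<ominus>\<^bsub>J\<^esub> (a \<oplus>\<^bsub>J\<^esub> a) = \<zero>\<^bsub>J\<^esub>"
    proof (rule zJ[OF _ \<open>a \<in> carrier J\<close>])
      have "a \<oplus>\<^bsub>J\<^esub> a = \<ominus>\<^bsub>J\<^esub> (\<ominus>\<^bsub>J\<^esub> (a \<oplus>\<^bsub>J\<^esub> a))" using \<open>a \<in> carrier J\<close> by simp
      then show "a \<oplus>\<^bsub>J\<^esub> a = \<zero>\<^bsub>J\<^esub>" unfolding that by simp
    qed
    then show "\<ominus>\<^bsub>J\<^esub> (a \<oplus>\<^bsub>J\<^esub> a) = \<zero>\<^bsub>J\<^esub> \<longleftrightarrow> a = \<zero>\<^bsub>J\<^esub>" by (rule iffI) simp_all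
    show "\<ominus>\<^bsub>J\<^esub> (a \<oplus>\<^bsub>J\<^esub> a) = a \<oplus>\<^bsub>J\<^esub> a \<longleftrightarrow> a = \<zero>\<^bsub>J\<^esub>"
      by (rule iffI, erule zJ'[OF _ that], simp)
    show "a \<oplus>\<^bsub>J\<^esub> a = \<ominus>\<^bsub>J\<^esub> (a \<oplus>\<^bsub>J\<^esub> a) \<longleftrightarrow> a = \<zero>\<^bsub>J\<^esub>"
      by (rule iffI, drule sym, erule zJ'[OF _ that], simp)
    show "a \<oplus>\<^bsub>J\<^esub> a = \<zero>\<^bsub>J\<^esub> \<longleftrightarrow> a = \<zero>\<^bsub>J\<^esub>"
      by (rule iffI, erule zJ[OF _ that], simp)
  qed
  have iffI: "\<zero>\<^bsub>P.I\<^esub> = Z \<oplus>\<^bsub>P.I\<^esub> Z \<longleftrightarrow> Z = \<zero>\<^bsub>P.I\<^esub>" "\<zero>\<^bsub>P.I\<^esub> = \<ominus>\<^bsub>P.I\<^esub> (Z \<oplus>\<^bsub>P.I\<^esub> Z) \<longleftrightarrow> Z = \<zero>\<^bsub>P.I\<^esub>"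
    if "Z \<in> carrier P.I" for Z
    by (rule iffI, erule zI[OF _ that], simp, rule iffI, erule zI'[OF _ that], simp)
  have mem: "(a, Z, b) \<in> carrier P.L \<longleftrightarrow> a \<in> carrier J \<and> Z \<in> carrier P.I \<and> b \<in> carrier J" for a Z b
    by (simp add: P.tkk_simps)
  have "x \<in> h_grade LJ hJ (- 1) \<longleftrightarrow> x \<in> grade P.L (- 1)" "x \<in> h_grade LJ hJ 0 \<longleftrightarrow> x \<in> grade P.L 0"
    "x \<in> h_grade LJ hJ 1 \<longleftrightarrow> x \<in> grade P.L 1" for x
  proof -
    obtain a Z b where x: "x = (a, Z, b)" by (cases x)
    show "x \<in> h_grade LJ hJ (- 1) \<longleftrightarrow> x \<in> grade P.L (- 1)" "x \<in> h_grade LJ hJ 0 \<longleftrightarrow> x \<in> grade P.L 0"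
      "x \<in> h_grade LJ hJ 1 \<longleftrightarrow> x \<in> grade P.L 1"
      unfolding LJ.h_grade_iff x neg' lie_algebra_truncate_simps mem
      by (cases "a \<in> carrier J \<and> Z \<in> carrier P.I \<and> b \<in> carrier J";
          auto simp: P.tkk_grade P.tkk_simps(2,3) ad_hJ neg iffJ iffI)+
  qed
  then show "h_grade LJ hJ (- 1) = grade P.L (- 1)" "h_grade LJ hJ 0 = grade P.L 0" "h_grade LJ hJ 1 =
      grade P.L 1"
    by blast+
qed

text \<open>
  So \<open>A\<^sub>1\<close>-graded morphisms out of \<open>TKK(J)\<close> are graded homomorphisms, to which the universal
  property applies.
\<close>

lemma h_graded_tkk: "h_graded LJ hJ = P.L"
proof -
  have "grade (h_graded LJ hJ) i = grade P.L i" for i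
  proof -
    consider "i = - 1" | "i = 0" | "i = 1" | "1 < \<bar>i\<bar>" by linarith
    then show ?thesis
      by cases (simp_all add: h_grade_tkk P.tkk_grade(4))
  qed
  then have "grade (h_graded LJ hJ) = grade P.L" by (simp add: fun_eq_iff)
  then show ?thesis
    by (simp add: h_graded_def lie_algebra.extend_def lie_algebra.truncate_def
        graded_lie_algebra.fields_def)
qed

text \<open>
  Degree 0 of \<open>TKK(J)\<close> is spanned by the elements \<open>\<langle>a,b\<rangle> = [a,b]\<close>.
\<close>

lemma tkk_ja_A1: "is_A1_graded R LJ hJ eJ fJ"
proof -
  interpret LJ: lie R LJ by unfold_locales (rule lie_LJ)
  have sub: "submodule S R LJ" if "submodule S R P.L" for S
    by (rule submodule_cong[OF P.module_L that]) simp_all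
  have "is_sl2_triple LJ hJ eJ fJ"
    using hef_closed P.inp_inm_bracket[of "\<one>\<^bsub>J\<^esub>" two_J] h_grade_tkk
    unfolding is_sl2_triple_def
    by (auto simp: h_grade_def P.tkk_grade)
  moreover have "is_direct_sum3 R LJ (h_grade LJ hJ (- 1)) (h_grade LJ hJ 0) (h_grade LJ hJ 1)"
    using P.tkk_3graded sub unfolding h_grade_tkk by (simp add: is_3graded_def is_direct_sum3_def)
  moreover have "h_grade LJ hJ 0 =
    module_span R LJ {bracket LJ x y | x y. x \<in> h_grade LJ hJ (- 1) \<and> y \<in> h_grade LJ hJ 1}" (is "_ =
        module_span R LJ ?S")
  proof
    interpret G: gla R P.L by unfold_locales (rule P.tkk_3graded)
    have S0: "?S \<subseteq> grade P.L 0"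
      using G.grade_bracket[of _ "- 1" _ 1] unfolding h_grade_tkk by auto
    show "module_span R LJ ?S \<subseteq> h_grade LJ hJ 0"
      unfolding h_grade_tkk(2) by (rule module_span_minimal[OF sub[OF G.submodule_grade] S0])
    have span: "submodule (module_span R LJ ?S) R LJ"
      using subset_trans[OF S0 G.grade_subset] by (intro module_span_submodule[OF LJ.module_lie]) simp
    have "(\<zero>\<^bsub>J\<^esub>, Z, \<zero>\<^bsub>J\<^esub>) \<in> module_span R LJ ?S" if "Z \<in> carrier P.I" for Z
      using that
    proof (induction rule: P.inner_induct)
      case (ang a b)
      then have "(\<zero>\<^bsub>J\<^esub>, P.ang a b, \<zero>\<^bsub>J\<^esub>) = bracket LJ (P.inm a) (P.inp b)"
        using P.inm_inp_bracket[of a b] by simp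
      moreover have "P.inm a \<in> h_grade LJ hJ (- 1)" "P.inp b \<in> h_grade LJ hJ 1"
        unfolding h_grade_tkk using ang P.inm_inp_closed(3,4) by blast+
      ultimately show ?case
        using module_span_incl[of ?S R LJ] by blast
    next
      case (add Z Y)
      then have "(\<zero>\<^bsub>J\<^esub>, Z, \<zero>\<^bsub>J\<^esub>) \<oplus>\<^bsub>LJ\<^esub> (\<zero>\<^bsub>J\<^esub>, Y, \<zero>\<^bsub>J\<^esub>) \<in> module_span R LJ ?S"
        by (intro LJ.submoduleE(5)[OF span])
      then show ?case by (simp add: P.tkk_simps)
    qed
    then show "h_grade LJ hJ 0 \<subseteq> module_span R LJ ?S"
      unfolding h_grade_tkk(2) by (auto simp: P.tkk_grade)
  qed
  ultimately show ?thesis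
    using lie_LJ unfolding is_A1_graded_def by blast
qed

end

subsection \<open>The functors\<close>

lemma ja_hom_tr:
  assumes J: "jordan_algebra R J" and K: "jordan_algebra R K" and \<gamma>: "\<gamma> \<in> ja_hom R J K"
    and "a \<in> carrier J" "b \<in> carrier J" "c \<in> carrier J"
  shows "\<gamma> (jordan_algebra.tr J a b c) = jordan_algebra.tr K (\<gamma> a) (\<gamma> b) (\<gamma> c)"
proof -
  interpret J: jordan_algebra R J by (rule J)
  interpret K: jordan_algebra R K by (rule K)
  note lin = ja_homD(2)[OF \<gamma>]
  show ?thesis
    using assms(4-6)
    by (simp add: J.tr_def K.tr_def linear_map_minus[OF J.module_J K.module_J lin] linear_map_add[OF lin]
        ja_homD(3)[OF \<gamma>])
qed

lemma ja_hom_jp_hom: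
  assumes J: "jordan_algebra R J" and K: "jordan_algebra R K" and \<gamma>: "\<gamma> \<in> ja_hom R J K"
  shows "(\<gamma>, \<gamma>) \<in> jp_hom R (jp_of_ja J) (jp_of_ja K)"
proof -
  interpret J: jordan_algebra R J by (rule J)
  interpret K: jordan_algebra R K by (rule K)
  show ?thesis
    by (rule jp_homI) (use ja_homD(1,2)[OF \<gamma>] ja_hom_tr[OF J K \<gamma>] in \<open>simp_all add: linear_map_def\<close>)
qed

lemma tkk_ja_map_hom:
  assumes J: "jordan_algebra R J" and K: "jordan_algebra R K" and \<gamma>: "\<gamma> \<in> ja_hom R J K"
  shows "tkk_ja_map R J K \<gamma> \<in> A1_hom R (tkk_ja R J) (tkk_ja R K)"
proof -
  interpret J: jordan_algebra R J by (rule J)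
  interpret K: jordan_algebra R K by (rule K)
  interpret jpair_hom R "jp_of_ja J" "jp_of_ja K" "(\<gamma>, \<gamma>)"
    by unfold_locales (rule ja_hom_jp_hom[OF J K \<gamma>])
  let ?\<alpha> = "tkk_map R (jp_of_ja J) (jp_of_ja K) (\<gamma>, \<gamma>)"
  note \<alpha> = graded_hom_lie_hom[OF tkk_map_hom]
  have e: "?\<alpha> J.eJ = K.eJ"
    using tkk_map_inp[of J.two_J] linear_map_add[OF ja_homD(2)[OF \<gamma>], of "\<one>\<^bsub>J\<^esub>" "\<one>\<^bsub>J\<^esub>"] ja_homD(4)[OF \<gamma>] by
        simp
  have f: "?\<alpha> J.fJ = K.fJ"
    using tkk_map_inm[of "\<one>\<^bsub>J\<^esub>"] ja_homD(4)[OF \<gamma>] by simp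
  have "?\<alpha> J.hJ = bracket K.P.L (?\<alpha> J.eJ) (?\<alpha> J.fJ)"
    using lie_hom_bracket[OF \<alpha> J.hef_closed(2,3)] J.P.inp_inm_bracket[of "\<one>\<^bsub>J\<^esub>" J.two_J] by simp
  also have "\<dots> = K.hJ"
    unfolding e f using K.P.inp_inm_bracket[of "\<one>\<^bsub>K\<^esub>" K.two_J] by simp
  finally have h: "?\<alpha> J.hJ = K.hJ" .
  have "?\<alpha> \<in> lie_hom R J.LJ K.LJ"
    using \<alpha> lie_hom_cong[of J.LJ J.P.L K.LJ K.P.L R] by simp
  from A1_homI[OF this h e f] show ?thesis
    by (simp add: tkk_ja_map_def J.tkk_ja_eq K.tkk_ja_eq)
qed

context
  fixes R :: "('k, 'r) ring_scheme"
  assumes two: "[(2::nat)] \<cdot>\<^bsub>R\<^esub> \<one>\<^bsub>R\<^esub> \<in> Units R" and three: "[(3::nat)] \<cdot>\<^bsub>R\<^esub> \<one>\<^bsub>R\<^esub> \<in> Units R"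
begin

lemma jordan_algebra_iff: "jordan_algebra R J \<longleftrightarrow> J \<in> Ob (ja_cat R)"
  using two by (simp add: jordan_algebra_def ja_cat_def)

lemma A1_iff: "A1 R L h e f \<longleftrightarrow> (L, h, e, f) \<in> Ob (A1_cat R)"
  using two three by (auto simp: A1_def A1_axioms_def A1_cat_def lie_def is_A1_graded_def)

lemma tkk_ja_functor: "is_functor (ja_cat R) (A1_cat R) (tkk_ja R) (tkk_ja_map R)"
  unfolding is_functor_def
proof (intro conjI ballI ja_category[OF two] A1_category)
  fix J assume "J \<in> Ob (ja_cat R)"
  then have J: "jordan_algebra R J" by (simp add: jordan_algebra_iff)
  then interpret J: jordan_algebra R J .
  show "tkk_ja R J \<in> Ob (A1_cat R)"
    using J.tkk_ja_A1 by (simp add: J.tkk_ja_eq A1_cat_def)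
  show "tkk_ja_map R J J (Idn (ja_cat R) J) = Idn (A1_cat R) (tkk_ja R J)"
    using tkk_map_id[OF J.jordan_pair_ja] by (simp add: tkk_ja_map_def J.tkk_ja_eq ja_cat_def A1_cat_def)
  fix K f assume "K \<in> Ob (ja_cat R)" and "f \<in> Hom (ja_cat R) J K"
  then have K: "jordan_algebra R K" and f: "f \<in> ja_hom R J K"
    by (simp_all add: jordan_algebra_iff) (simp add: ja_cat_def)
  interpret K: jordan_algebra R K by (rule K)
  show "tkk_ja_map R J K f \<in> Hom (A1_cat R) (tkk_ja R J) (tkk_ja R K)"
    using tkk_ja_map_hom[OF J K f] by (simp add: A1_cat_def)
  fix W g assume "W \<in> Ob (ja_cat R)" and "g \<in> Hom (ja_cat R) K W"
  then have W: "jordan_algebra R W" and g: "g \<in> ja_hom R K W"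
    by (simp_all add: jordan_algebra_iff) (simp add: ja_cat_def)
  interpret W: jordan_algebra R W by (rule W)
  show "tkk_ja_map R J W (Cmp (ja_cat R) J g f) =
      Cmp (A1_cat R) (tkk_ja R J) (tkk_ja_map R K W g) (tkk_ja_map R J K f)"
    using tkk_map_comp[OF J.jordan_pair_ja K.jordan_pair_ja W.jordan_pair_ja ja_hom_jp_hom[OF J K f]
        ja_hom_jp_hom[OF K W g]]
    by (simp add: tkk_ja_map_def J.tkk_ja_eq ja_cat_def A1_cat_def jp_comp_def)
qed

lemma ja_of_A1_map_hom:
  assumes L: "A1 R L h e f" and K: "A1 R K h' e' f'" and \<alpha>: "\<alpha> \<in> A1_hom R (L, h, e, f) (K, h', e', f')"
  shows "ja_of_A1_map (L, h, e, f) (K, h', e', f') \<alpha> \<in> ja_hom R (ja_of_A1 R (L, h, e, f)) (ja_of_A1 R (K,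
      h', e', f'))"
proof -
  interpret L: A1 R L h e f by (rule L)
  interpret K: A1 R K h' e' f' by (rule K)
  note \<alpha>' = A1_homD(1)[OF \<alpha>] 
  note gr = A1_hom_graded(1)[OF L.lie_algebra K.lie_algebra L.sl2(1) \<alpha>]
  note lin = lie_hom_linear[OF \<alpha>']
  have grade: "\<alpha> x \<in> h_grade K h' 1" if "x \<in> h_grade L h 1" for x
    using graded_hom_grade[OF gr, of x 1] that by simp
  have L1: "x \<in> carrier L" if "x \<in> h_grade L h 1" for x using that by (simp add: h_grade_def)
  have closed: "L.lb (L.lb a f) b \<in> h_grade L h 1" if "a \<in> h_grade L h 1" "b \<in> h_grade L h 1" for a b
    using L.G.grade_triple[of a 1 f b] L.f_grade that by simp
  have "restrict \<alpha> (h_grade L h 1) \<in> ja_hom R L.Q K.Q"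
  proof (rule ja_homI)
    show "linear_map R L.Q K.Q (restrict \<alpha> (h_grade L h 1))"
      using jp_homD(4)[OF jp_of_gla_map_hom[OF L.graded_G K.graded_G gr]]
      by (simp add: jp_of_gla_map_def linear_map_def)
    show "restrict \<alpha> (h_grade L h 1) (a \<otimes>\<^bsub>L.Q\<^esub> b) =
        restrict \<alpha> (h_grade L h 1) a \<otimes>\<^bsub>K.Q\<^esub> restrict \<alpha> (h_grade L h 1) b"
      if "a \<in> carrier L.Q" "b \<in> carrier L.Q" for a b
      using that closed L1 by (simp add: lie_hom_bracket[OF \<alpha>'] A1_homD(4)[OF \<alpha>])
    have "\<alpha> \<one>\<^bsub>L.Q\<^esub> = \<one>\<^bsub>K.Q\<^esub>"
      using two by (simp add: linear_map_smult[OF lin] A1_homD(3)[OF \<alpha>])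
    then show "restrict \<alpha> (h_grade L h 1) \<one>\<^bsub>L.Q\<^esub> = \<one>\<^bsub>K.Q\<^esub>"
      using L.one_Q(1) by (simp del: L.ja_of_A1_simps(6) K.ja_of_A1_simps(6))
  qed simp
  then show ?thesis by (simp add: ja_of_A1_map_def)
qed

lemma ja_of_A1_functor: "is_functor (A1_cat R) (ja_cat R) (ja_of_A1 R) ja_of_A1_map"
  unfolding is_functor_def
proof (intro conjI ballI ja_category[OF two] A1_category)
  fix A assume "A \<in> Ob (A1_cat R)"
  then obtain L h e f where A: "A = (L, h, e, f)" "A1 R L h e f"
    by (cases A) (auto simp: A1_iff)
  interpret L: A1 R L h e f by (rule A)
  show "ja_of_A1 R A \<in> Ob (ja_cat R)"
    using L.jordan_algebra_A1 by (simp add: A ja_cat_def)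
  show "ja_of_A1_map A A (Idn (A1_cat R) A) = Idn (ja_cat R) (ja_of_A1 R A)"
    by (auto simp: A ja_cat_def A1_cat_def ja_of_A1_map_def fun_eq_iff restrict_def h_grade_def)
  fix B \<alpha> assume "B \<in> Ob (A1_cat R)" and \<alpha>: "\<alpha> \<in> Hom (A1_cat R) A B"
  then obtain K h' e' f' where B: "B = (K, h', e', f')" "A1 R K h' e' f'"
    by (cases B) (auto simp: A1_iff)
  interpret K: A1 R K h' e' f' by (rule B)
  have \<alpha>': "\<alpha> \<in> A1_hom R (L, h, e, f) (K, h', e', f')" using \<alpha> by (simp add: A B A1_cat_def)
  show "ja_of_A1_map A B \<alpha> \<in> Hom (ja_cat R) (ja_of_A1 R A) (ja_of_A1 R B)"
    using ja_of_A1_map_hom[OF A(2) B(2) \<alpha>'] by (simp add: A B ja_cat_def)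
  fix D g
  show "ja_of_A1_map A D (Cmp (A1_cat R) A g \<alpha>) =
      Cmp (ja_cat R) (ja_of_A1 R A) (ja_of_A1_map B D g) (ja_of_A1_map A B \<alpha>)"
    using graded_hom_grade[OF A1_hom_graded(1)[OF L.lie_algebra K.lie_algebra L.sl2(1) \<alpha>'], of _ 1]
    by (auto simp: A B ja_cat_def A1_cat_def ja_of_A1_map_def compose_def fun_eq_iff restrict_def
        h_grade_def)
qed

text \<open>
  Let \<open>\<alpha>\<close> be a morphism from \<open>TKK(J)\<close> and \<open>\<gamma>\<close> its part of degree \<open>1\<close>. Since \<open>\<alpha>\<close> maps \<open>1\<^sub>-\<close> to \<open>f\<close>,
  the part of degree \<open>-1\<close> is \<open>a \<mapsto> [[f, \<gamma> a], f] = \<psi> (\<gamma> a)\<close>, and \<open>\<gamma>\<close> is multiplicative because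
  \<open>a b = {a,1,b}\<close>. Conversely, for a homomorphism \<open>\<gamma>\<close> of Jordan algebras \<open>(\<psi> \<gamma>, \<gamma>)\<close> is one of
  Jordan pairs.
\<close>

lemma tkk_ja_bij:
  assumes J: "jordan_algebra R J" and K: "A1 R K h e f"
  shows "bij_betw (\<lambda>\<alpha>. snd (tkk_restrict R (jp_of_ja J) \<alpha>))
    (A1_hom R (tkk_ja R J) (K, h, e, f)) (ja_hom R J (ja_of_A1 R (K, h, e, f)))"
proof -
  interpret J: jordan_algebra R J by (rule J)
  interpret K: A1 R K h e f by (rule K)
  interpret Q: jordan_algebra R K.Q
    using K.jordan_algebra_A1 two by unfold_locales
  let ?res = "tkk_restrict R (jp_of_ja J)"
  have gr: "\<alpha> \<in> graded_hom R J.P.L K.G" and hef: "\<alpha> J.hJ = h" "\<alpha> J.eJ = e" "\<alpha> J.fJ = f"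
    if "\<alpha> \<in> A1_hom R (tkk_ja R J) (K, h, e, f)" for \<alpha>
    using A1_hom_graded[OF J.lie_LJ K.lie_algebra _ that[unfolded J.tkk_ja_eq]] J.hef_closed(1)
    by (simp_all add: J.h_graded_tkk)
  have fst_res: "fst (?res \<alpha>) a = K.lb (K.lb f (snd (?res \<alpha>) a)) f"
    if \<alpha>: "\<alpha> \<in> A1_hom R (tkk_ja R J) (K, h, e, f)" and a: "a \<in> carrier J" for \<alpha> a
  proof -
    have "fst (?res \<alpha>) \<one>\<^bsub>J\<^esub> = f" using hef(3)[OF \<alpha>] by (simp add: tkk_restrict_def)
    then show ?thesis
      using jp_homD(5)[OF J.P.tkk_restrict_hom[OF K.graded_G gr[OF \<alpha>]], of "\<one>\<^bsub>J\<^esub>" a "\<one>\<^bsub>J\<^esub>"] a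
      by (simp add: J.one_tr_one)
  qed
  show ?thesis
    unfolding bij_betw_def
  proof (intro conjI inj_onI equalityI subsetI)
    fix \<alpha> \<beta> assume \<alpha>: "\<alpha> \<in> A1_hom R (tkk_ja R J) (K, h, e, f)" and \<beta>: "\<beta> \<in> A1_hom R (tkk_ja R J) (K, h,
        e, f)"
      and eq: "snd (?res \<alpha>) = snd (?res \<beta>)"
    have "fst (?res \<alpha>) = fst (?res \<beta>)"
    proof (rule extensionalityI[of _ "carrier J"])
      show "fst (?res \<alpha>) a = fst (?res \<beta>) a" if "a \<in> carrier J" for a
        using that by (simp add: fst_res[OF \<alpha>] fst_res[OF \<beta>] eq)
    qed (simp_all add: tkk_restrict_def)
    with eq show "\<alpha> = \<beta>"
      by (intro J.P.graded_hom_tkk_eqI[OF gr[OF \<alpha>] gr[OF \<beta>]]) (simp add: prod_eq_iff)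
  next
    fix \<gamma> assume "\<gamma> \<in> (\<lambda>\<alpha>. snd (?res \<alpha>)) ` A1_hom R (tkk_ja R J) (K, h, e, f)"
    then obtain \<alpha> where \<alpha>: "\<alpha> \<in> A1_hom R (tkk_ja R J) (K, h, e, f)" and \<gamma>: "\<gamma> = snd (?res \<alpha>)" by blast
    note \<delta> = J.P.tkk_restrict_hom[OF K.graded_G gr[OF \<alpha>]]
    have f: "fst (?res \<alpha>) \<one>\<^bsub>J\<^esub> = f" using hef(3)[OF \<alpha>] by (simp add: tkk_restrict_def)
    have lin: "linear_map R J K.Q \<gamma>"
      using jp_homD(4)[OF \<delta>] by (simp add: \<gamma> linear_map_def)
    show "\<gamma> \<in> ja_hom R J K.Q"
    proof (rule ja_homI[OF _ lin])
      show "\<gamma> \<in> extensional (carrier J)" by (simp add: \<gamma> tkk_restrict_def)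
      show "\<gamma> (a \<otimes>\<^bsub>J\<^esub> b) = \<gamma> a \<otimes>\<^bsub>K.Q\<^esub> \<gamma> b" if "a \<in> carrier J" "b \<in> carrier J" for a b
        using that jp_homD(6)[OF \<delta>, of a "\<one>\<^bsub>J\<^esub>" b] by (simp add: J.tr_one f \<gamma>)
      have "\<gamma> J.two_J = e" using hef(2)[OF \<alpha>] by (simp add: \<gamma> tkk_restrict_def)
      then have "\<gamma> \<one>\<^bsub>J\<^esub> \<oplus>\<^bsub>K.Q\<^esub> \<gamma> \<one>\<^bsub>J\<^esub> = \<one>\<^bsub>K.Q\<^esub> \<oplus>\<^bsub>K.Q\<^esub> \<one>\<^bsub>K.Q\<^esub>"
        using linear_map_add[OF lin, of "\<one>\<^bsub>J\<^esub>" "\<one>\<^bsub>J\<^esub>"] K.one_Q(2) by (simp del: K.ja_of_A1_simps(6))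
      then show "\<gamma> \<one>\<^bsub>J\<^esub> = \<one>\<^bsub>K.Q\<^esub>"
        by (rule module_double_cancel[OF Q.module_J two, rotated 2])
          (use linear_map_closed[OF lin, of "\<one>\<^bsub>J\<^esub>"] Q.one_closed in simp_all)
    qed
  next
    fix \<gamma> assume \<gamma>: "\<gamma> \<in> ja_hom R J K.Q"
    have lin: "linear_map R J K.jp.N \<gamma>"
      using ja_homD(2)[OF \<gamma>] by (simp add: linear_map_def)
    note cl = linear_map_closed[OF lin]
    have tr: "\<gamma> (J.tr a b c) = K.jp.htr (\<gamma> a) (\<gamma> b) (\<gamma> c)" if "a \<in> carrier J" "b \<in> carrier J" "c \<in>
        carrier J" for a b c
    proof -
      have minus: "x \<ominus>\<^bsub>K.Q\<^esub> y = x \<ominus>\<^bsub>K.jp.N\<^esub> y" for x y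
        using a_inv_cong(2)[of K.Q K.jp.N] by simp
      show ?thesis
        using ja_hom_tr[OF J Q.jordan_algebra_axioms \<gamma> that] minus by (simp add: Q.tr_def K.jp.htr_def)
    qed
    let ?\<delta> = "\<lambda>a\<in>carrier J. K.jp.\<psi> (\<gamma> a)"
    have hom: "(?\<delta>, \<gamma>) \<in> jp_hom R (jp_of_ja J) (jp_of_gla K.G)"
    proof (rule jp_homI)
      show "linear_map R (jpm (jp_of_ja J)) K.jp.M ?\<delta>"
        using linear_map_restrict[OF J.module_J linear_map_comp[OF lin K.jp.\<psi>_linear]]
          by (simp add: linear_map_def)
      show "linear_map R (jpp (jp_of_ja J)) K.jp.N \<gamma>"
        using lin by (simp add: linear_map_def)
      show "\<gamma> \<in> extensional (carrier (jpp (jp_of_ja J)))" using ja_homD(1)[OF \<gamma>] by simp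
      show "?\<delta> (J.P.t a b c) = K.jp.t (?\<delta> a) (\<gamma> b) (?\<delta> c)"
        if "a \<in> carrier J.P.M" "b \<in> carrier J.P.N" "c \<in> carrier J.P.M" for a b c
        using that K.jp.htr_t[of "\<gamma> a" "\<gamma> b" "\<gamma> c"] cl J.tr_closed tr[of a b c] by simp
      show "\<gamma> (J.P.s b a d) = K.jp.s (\<gamma> b) (?\<delta> a) (\<gamma> d)"
        if "b \<in> carrier J.P.N" "a \<in> carrier J.P.M" "d \<in> carrier J.P.N" for a b d
        using that K.jp.htr_s[of "\<gamma> b" "\<gamma> a" "\<gamma> d"] cl tr[of b a d] by simp
    qed simp
    interpret lift: tkk_lift R "jp_of_ja J" K.G ?\<delta> \<gamma>
      by (intro tkk_lift.intro J.P.jpair_axioms gla.intro K.graded_G tkk_lift_axioms.intro hom)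
    have one: "\<gamma> \<one>\<^bsub>J\<^esub> = \<one>\<^bsub>K.Q\<^esub>" by (rule ja_homD(4)[OF \<gamma>])
    have \<gamma>two: "\<gamma> J.two_J = e"
      using linear_map_add[OF lin, of "\<one>\<^bsub>J\<^esub>" "\<one>\<^bsub>J\<^esub>"] K.one_Q(2) by (simp add: one del: K.ja_of_A1_simps(6))
    have \<psi>one: "K.jp.\<psi> (\<gamma> \<one>\<^bsub>J\<^esub>) = f"
    proof (rule module_double_cancel[OF K.jp.module_M two])
      have "K.jp.\<psi> e = f \<oplus>\<^bsub>K.jp.M\<^esub> f"
        using K.jp.tfe[OF K.jp.f] by (simp add: K.jp.\<psi>_def)
      then show "K.jp.\<psi> (\<gamma> \<one>\<^bsub>J\<^esub>) \<oplus>\<^bsub>K.jp.M\<^esub> K.jp.\<psi> (\<gamma> \<one>\<^bsub>J\<^esub>) = f \<oplus>\<^bsub>K.jp.M\<^esub> f"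
        using linear_map_add[OF linear_map_comp[OF lin K.jp.\<psi>_linear], of "\<one>\<^bsub>J\<^esub>" "\<one>\<^bsub>J\<^esub>"] \<gamma>two by simp
    qed (use cl[of "\<one>\<^bsub>J\<^esub>"] K.jp.\<psi>_closed[of "\<gamma> \<one>\<^bsub>J\<^esub>"] K.jp.f in simp_all)
    have e: "lift.lift J.eJ = e" using lift.lift_inp[of J.two_J] \<gamma>two by simp
    have f: "lift.lift J.fJ = f" using lift.lift_inm[of "\<one>\<^bsub>J\<^esub>"] \<psi>one by simp
    have lift_hom: "lift.lift \<in> lie_hom R J.P.L K.G"
      by (rule graded_hom_lie_hom[OF lift.lift_graded_hom])
    have "lift.lift J.hJ = K.lb (lift.lift J.eJ) (lift.lift J.fJ)"
      using lie_hom_bracket[OF lift_hom J.hef_closed(2,3)] J.P.inp_inm_bracket[of "\<one>\<^bsub>J\<^esub>" J.two_J] by simp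
    then have h: "lift.lift J.hJ = h" by (simp add: e f)
    have "lift.lift \<in> A1_hom R (tkk_ja R J) (K, h, e, f)"
      unfolding J.tkk_ja_eq using lift_hom lie_hom_cong[of J.LJ J.P.L K K.G R]
      by (intro A1_homI h e f) simp
    then show "\<gamma> \<in> (\<lambda>\<alpha>. snd (?res \<alpha>)) ` A1_hom R (tkk_ja R J) (K, h, e, f)"
      using lift.tkk_restrict_lift by force
  qed
qed

lemma tkk_ja_adjunction:
  "naturally_isomorphic (ja_cat R) (A1_cat R) (hom_from_tkk_ja R) (hom_to_ja R)"
  unfolding naturally_isomorphic_def
proof (intro exI[of _ "\<lambda>J LS \<alpha>. snd (tkk_restrict R (jp_of_ja J) \<alpha>)"] conjI ballI)
  show "bij_betw (\<lambda>\<alpha>. snd (tkk_restrict R (jp_of_ja J) \<alpha>)) (bi_set (hom_from_tkk_ja R) J A) (bi_set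
      (hom_to_ja R) J A)"
    if "J \<in> Ob (ja_cat R)" "A \<in> Ob (A1_cat R)" for J A
    using that
    by (cases A) (simp add: hom_from_tkk_ja_def hom_to_ja_def tkk_ja_bij flip: jordan_algebra_iff A1_iff)
  fix J J' A A' \<gamma> \<beta> \<alpha>
  assume "J \<in> Ob (ja_cat R)" "J' \<in> Ob (ja_cat R)" and A: "A \<in> Ob (A1_cat R)" and "A' \<in> Ob (A1_cat R)"
    and "\<gamma> \<in> Hom (ja_cat R) J' J" "\<beta> \<in> Hom (A1_cat R) A A'" "\<alpha> \<in> bi_set (hom_from_tkk_ja R) J A"
  then have J: "jordan_algebra R J" and J': "jordan_algebra R J'" and \<gamma>: "\<gamma> \<in> ja_hom R J' J"
    and \<alpha>: "\<alpha> \<in> A1_hom R (tkk_ja R J) A"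
    by (simp_all add: jordan_algebra_iff) (simp_all add: ja_cat_def hom_from_tkk_ja_def)
  obtain K h e f where K: "A = (K, h, e, f)" "A1 R K h e f"
    using A by (cases A) (auto simp: A1_iff)
  interpret J: jordan_algebra R J by (rule J)
  interpret J': jordan_algebra R J' by (rule J')
  interpret K: A1 R K h e f by (rule K)
  interpret hom: jpair_hom R "jp_of_ja J'" "jp_of_ja J" "(\<gamma>, \<gamma>)"
    by unfold_locales (rule ja_hom_jp_hom[OF J' J \<gamma>])
  have "\<alpha> \<in> graded_hom R J.P.L K.G"
    using A1_hom_graded(1)[OF J.lie_LJ K.lie_algebra _ \<alpha>[unfolded J.tkk_ja_eq K(1)]] J.hef_closed(1)
    by (simp add: J.h_graded_tkk)
  then have "\<alpha> (J.P.inp b) \<in> h_grade K h 1" if "b \<in> carrier J" for b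
    using graded_hom_grade[of \<alpha> R J.P.L K.G _ 1, OF _ J.P.inm_inp_closed(4)] that by simp
  then show "snd (tkk_restrict R (jp_of_ja J') (bi_map (hom_from_tkk_ja R) J' J A A' \<gamma> \<beta> \<alpha>)) =
      bi_map (hom_to_ja R) J' J A A' \<gamma> \<beta> (snd (tkk_restrict R (jp_of_ja J) \<alpha>))"
    using hom.tkk_map_inp J'.P.inm_inp_closed(2) hom.\<gamma>_closed(2)
    by (auto simp: tkk_restrict_def hom_from_tkk_ja_def hom_to_ja_def ja_of_A1_map_def tkk_ja_map_def
        J'.tkk_ja_eq
      compose_def fun_eq_iff K(1))
qed

lemma tkk_ja_faithful: "is_faithful (ja_cat R) (tkk_ja_map R)"
  unfolding is_faithful_def inj_on_def
proof (intro ballI impI)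
  fix J K f g assume "J \<in> Ob (ja_cat R)" "K \<in> Ob (ja_cat R)" "f \<in> Hom (ja_cat R) J K" "g \<in> Hom (ja_cat R)
      J K"
    and eq: "tkk_ja_map R J K f = tkk_ja_map R J K g"
  then have J: "jordan_algebra R J" and K: "jordan_algebra R K" and fg: "f \<in> ja_hom R J K" "g \<in> ja_hom R
      J K"
    by (simp_all add: jordan_algebra_iff) (simp_all add: ja_cat_def)
  have "(f, f) = (g, g)"
    by (rule tkk_map_inj[OF jordan_algebra.jordan_pair_ja[OF J] jordan_algebra.jordan_pair_ja[OF K]
        ja_hom_jp_hom[OF J K fg(1)] ja_hom_jp_hom[OF J K fg(2)]])
      (use eq in \<open>simp add: tkk_ja_map_def\<close>)
  then show "f = g" by simp
qed

text \<open>
  A morphism respecting \<open>1\<^sub>-\<close> and \<open>2\<^sub>+\<close> has equal components on the Jordan pair, as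
  \<open>a\<^sub>- = {1\<^sub>-, a\<^sub>+, 1\<^sub>-}\<close>.
\<close>

lemma tkk_ja_full: "is_full (ja_cat R) (A1_cat R) (tkk_ja R) (tkk_ja_map R)"
  unfolding is_full_def
proof (intro ballI subsetI)
  fix J K \<alpha> assume "J \<in> Ob (ja_cat R)" "K \<in> Ob (ja_cat R)" "\<alpha> \<in> Hom (A1_cat R) (tkk_ja R J) (tkk_ja R K)"
  then have J: "jordan_algebra R J" and K: "jordan_algebra R K" and \<alpha>: "\<alpha> \<in> A1_hom R (tkk_ja R J) (tkk_ja
      R K)"
    by (simp_all add: jordan_algebra_iff) (simp_all add: A1_cat_def)
  interpret J: jordan_algebra R J by (rule J)
  interpret K: jordan_algebra R K by (rule K)
  have gr: "\<alpha> \<in> graded_hom R J.P.L K.P.L" and e: "\<alpha> J.eJ = K.eJ" and f: "\<alpha> J.fJ = K.fJ"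
    using A1_hom_graded[OF J.lie_LJ K.lie_LJ _ \<alpha>[unfolded J.tkk_ja_eq K.tkk_ja_eq]] J.hef_closed(1)
    by (simp_all add: J.h_graded_tkk K.h_graded_tkk)
  from tkk_map_surj[OF J.jordan_pair_ja K.jordan_pair_ja gr]
  obtain \<gamma> where \<gamma>: "\<gamma> \<in> jp_hom R (jp_of_ja J) (jp_of_ja K)" "\<alpha> = tkk_map R (jp_of_ja J) (jp_of_ja K) \<gamma>"
      .
  interpret jpair_hom R "jp_of_ja J" "jp_of_ja K" \<gamma> by unfold_locales (rule \<gamma>)
  have m1: "fst \<gamma> \<one>\<^bsub>J\<^esub> = \<one>\<^bsub>K\<^esub>"
    using f tkk_map_inm[of "\<one>\<^bsub>J\<^esub>"] by (simp add: \<gamma>(2))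
  have p2: "snd \<gamma> J.two_J = K.two_J"
    using e tkk_map_inp[of J.two_J] by (simp add: \<gamma>(2))
  have lin: "linear_map R J K (snd \<gamma>)"
    using jp_homD(4)[OF hom] by (simp add: linear_map_def)
  have p1: "snd \<gamma> \<one>\<^bsub>J\<^esub> = \<one>\<^bsub>K\<^esub>"
    by (rule module_double_cancel[OF K.module_J two])
      (use p2 linear_map_add[OF lin, of "\<one>\<^bsub>J\<^esub>" "\<one>\<^bsub>J\<^esub>"] linear_map_closed[OF lin] in simp_all)
  have "fst \<gamma> a = snd \<gamma> a" for a
  proof (cases "a \<in> carrier J")
    case True
    then show ?thesis
      using jp_homD(5)[OF hom, of "\<one>\<^bsub>J\<^esub>" a "\<one>\<^bsub>J\<^esub>"] linear_map_closed[OF lin True]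
        by (simp add: m1 J.one_tr_one K.one_tr_one)
  next
    case False
    then show ?thesis using jp_homD(1,3)[OF hom] by (simp add: extensional_def)
  qed
  then have eq: "\<gamma> = (snd \<gamma>, snd \<gamma>)" by (simp add: prod_eq_iff fun_eq_iff)
  have "snd \<gamma> \<in> ja_hom R J K"
  proof (rule ja_homI[OF _ lin _ p1])
    show "snd \<gamma> (a \<otimes>\<^bsub>J\<^esub> b) = snd \<gamma> a \<otimes>\<^bsub>K\<^esub> snd \<gamma> b" if "a \<in> carrier J" "b \<in> carrier J" for a b
      using that jp_homD(6)[OF hom, of a "\<one>\<^bsub>J\<^esub>" b] linear_map_closed[OF lin]
      by (simp add: m1 J.tr_one K.tr_one)
  qed (use jp_homD(3)[OF hom] in simp)
  moreover have "\<alpha> = tkk_ja_map R J K (snd \<gamma>)"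
    using \<gamma>(2) eq by (simp add: tkk_ja_map_def)
  ultimately show "\<alpha> \<in> tkk_ja_map R J K ` Hom (ja_cat R) J K"
    by (simp add: ja_cat_def)
qed

end

theorem mainTheorem6:
  fixes R :: "('k, 'r) ring_scheme"
  assumes "cring R" and "no_torsion R 2" and "no_torsion R 3"
  shows
    "(is_functor (jp_cat R :: ('k, 'a, 'b) jp_category) (gla_cat R) (tkk R) (tkk_map R) \<and>
      is_functor (gla_cat R :: ('k, 'l) gla_category) (jp_cat R) jp_of_gla jp_of_gla_map \<and>
      naturally_isomorphic (jp_cat R :: ('k, 'a, 'b) jp_category) (gla_cat R :: ('k, 'l) gla_category)
        (hom_from_tkk R) (hom_to_jp R) \<and>
      is_full (jp_cat R :: ('k, 'a, 'b) jp_category) (gla_cat R) (tkk R) (tkk_map R) \<and>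
      is_faithful (jp_cat R :: ('k, 'a, 'b) jp_category) (tkk_map R)) \<and>
     (is_functor (jts_cat R :: ('k, 'a) jts_category) (igla_cat R) (tkk_jts R) (tkk_jts_map R) \<and>
      is_functor (igla_cat R :: ('k, 'l) igla_category) (jts_cat R) jts_of_igla jts_of_igla_map \<and>
      naturally_isomorphic (jts_cat R :: ('k, 'a) jts_category) (igla_cat R :: ('k, 'l) igla_category)
        (hom_from_tkk_jts R) (hom_to_jts R) \<and>
      is_full (jts_cat R :: ('k, 'a) jts_category) (igla_cat R) (tkk_jts R) (tkk_jts_map R) \<and>
      is_faithful (jts_cat R :: ('k, 'a) jts_category) (tkk_jts_map R)) \<and>
     ([(2::nat)] \<cdot>\<^bsub>R\<^esub> \<one>\<^bsub>R\<^esub> \<in> Units R \<and> [(3::nat)] \<cdot>\<^bsub>R\<^esub> \<one>\<^bsub>R\<^esub> \<in> Units R \<longrightarrow>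
      is_functor (ja_cat R :: ('k, 'a) ja_category) (A1_cat R) (tkk_ja R) (tkk_ja_map R) \<and>
      is_functor (A1_cat R :: ('k, 'l) A1_category) (ja_cat R) (ja_of_A1 R) ja_of_A1_map \<and>
      naturally_isomorphic (ja_cat R :: ('k, 'a) ja_category) (A1_cat R :: ('k, 'l) A1_category)
        (hom_from_tkk_ja R) (hom_to_ja R) \<and>
      is_full (ja_cat R :: ('k, 'a) ja_category) (A1_cat R) (tkk_ja R) (tkk_ja_map R) \<and>
      is_faithful (ja_cat R :: ('k, 'a) ja_category) (tkk_ja_map R))"
  by (intro conjI impI tkk_functor jp_of_gla_functor tkk_adjunction tkk_full tkk_faithful
    tkk_jts_functor jts_of_igla_functor tkk_jts_adjunction tkk_jts_full tkk_jts_faithful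
    tkk_ja_functor ja_of_A1_functor tkk_ja_adjunction tkk_ja_full tkk_ja_faithful) simp_all

end
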